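(* The cut rule is admissible in $LG^\omega$: every sequent $\Sigma;\Gamma\vdash C$ that has a derivation in $LG^\omega$ (possibly using the multicut rule $mc$) also has a derivation in $LG^\omega$ that does not use $mc$.
   Context: Logic $LG^\omega$. Terms: Church's simply typed $\lambda$-calculus; formulas have type $o$; quantifier types do not contain $o$. There are distinguished nominal types, each with infinitely many nominal constants, plus a set $\mathcal K$ of other constants. A permutation $\pi$ is a finite type-preserving bijection on nominal constants, acting on terms by $\pi.t$. $supp(t)$ = set of nominal constants in $t$. $\Sigma$-substitutions map variables to terms with no nominal constants; $\Sigma\theta$ is the resulting signature. Sequents: $\Sigma;\Gamma\vdash C$, $\Gamma$ a multiset, free variables among $\Sigma$. Rules: $id_\pi$ ($\Sigma;\Gamma,B\vdash B'$ if $\pi.B=\pi'.B'$ for some permutations); multicut $mc$ (from $\Sigma;\Delta_i\vdash B_i$, $i=1..n$, and $\Sigma;B_1..B_n,\Gamma\vdash C$ infer $\Sigma;\Delta_1..\Delta_n,\Gamma\vdash C$); contraction $cL$; $\bot L$, $\top R$; usual intuitionistic $\land,\lor,\supset$ rules; $\forall L$, $\exists R$ instantiate with any well-typed term over $\Sigma$, $\mathcal K$ and nominal constants; $\forall R$ (resp. $\exists L$): from $\Sigma,h;\Gamma\vdash B[h\,\vec c/x]$ infer $\Sigma;\Gamma\vdash\forall x.B$ (dually on the left for $\exists$), $h\notin\Sigma$, $\vec c=c_1{:}\iota_1..c_n{:}\iota_n$ listing $supp(B)$, $h:\iota_1\to\dots\to\iota_n\to\tau$; $\nabla L,\nabla R$: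 replace the $\nabla$-bound variable (of nominal type) by a nominal constant $a\notin supp(B)$; $eqR$: $\Sigma;\Gamma\vdash t=t$; $eqL$: from premises $\Sigma\theta;\Gamma\theta\vdash C\theta$ for every $\Sigma$-substitution $\theta$ with $(\lambda\vec c.s)\theta=_{\beta\eta}(\lambda\vec c.t)\theta$, $\vec c$ listing $supp(s=t)$, infer $\Sigma;\Gamma,s=t\vdash C$; definitions: a set of definition clauses $\forall\vec x.p\,\vec x\stackrel{\triangle}{=}B$, each stratified, i.e. each predicate has a natural-number level, with $lvl(p\,\vec t)=lvl(p)$, $lvl(\bot)=lvl(\top)=0$, $lvl(B\land C)=lvl(B\lor C)=\max(lvl B,lvl C)$, $lvl(B\supset C)=\max(lvl(B)+1,lvl(C))$, quantifiers preserve level, and required $lvl(B)\le lvl(p)$ and $B$ free of nominal constants; $defL$: from $\Gamma,B[\vec t/\vec x]\vdash C$ infer $\Gamma,p\,\vec t\vdash C$; $defR$: from $\Gamma\vdash B[\vec t/\vec x]$ infer $\Gamma\vdash p\,\vec t$; natural numbers: $z:nt$, $s:nt\to nt$, predicate $nat$; $natR$: $\Sigma;\Gamma\vdash nat\,z$, and from $\Sigma;\Gamma\vdash nat\,I$ infer $\Sigma;\Gamma\vdash nat\,(s\,I)$; $natL$: from $\vdash D\,z$, $j;D\,j\vdash D\,(s\,j)$ and $\Sigma;\Gamma,D\,I\vdash C$ infer $\Sigma;\Gamma,nat\,I\vdash C$.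
   Formalization: A definition is taken to contain at most one clause per predicate (and none for nat); with two clauses such as p≜⊤ and p≜⊥, the sequent ⊢⊥ would be derivable with mc but not without it. *)

theory Defs
  imports "HOL-Library.Multiset"
begin

section \<open>Simply typed lambda-terms\<close>

datatype 'b ty =
    Base 'b
  | Prop     \<comment> \<open>the type \<open>o\<close> of formulas\<close>
  | Nt       \<comment> \<open>the type of natural numbers\<close>
  | Arr "'b ty" "'b ty"  (infixr \<open>\<rightarrow>\<close> 60)

primrec o_free :: "'b ty \<Rightarrow> bool" where
  "o_free (Base b) = True"
| "o_free Prop = False"
| "o_free Nt = True"
| "o_free (\<sigma> \<rightarrow> \<tau>) = (o_free \<sigma> \<and> o_free \<tau>)"

text \<open>A variable carries its type, so a signature is just a finite set of variables.\<close>

type_synonym 'b var = "nat \<times> 'b ty"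

datatype ('b, 'k) cst =
    K 'k
  | CZero | CSucc | CNat
  | CBot | CTop | CConj | CDisj | CImp
  | CEq "'b ty" | CAll "'b ty" | CEx "'b ty" | CNabla "'b ty"

text \<open>
  Terms are locally nameless: \<open>Bound\<close> is a de Bruijn index, \<open>Var\<close> a free variable (one that a
  signature may declare), \<open>Nom\<close> a nominal constant.  The functions \<open>supp\<close> (nominal constants
  occurring in a term) and \<open>perm\<close> (renaming of nominal constants) are generated by the datatype.
\<close>

datatype (dead 'b, dead 'k, supp: 'n) tm =
    Bound nat
  | Var "'b var"
  | Nom 'n
  | Cst "('b, 'k) cst"
  | App "('b, 'k, 'n) tm" "('b, 'k, 'n) tm"  (infixl \<open>\<cdot>\<close> 70)
  | Lam "'b ty" "('b, 'k, 'n) tm"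
  for map: perm

abbreviation apps :: "('b, 'k, 'n) tm \<Rightarrow> ('b, 'k, 'n) tm list \<Rightarrow> ('b, 'k, 'n) tm" where
  "apps t us \<equiv> foldl App t us"

primrec fv :: "('b, 'k, 'n) tm \<Rightarrow> 'b var set" where
  "fv (Bound i) = {}"
| "fv (Var x) = {x}"
| "fv (Nom a) = {}"
| "fv (Cst c) = {}"
| "fv (t \<cdot> u) = fv t \<union> fv u"
| "fv (Lam \<tau> t) = fv t"

subsection \<open>Beta-eta normal forms\<close>

primrec lift :: "nat \<Rightarrow> ('b, 'k, 'n) tm \<Rightarrow> ('b, 'k, 'n) tm" where
  "lift k (Bound i) = (if i < k then Bound i else Bound (Suc i))"
| "lift k (Var x) = Var x"
| "lift k (Nom a) = Nom a"
| "lift k (Cst c) = Cst c"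
| "lift k (t \<cdot> u) = lift k t \<cdot> lift k u"
| "lift k (Lam \<tau> t) = Lam \<tau> (lift (Suc k) t)"

primrec subst_bound :: "nat \<Rightarrow> ('b, 'k, 'n) tm \<Rightarrow> ('b, 'k, 'n) tm \<Rightarrow> ('b, 'k, 'n) tm" where
  "subst_bound k u (Bound i) = (if i < k then Bound i else if i = k then u else Bound (i - 1))"
| "subst_bound k u (Var x) = Var x"
| "subst_bound k u (Nom a) = Nom a"
| "subst_bound k u (Cst c) = Cst c"
| "subst_bound k u (s \<cdot> t) = subst_bound k u s \<cdot> subst_bound k u t"
| "subst_bound k u (Lam \<tau> t) = Lam \<tau> (subst_bound (Suc k) (lift 0 u) t)"

inductive red :: "('b, 'k, 'n) tm \<Rightarrow> ('b, 'k, 'n) tm \<Rightarrow> bool" where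
  beta: "red (Lam \<tau> t \<cdot> u) (subst_bound 0 u t)"
| eta: "red (Lam \<tau> (lift 0 t \<cdot> Bound 0)) t"
| appL: "red s s' \<Longrightarrow> red (s \<cdot> t) (s' \<cdot> t)"
| appR: "red t t' \<Longrightarrow> red (s \<cdot> t) (s \<cdot> t')"
| lam: "red t t' \<Longrightarrow> red (Lam \<tau> t) (Lam \<tau> t')"

definition normal :: "('b, 'k, 'n) tm \<Rightarrow> bool" where
  "normal t \<longleftrightarrow> (\<nexists>u. red t u)"

text \<open>
  Terms are identified up to beta-eta-conversion by letting sequents contain normal terms only and
  by normalizing the results of application and substitution.  On well-typed terms, the only ones
  to which \<open>nf\<close> is applied below, normal forms exist and are unique.  Reduction rather than
  conversion is used in \<open>nf\<close> because conversion through ill-typed terms would identify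
  abstractions with different type annotations.
\<close>

definition nf :: "('b, 'k, 'n) tm \<Rightarrow> ('b, 'k, 'n) tm" where
  "nf t = (THE u. red\<^sup>*\<^sup>* t u \<and> normal u)"

subsection \<open>Substitution for variables and abstraction over nominal constants\<close>

text \<open>
  Neither function shifts indices: substituted terms, and the terms whose nominal constants are
  abstracted, are always closed with respect to \<open>Bound\<close>.
\<close>

primrec msubst :: "('b var \<Rightarrow> ('b, 'k, 'n) tm) \<Rightarrow> ('b, 'k, 'n) tm \<Rightarrow> ('b, 'k, 'n) tm" where
  "msubst \<theta> (Bound i) = Bound i"
| "msubst \<theta> (Var x) = \<theta> x"
| "msubst \<theta> (Nom a) = Nom a"
| "msubst \<theta> (Cst c) = Cst c"
| "msubst \<theta> (t \<cdot> u) = msubst \<theta> t \<cdot> msubst \<theta> u"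
| "msubst \<theta> (Lam \<tau> t) = Lam \<tau> (msubst \<theta> t)"

definition inst :: "('b, 'k, 'n) tm \<Rightarrow> 'b var list \<Rightarrow> ('b, 'k, 'n) tm list \<Rightarrow> ('b, 'k, 'n) tm" where
  "inst B xs ts =
     nf (msubst (\<lambda>x. case map_of (zip xs ts) x of Some t \<Rightarrow> t | None \<Rightarrow> Var x) B)"

definition subst_sig ::
  "('b var \<Rightarrow> ('b, 'k, 'n) tm) \<Rightarrow> 'b var set \<Rightarrow> 'b var set" where
  "subst_sig \<theta> \<Sigma> = (\<Union>x\<in>\<Sigma>. fv (\<theta> x))"

primrec bind_nom :: "'n \<Rightarrow> nat \<Rightarrow> ('b, 'k, 'n) tm \<Rightarrow> ('b, 'k, 'n) tm" where
  "bind_nom a k (Bound i) = Bound i"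
| "bind_nom a k (Var x) = Var x"
| "bind_nom a k (Nom b) = (if a = b then Bound k else Nom b)"
| "bind_nom a k (Cst c) = Cst c"
| "bind_nom a k (t \<cdot> u) = bind_nom a k t \<cdot> bind_nom a k u"
| "bind_nom a k (Lam \<tau> t) = Lam \<tau> (bind_nom a (Suc k) t)"

subsection \<open>Formulas\<close>

abbreviation "Zero \<equiv> Cst CZero"
abbreviation "Succ t \<equiv> Cst CSucc \<cdot> t"
abbreviation "NatP t \<equiv> Cst CNat \<cdot> t"
abbreviation "Bot \<equiv> Cst CBot"
abbreviation "Top \<equiv> Cst CTop"
abbreviation "Conj B C \<equiv> Cst CConj \<cdot> B \<cdot> C"
abbreviation "Disj B C \<equiv> Cst CDisj \<cdot> B \<cdot> C"
abbreviation "Imp B C \<equiv> Cst CImp \<cdot> B \<cdot> C"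
abbreviation "Eq \<tau> s t \<equiv> Cst (CEq \<tau>) \<cdot> s \<cdot> t"
abbreviation "Atom p ts \<equiv> apps (Cst (K p)) ts"

text \<open>
  The argument of a quantifier is a term of type \<open>\<tau> \<rightarrow> Prop\<close>, which need not be an abstraction
  since normal forms are eta-short.  The instance \<open>B[t/x]\<close> of \<open>\<forall>x. B\<close>, written
  \<open>Forall \<tau> F\<close>, is therefore \<open>nf (F \<cdot> t)\<close>, and \<open>supp B\<close> is \<open>supp F\<close>.
\<close>

abbreviation "Forall \<tau> F \<equiv> Cst (CAll \<tau>) \<cdot> F"
abbreviation "Exists \<tau> F \<equiv> Cst (CEx \<tau>) \<cdot> F"
abbreviation "Nabla \<tau> F \<equiv> Cst (CNabla \<tau>) \<cdot> F"

text \<open>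
  The level of a normal formula, given levels for the predicates: \<open>level_args l t ns\<close> is the level
  of \<open>t\<close> applied to arguments whose levels are \<open>ns\<close>.  The levels of the arguments of an atom or
  an equation are irrelevant; equations have level 0.
\<close>

fun level_cst :: "('k \<Rightarrow> nat) \<Rightarrow> nat \<Rightarrow> ('b, 'k) cst \<Rightarrow> nat list \<Rightarrow> nat" where
  "level_cst l ln (K p) ns = l p"
| "level_cst l ln CNat ns = ln"
| "level_cst l ln CConj [m, n] = max m n"
| "level_cst l ln CDisj [m, n] = max m n"
| "level_cst l ln CImp [m, n] = max (m + 1) n"
| "level_cst l ln (CAll \<tau>) [n] = n"
| "level_cst l ln (CEx \<tau>) [n] = n"
| "level_cst l ln (CNabla \<tau>) [n] = n"
| "level_cst l ln _ _ = 0"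

primrec level_args :: "('k \<Rightarrow> nat) \<Rightarrow> nat \<Rightarrow> ('b, 'k, 'n) tm \<Rightarrow> nat list \<Rightarrow> nat" where
  "level_args l ln (Bound i) ns = 0"
| "level_args l ln (Var x) ns = 0"
| "level_args l ln (Nom a) ns = 0"
| "level_args l ln (Cst c) ns = level_cst l ln c ns"
| "level_args l ln (t \<cdot> u) ns = level_args l ln t (level_args l ln u [] # ns)"
| "level_args l ln (Lam \<tau> t) ns = level_args l ln t []"

definition level :: "('k \<Rightarrow> nat) \<Rightarrow> nat \<Rightarrow> ('b, 'k, 'n) tm \<Rightarrow> nat" where
  "level l ln B = level_args l ln B []"

lemma level_simps:
  "level l ln (Atom p ts) = l p"
  "level l ln (NatP t) = ln"
  "level l ln Bot = 0"
  "level l ln Top = 0"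
  "level l ln (Eq \<tau> s t) = 0"
  "level l ln (Conj B C) = max (level l ln B) (level l ln C)"
  "level l ln (Disj B C) = max (level l ln B) (level l ln C)"
  "level l ln (Imp B C) = max (level l ln B + 1) (level l ln C)"
  "level l ln (Forall \<tau> (Lam \<tau> B)) = level l ln B"
  "level l ln (Exists \<tau> (Lam \<tau> B)) = level l ln B"
  "level l ln (Nabla \<tau> (Lam \<tau> B)) = level l ln B"
proof -
  have "level_args l ln (Atom p ts) ns = l p" for ns
    by (induction ts arbitrary: ns rule: rev_induct) auto
  then show "level l ln (Atom p ts) = l p"
    by (simp add: level_def)
qed (simp_all add: level_def)

section \<open>Sequents and derivations\<close>

datatype ('b, 'k, 'n) sequent =
  Sequent "'b var set" "('b, 'k, 'n) tm multiset" "('b, 'k, 'n) tm"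
    (\<open>(_;;/ _ \<turnstile>/ _)\<close> [51, 51, 51] 50)

text \<open>
  Derivability in a calculus given by a relation between (possibly infinite) sets of premises and
  conclusions.
\<close>

inductive derivable :: "('s set \<Rightarrow> 's \<Rightarrow> bool) \<Rightarrow> 's \<Rightarrow> bool" for R where
  "R Ps S \<Longrightarrow> (\<And>P. P \<in> Ps \<Longrightarrow> derivable R P) \<Longrightarrow> derivable R S"

text \<open>
  The logic is parameterized by the types of the constants in \<open>K\<close> and of the nominal constants,
  the set of nominal types, and the definition.  A definition maps a predicate \<open>p\<close> to
  \<open>Some (xs, B)\<close> if it contains the clause \<open>\<forall>xs. p xs \<triangleq> B\<close>; so a predicate has at most one
  clause, without which cut would not be admissible.
\<close>

locale LG =
  fixes ktype :: "'k \<Rightarrow> 'b ty"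
    and ntype :: "'n \<Rightarrow> 'b ty"
    and nominal :: "'b ty set"
    and clause :: "'k \<Rightarrow> ('b var list \<times> ('b, 'k, 'n) tm) option"
begin

primrec cst_type :: "('b, 'k) cst \<Rightarrow> 'b ty" where
  "cst_type (K k) = ktype k"
| "cst_type CZero = Nt"
| "cst_type CSucc = Nt \<rightarrow> Nt"
| "cst_type CNat = Nt \<rightarrow> Prop"
| "cst_type CBot = Prop"
| "cst_type CTop = Prop"
| "cst_type CConj = Prop \<rightarrow> Prop \<rightarrow> Prop"
| "cst_type CDisj = Prop \<rightarrow> Prop \<rightarrow> Prop"
| "cst_type CImp = Prop \<rightarrow> Prop \<rightarrow> Prop"
| "cst_type (CEq \<tau>) = \<tau> \<rightarrow> \<tau> \<rightarrow> Prop"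
| "cst_type (CAll \<tau>) = (\<tau> \<rightarrow> Prop) \<rightarrow> Prop"
| "cst_type (CEx \<tau>) = (\<tau> \<rightarrow> Prop) \<rightarrow> Prop"
| "cst_type (CNabla \<tau>) = (\<tau> \<rightarrow> Prop) \<rightarrow> Prop"

fun cst_ok :: "('b, 'k) cst \<Rightarrow> bool" where
  "cst_ok (CAll \<tau>) = o_free \<tau>"
| "cst_ok (CEx \<tau>) = o_free \<tau>"
| "cst_ok (CNabla \<tau>) = (\<tau> \<in> nominal)"
| "cst_ok _ = True"

inductive has_type :: "'b ty list \<Rightarrow> ('b, 'k, 'n) tm \<Rightarrow> 'b ty \<Rightarrow> bool" where
  "i < length \<Delta> \<Longrightarrow> has_type \<Delta> (Bound i) (\<Delta> ! i)"
| "has_type \<Delta> (Var x) (snd x)"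
| "ntype a \<in> nominal \<Longrightarrow> has_type \<Delta> (Nom a) (ntype a)"
| "cst_ok c \<Longrightarrow> has_type \<Delta> (Cst c) (cst_type c)"
| "has_type \<Delta> t (\<sigma> \<rightarrow> \<tau>) \<Longrightarrow> has_type \<Delta> u \<sigma> \<Longrightarrow> has_type \<Delta> (t \<cdot> u) \<tau>"
| "has_type (\<sigma> # \<Delta>) t \<tau> \<Longrightarrow> has_type \<Delta> (Lam \<sigma> t) (\<sigma> \<rightarrow> \<tau>)"

definition is_term :: "'b var set \<Rightarrow> ('b, 'k, 'n) tm \<Rightarrow> 'b ty \<Rightarrow> bool" where
  "is_term \<Sigma> t \<tau> \<longleftrightarrow> has_type [] t \<tau> \<and> normal t \<and> fv t \<subseteq> \<Sigma>"

text \<open>Signatures declare eigenvariables, whose types are those of quantified variables.\<close>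

definition is_sig :: "'b var set \<Rightarrow> bool" where
  "is_sig \<Sigma> \<longleftrightarrow> finite \<Sigma> \<and> (\<forall>x\<in>\<Sigma>. o_free (snd x))"

fun is_sequent :: "('b, 'k, 'n) sequent \<Rightarrow> bool" where
  "is_sequent (\<Sigma>;; \<Gamma> \<turnstile> C) \<longleftrightarrow>
     is_sig \<Sigma> \<and> (\<forall>B\<in>#\<Gamma>. is_term \<Sigma> B Prop) \<and> is_term \<Sigma> C Prop"

definition is_perm :: "('n \<Rightarrow> 'n) \<Rightarrow> bool" where
  "is_perm \<pi> \<longleftrightarrow> bij \<pi> \<and> finite {a. \<pi> a \<noteq> a} \<and> (\<forall>a. ntype (\<pi> a) = ntype a)"

definition is_subst :: "'b var set \<Rightarrow> ('b var \<Rightarrow> ('b, 'k, 'n) tm) \<Rightarrow> bool" where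
  "is_subst \<Sigma> \<theta> \<longleftrightarrow>
     is_sig (subst_sig \<theta> \<Sigma>) \<and>
     (\<forall>x\<in>\<Sigma>. is_term (subst_sig \<theta> \<Sigma>) (\<theta> x) (snd x) \<and> supp (\<theta> x) = {})"

definition abs_noms :: "'n list \<Rightarrow> ('b, 'k, 'n) tm \<Rightarrow> ('b, 'k, 'n) tm" where
  "abs_noms cs t = foldr (\<lambda>c u. Lam (ntype c) (bind_nom c 0 u)) cs t"

definition lists_supp :: "'n list \<Rightarrow> ('b, 'k, 'n) tm \<Rightarrow> bool" where
  "lists_supp cs t \<longleftrightarrow> distinct cs \<and> set cs = supp t"

text \<open>The type of the eigenvariable \<open>h\<close> that is applied to the nominal constants \<open>cs\<close>.\<close>

definition raised :: "'n list \<Rightarrow> 'b ty \<Rightarrow> 'b ty" where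
  "raised cs \<tau> = foldr (\<lambda>c \<sigma>. ntype c \<rightarrow> \<sigma>) cs \<tau>"

inductive LG_rule :: "('b, 'k, 'n) sequent set \<Rightarrow> ('b, 'k, 'n) sequent \<Rightarrow> bool" where
  id_perm: "is_perm \<pi> \<Longrightarrow> is_perm \<pi>' \<Longrightarrow> perm \<pi> B = perm \<pi>' B' \<Longrightarrow>
    LG_rule {} (\<Sigma>;; add_mset B \<Gamma> \<turnstile> B')"
| cL: "LG_rule {\<Sigma>;; add_mset B (add_mset B \<Gamma>) \<turnstile> C} (\<Sigma>;; add_mset B \<Gamma> \<turnstile> C)"
| botL: "LG_rule {} (\<Sigma>;; add_mset Bot \<Gamma> \<turnstile> C)"
| topR: "LG_rule {} (\<Sigma>;; \<Gamma> \<turnstile> Top)"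
| andL1: "LG_rule {\<Sigma>;; add_mset B \<Gamma> \<turnstile> D} (\<Sigma>;; add_mset (Conj B C) \<Gamma> \<turnstile> D)"
| andL2: "LG_rule {\<Sigma>;; add_mset C \<Gamma> \<turnstile> D} (\<Sigma>;; add_mset (Conj B C) \<Gamma> \<turnstile> D)"
| andR: "LG_rule {\<Sigma>;; \<Gamma> \<turnstile> B, \<Sigma>;; \<Gamma> \<turnstile> C} (\<Sigma>;; \<Gamma> \<turnstile> Conj B C)"
| orL: "LG_rule {\<Sigma>;; add_mset B \<Gamma> \<turnstile> D, \<Sigma>;; add_mset C \<Gamma> \<turnstile> D}
    (\<Sigma>;; add_mset (Disj B C) \<Gamma> \<turnstile> D)"
| orR1: "LG_rule {\<Sigma>;; \<Gamma> \<turnstile> B} (\<Sigma>;; \<Gamma> \<turnstile> Disj B C)"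
| orR2: "LG_rule {\<Sigma>;; \<Gamma> \<turnstile> C} (\<Sigma>;; \<Gamma> \<turnstile> Disj B C)"
| impL: "LG_rule {\<Sigma>;; \<Gamma> \<turnstile> B, \<Sigma>;; add_mset C \<Gamma> \<turnstile> D} (\<Sigma>;; add_mset (Imp B C) \<Gamma> \<turnstile> D)"
| impR: "LG_rule {\<Sigma>;; add_mset B \<Gamma> \<turnstile> C} (\<Sigma>;; \<Gamma> \<turnstile> Imp B C)"
| allL: "is_term \<Sigma> t \<tau> \<Longrightarrow>
    LG_rule {\<Sigma>;; add_mset (nf (F \<cdot> t)) \<Gamma> \<turnstile> C} (\<Sigma>;; add_mset (Forall \<tau> F) \<Gamma> \<turnstile> C)"
| allR: "lists_supp cs F \<Longrightarrow> h = (n, raised cs \<tau>) \<Longrightarrow> h \<notin> \<Sigma> \<Longrightarrow>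
    LG_rule {insert h \<Sigma>;; \<Gamma> \<turnstile> nf (F \<cdot> apps (Var h) (map Nom cs))} (\<Sigma>;; \<Gamma> \<turnstile> Forall \<tau> F)"
| exL: "lists_supp cs F \<Longrightarrow> h = (n, raised cs \<tau>) \<Longrightarrow> h \<notin> \<Sigma> \<Longrightarrow>
    LG_rule {insert h \<Sigma>;; add_mset (nf (F \<cdot> apps (Var h) (map Nom cs))) \<Gamma> \<turnstile> C}
      (\<Sigma>;; add_mset (Exists \<tau> F) \<Gamma> \<turnstile> C)"
| exR: "is_term \<Sigma> t \<tau> \<Longrightarrow>
    LG_rule {\<Sigma>;; \<Gamma> \<turnstile> nf (F \<cdot> t)} (\<Sigma>;; \<Gamma> \<turnstile> Exists \<tau> F)"
| nablaL: "ntype a = \<tau> \<Longrightarrow> a \<notin> supp F \<Longrightarrow>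
    LG_rule {\<Sigma>;; add_mset (nf (F \<cdot> Nom a)) \<Gamma> \<turnstile> C} (\<Sigma>;; add_mset (Nabla \<tau> F) \<Gamma> \<turnstile> C)"
| nablaR: "ntype a = \<tau> \<Longrightarrow> a \<notin> supp F \<Longrightarrow>
    LG_rule {\<Sigma>;; \<Gamma> \<turnstile> nf (F \<cdot> Nom a)} (\<Sigma>;; \<Gamma> \<turnstile> Nabla \<tau> F)"
| eqL: "lists_supp cs (Eq \<tau> s t) \<Longrightarrow>
    LG_rule {subst_sig \<theta> \<Sigma>;; image_mset (\<lambda>B. nf (msubst \<theta> B)) \<Gamma> \<turnstile> nf (msubst \<theta> C) | \<theta>.
        is_subst \<Sigma> \<theta> \<and>
        nf (msubst \<theta> (abs_noms cs s)) = nf (msubst \<theta> (abs_noms cs t))}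
      (\<Sigma>;; add_mset (Eq \<tau> s t) \<Gamma> \<turnstile> C)"
| eqR: "LG_rule {} (\<Sigma>;; \<Gamma> \<turnstile> Eq \<tau> t t)"
| defL: "clause p = Some (xs, B) \<Longrightarrow> length ts = length xs \<Longrightarrow>
    LG_rule {\<Sigma>;; add_mset (inst B xs ts) \<Gamma> \<turnstile> C} (\<Sigma>;; add_mset (Atom p ts) \<Gamma> \<turnstile> C)"
| defR: "clause p = Some (xs, B) \<Longrightarrow> length ts = length xs \<Longrightarrow>
    LG_rule {\<Sigma>;; \<Gamma> \<turnstile> inst B xs ts} (\<Sigma>;; \<Gamma> \<turnstile> Atom p ts)"
| natL: "is_term {} D (Nt \<rightarrow> Prop) \<Longrightarrow> j = (n, Nt) \<Longrightarrow>
    LG_rule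
      {{};; {#} \<turnstile> nf (D \<cdot> Zero),
       {j};; {#nf (D \<cdot> Var j)#} \<turnstile> nf (D \<cdot> Succ (Var j)),
       \<Sigma>;; add_mset (nf (D \<cdot> I)) \<Gamma> \<turnstile> C}
      (\<Sigma>;; add_mset (NatP I) \<Gamma> \<turnstile> C)"
| natR_zero: "LG_rule {} (\<Sigma>;; \<Gamma> \<turnstile> NatP Zero)"
| natR_succ: "LG_rule {\<Sigma>;; \<Gamma> \<turnstile> NatP I} (\<Sigma>;; \<Gamma> \<turnstile> NatP (Succ I))"

text \<open>The \<open>i\<close>-th element of \<open>\<Delta>Bs\<close> is the pair of \<open>\<Delta>\<^sub>i\<close> and \<open>B\<^sub>i\<close>.\<close>

inductive multicut :: "('b, 'k, 'n) sequent set \<Rightarrow> ('b, 'k, 'n) sequent \<Rightarrow> bool" where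
  mc: "multicut
     (insert (\<Sigma>;; mset (map snd \<Delta>Bs) + \<Gamma> \<turnstile> C) {\<Sigma>;; \<Delta> \<turnstile> B | \<Delta> B. (\<Delta>, B) \<in> set \<Delta>Bs})
     (\<Sigma>;; sum_list (map fst \<Delta>Bs) + \<Gamma> \<turnstile> C)"

text \<open>Derivations consist of well-formed sequents.\<close>

definition derivable_mc_free :: "('b, 'k, 'n) sequent \<Rightarrow> bool" where
  "derivable_mc_free = derivable (\<lambda>Ps S. is_sequent S \<and> LG_rule Ps S)"

definition derivable_mc :: "('b, 'k, 'n) sequent \<Rightarrow> bool" where
  "derivable_mc = derivable (\<lambda>Ps S. is_sequent S \<and> (LG_rule Ps S \<or> multicut Ps S))"

definition nominal_types_ok :: bool where
  "nominal_types_ok \<longleftrightarrow> (\<forall>\<iota>\<in>nominal. o_free \<iota> \<and> infinite {a. ntype a = \<iota>})"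

text \<open>
  The clauses are well-formed, and stratified with respect to the levels \<open>lvl\<close> of the predicates
  in \<open>K\<close> and \<open>lvl_nat\<close> of \<open>nat\<close>.
\<close>

definition stratified :: "('k \<Rightarrow> nat) \<Rightarrow> nat \<Rightarrow> bool" where
  "stratified lvl lvl_nat \<longleftrightarrow>
     (\<forall>p xs B. clause p = Some (xs, B) \<longrightarrow>
        distinct xs \<and> is_sig (set xs) \<and>
        ktype p = foldr (\<lambda>x \<tau>. snd x \<rightarrow> \<tau>) xs Prop \<and>
        is_term (set xs) B Prop \<and> supp B = {} \<and>
        level lvl lvl_nat B \<le> lvl p)"

end

end

theory Submission
  imports Defs
begin

text \<open>
  The proof is semantic: cut-free provability is obtained from a Kripke-style forcing
  interpretation, as in normalization by evaluation.  Worlds are pairs \<open>(\<Sigma>, \<Gamma>)\<close>; morphisms between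
  them instantiate variables, weaken the assumptions and rename nominal constants.  Disjunctions,
  existentials, equations, defined atoms and \<open>nat\<close> are interpreted in continuation-passing style with
  cut-free derivability as the answer type, which makes forcing closed under the left rules.  Forcing
  is defined by recursion on levels and, within a level, as a least fixed point: by stratification an
  antecedent of an implication has a lower level, whereas unfolding a clause only has to be positive.
  Every assumption is forced and every forced formula is cut-free derivable.  Finally all rules,
  multicut included, preserve forcing.  The valuations used there may contain nominal constants, which
  have to be kept apart from those of each formula of the sequent separately, since every formula
  is only determined up to a permutation of its nominal constants.

  For terms, strong normalization by reducibility and local confluence of well-typed terms make \<open>nf\<close>
  well-behaved.
\<close>

section \<open>Parallel substitution\<close>

text \<open>Morphisms and valuations need different substitutions. The premises of
  \<open>eqL\<close> apply only substitutions without nominal constants, and only such substitutions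
  are compatible with renaming every assumption on its own, so morphisms are restricted to them. But
  \<open>allL\<close> and \<open>exR\<close> instantiate with arbitrary terms, hence an
  eigenvariable of \<open>allR\<close> has to be valid for values with nominal constants.

  Two rules resist this mismatch. A unifier that comes from a valuation must be freed of nominal
  constants before a premise of \<open>eqL\<close> applies to it. And the step premise of
  \<open>natL\<close> cannot be evaluated at a number that shares nominal constants with the
  invariant.

  The invariant of \<open>natL\<close> may also have a higher level than \<open>nat\<close> itself,
  so induction on levels alone cannot justify the rule. Since \<open>nat\<close> is forced through a
  least fixed point, its induction principle serves invariants of every level.\<close>

fun up :: "(('b, 'k, 'n) tm \<Rightarrow> ('b, 'k, 'n) tm) \<Rightarrow> ('b, 'k, 'n) tm \<Rightarrow> ('b, 'k, 'n) tm" where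
  "up s (Bound 0) = Bound 0"
| "up s (Bound (Suc i)) = lift 0 (s (Bound i))"
| "up s t = lift 0 (s t)"

text \<open>A substitution is a function on all terms of which only the values at
  \<open>Bound\<close>, \<open>Var\<close> and \<open>Nom\<close> are consulted. So
  \<open>lift k\<close>, \<open>subst_bound k u\<close>, \<open>bind_nom a k\<close> and
  \<open>perm \<pi>\<close> can themselves be passed as substitutions.\<close>

primrec psubst :: "(('b, 'k, 'n) tm \<Rightarrow> ('b, 'k, 'n) tm) \<Rightarrow> ('b, 'k, 'n) tm \<Rightarrow> ('b, 'k, 'n) tm" where
  "psubst s (Bound i) = s (Bound i)"
| "psubst s (Var x) = s (Var x)"
| "psubst s (Nom a) = s (Nom a)"
| "psubst s (Cst c) = Cst c"
| "psubst s (t \<cdot> u) = psubst s t \<cdot> psubst s u"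
| "psubst s (Lam \<tau> t) = Lam \<tau> (psubst (up s) t)"

lemma psubst_apps: "psubst s (apps t us) = apps (psubst s t) (map (psubst s) us)"
  by (induction us arbitrary: t) auto

lemma psubst_cong:
  assumes "\<And>i. s (Bound i) = s' (Bound i)" "\<And>x. x \<in> fv t \<Longrightarrow> s (Var x) = s' (Var x)"
    "\<And>a. a \<in> supp t \<Longrightarrow> s (Nom a) = s' (Nom a)"
  shows "psubst s t = psubst s' t"
  using assms
proof (induction t arbitrary: s s')
  case (Lam \<tau> t)
  have "psubst (up s) t = psubst (up s') t"
  proof (rule Lam.IH)
    show "up s (Bound i) = up s' (Bound i)" for i
      by (cases i) (auto simp: Lam.prems)
  qed (auto simp: Lam.prems)
  then show ?case by simp
next
  case (App t u)
  have "psubst s t = psubst s' t" "psubst s u = psubst s' u"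
    by (rule App.IH; simp add: App.prems)+
  then show ?case by simp
qed simp_all

text \<open>
  The operations on terms are their own parallel substitutions, which makes the composition law
  \<open>psubst_psubst\<close> apply to all of them.
\<close>

lemma eq_hsI:
  assumes "\<And>i t u. f i (t \<cdot> u) = f i t \<cdot> f i u" "\<And>i c. f i (Cst c) = Cst c"
    "\<And>i \<tau> t. f i (Lam \<tau> t) = Lam \<tau> (f (g i) t)"
    "\<And>i j. up (f i) (Bound j) = f (g i) (Bound j)" "\<And>i x. lift 0 (f i (Var x)) = f (g i) (Var x)"
    "\<And>i a. lift 0 (f i (Nom a)) = f (g i) (Nom a)"
  shows "f i t = psubst (f i) t"
proof (induction t arbitrary: i)
  case (Lam \<tau> t)
  have "psubst (up (f i)) t = psubst (f (g i)) t" by (rule psubst_cong) (simp_all add: assms)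
  then show ?case using Lam assms(3) by simp
qed (simp_all add: assms)

lemma lift_eq_psubst: "lift k t = psubst (lift k) t"
proof (rule eq_hsI[of lift Suc])
  show "up (lift k) (Bound j) = lift (Suc k) (Bound j)" for k j
    by (cases j) auto
qed auto

lemma subst_bound_eq_psubst: "subst_bound k u t = psubst (subst_bound k u) t"
proof -
  let ?f = "\<lambda>(k, u). subst_bound k u" and ?g = "\<lambda>(k, u). (Suc k, lift 0 u)"
  have "?f (k, u) t = psubst (?f (k, u)) t"
  proof (rule eq_hsI[of ?f ?g])
    show "up (?f i) (Bound j) = ?f (?g i) (Bound j)" for i j
      by (cases j) (auto split: prod.splits)
  qed (auto split: prod.splits)
  then show ?thesis by simp
qed

lemma bind_nom_eq_psubst: "bind_nom a k t = psubst (bind_nom a k) t"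
proof (rule eq_hsI[of "bind_nom a" Suc])
  show "up (bind_nom a k) (Bound j) = bind_nom a (Suc k) (Bound j)" for k j
    by (cases j) auto
qed auto

lemma perm_eq_psubst: "perm \<pi> t = psubst (perm \<pi>) t"
proof (rule eq_hsI[of "\<lambda>_ :: unit. perm \<pi>" id])
  show "up (perm \<pi>) (Bound j) = perm \<pi> (Bound j)" for j
    by (cases j) auto
qed auto

lemma psubst_id: "(\<And>i. s (Bound i) = Bound i) \<Longrightarrow> (\<And>x. s (Var x) = Var x) \<Longrightarrow>
    (\<And>a. s (Nom a) = Nom a) \<Longrightarrow> psubst s t = t"
proof (induction t arbitrary: s)
  case (Lam \<tau> t)
  have "psubst (up s) t = t"
  proof (rule Lam.IH)
    show "up s (Bound i) = Bound i" for i
      by (cases i) (auto simp: Lam.prems)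
  qed (auto simp: Lam.prems)
  then show ?case by simp
qed auto

lemma lift_lift: "i \<le> k \<Longrightarrow> lift i (lift k t) = lift (Suc k) (lift i t)"
  by (induction t arbitrary: i k) auto

text \<open>Generalised to depth \<open>k\<close> because the induction passes under binders;
  \<open>psubst_up_lift\<close> is the case \<open>k = 0\<close>.\<close>

lemma psubst_upn_lift: "psubst ((up ^^ Suc k) s) (lift k t) = lift k (psubst ((up ^^ k) s) t)"
proof (induction t arbitrary: k)
  case (Bound i)
  have "(up ^^ Suc k) s (lift k (Bound i)) = lift k ((up ^^ k) s (Bound i))"
  proof (induction k arbitrary: i)
    case (Suc k)
    show ?case
    proof (cases i)
      case (Suc j)
      have "(up ^^ Suc (Suc k)) s (lift (Suc k) (Bound i)) = lift 0 ((up ^^ Suc k) s (lift k (Bound j)))"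
        by (simp add: Suc)
      also have "\<dots> = lift (Suc k) ((up ^^ Suc k) s (Bound i))"
        unfolding Suc.IH by (simp add: Suc lift_lift)
      finally show ?thesis .
    qed auto
  qed auto
  then show ?case by (simp split: if_splits)
next
  case (Var x)
  have "(up ^^ Suc k) s (Var x) = lift k ((up ^^ k) s (Var x))"
    by (induction k) (auto simp: lift_lift)
  then show ?case by simp
next
  case (Nom a)
  have "(up ^^ Suc k) s (Nom a) = lift k ((up ^^ k) s (Nom a))"
    by (induction k) (auto simp: lift_lift)
  then show ?case by simp
next
  case (Lam \<tau> t)
  show ?case using Lam[of "Suc k"] by simp
qed auto

lemma psubst_up_lift: "psubst (up s) (lift 0 t) = lift 0 (psubst s t)"
  using psubst_upn_lift[of 0 s t] by simp

lemma psubst_psubst: "psubst s (psubst s' t) = psubst (\<lambda>a. psubst s (s' a)) t"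
proof (induction t arbitrary: s s')
  case (Lam \<tau> t)
  have "psubst (\<lambda>a. psubst (up s) (up s' a)) t = psubst (up (\<lambda>a. psubst s (s' a))) t"
  proof (rule psubst_cong)
    show "psubst (up s) (up s' (Bound i)) = up (\<lambda>a. psubst s (s' a)) (Bound i)" for i
      by (cases i) (auto simp: psubst_up_lift)
  qed (auto simp: psubst_up_lift)
  then show ?case using Lam by simp
qed auto

text \<open>The cons of explicit substitution calculi: contracting a redex below a substitution
  extends the substitution by the argument, see \<open>subst_bound_psubst_up\<close>.\<close>

definition scons :: "('b, 'k, 'n) tm \<Rightarrow> (('b, 'k, 'n) tm \<Rightarrow> ('b, 'k, 'n) tm) \<Rightarrow> ('b, 'k, 'n) tm \<Rightarrow> ('b, 'k, 'n) tm"
  where "scons u s a = (case a of Bound 0 \<Rightarrow> u | Bound (Suc i) \<Rightarrow> s (Bound i) | _ \<Rightarrow> s a)"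

lemma scons_simps [simp]:
  "scons u s (Bound 0) = u" "scons u s (Bound (Suc i)) = s (Bound i)"
  "scons u s (Var x) = s (Var x)" "scons u s (Nom a) = s (Nom a)"
  by (simp_all add: scons_def)

lemma subst_bound_lift: "subst_bound k u (lift k t) = t"
  by (induction t arbitrary: k u) auto

lemma lift_inject: "lift k t = lift k t' \<longleftrightarrow> t = t'"
  by (metis subst_bound_lift)

lemma subst_bound_psubst_up: "subst_bound 0 u (psubst (up s) t) = psubst (scons u s) t"
proof -
  have "psubst (\<lambda>a. psubst (subst_bound 0 u) (up s a)) t = psubst (scons u s) t"
  proof (rule psubst_cong)
    show "psubst (subst_bound 0 u) (up s (Bound i)) = scons u s (Bound i)" for i
      by (cases i) (auto simp: subst_bound_lift simp flip: subst_bound_eq_psubst)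
  qed (auto simp: subst_bound_lift simp flip: subst_bound_eq_psubst)
  then show ?thesis
    by (subst subst_bound_eq_psubst) (simp add: psubst_psubst)
qed

lemma psubst_subst_bound: "psubst s (subst_bound 0 u t) = subst_bound 0 (psubst s u) (psubst (up s) t)"
proof -
  have "psubst (\<lambda>a. psubst s (subst_bound 0 u a)) t = psubst (scons (psubst s u) s) t"
  proof (rule psubst_cong)
    show "psubst s (subst_bound 0 u (Bound i)) = scons (psubst s u) s (Bound i)" for i
      by (cases i) auto
  qed auto
  then show ?thesis
    by (subst subst_bound_eq_psubst) (simp add: psubst_psubst subst_bound_psubst_up)
qed

section \<open>Reduction\<close>

lemma red_psubst: "red t t' \<Longrightarrow> red (psubst s t) (psubst s t')"
proof (induction arbitrary: s rule: red.induct)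
  case (beta \<tau> t u)
  then show ?case by (simp add: psubst_subst_bound red.beta)
next
  case (eta \<tau> t)
  then show ?case by (simp add: psubst_up_lift red.eta)
qed (auto intro: red.intros)

lemma red_subst_bound: "red t t' \<Longrightarrow> red (subst_bound k u t) (subst_bound k u t')"
  using red_psubst[of t t' "subst_bound k u"] by (simp flip: subst_bound_eq_psubst)

lemma reds_psubst: "red\<^sup>*\<^sup>* t t' \<Longrightarrow> red\<^sup>*\<^sup>* (psubst s t) (psubst s t')"
  by (induction rule: rtranclp_induct) (auto intro: red_psubst rtranclp.rtrancl_into_rtrancl)

lemma reds_lift: "red\<^sup>*\<^sup>* t t' \<Longrightarrow> red\<^sup>*\<^sup>* (lift k t) (lift k t')"
  using reds_psubst[of t t' "lift k"] by (simp flip: lift_eq_psubst)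

lemma reds_appL: "red\<^sup>*\<^sup>* t t' \<Longrightarrow> red\<^sup>*\<^sup>* (t \<cdot> u) (t' \<cdot> u)"
  by (induction rule: rtranclp_induct) (auto intro: red.intros rtranclp.rtrancl_into_rtrancl)

lemma reds_appR: "red\<^sup>*\<^sup>* u u' \<Longrightarrow> red\<^sup>*\<^sup>* (t \<cdot> u) (t \<cdot> u')"
  by (induction rule: rtranclp_induct) (auto intro: red.intros rtranclp.rtrancl_into_rtrancl)

lemma reds_app: "red\<^sup>*\<^sup>* t t' \<Longrightarrow> red\<^sup>*\<^sup>* u u' \<Longrightarrow> red\<^sup>*\<^sup>* (t \<cdot> u) (t' \<cdot> u')"
  by (meson reds_appL reds_appR rtranclp_trans)

lemma reds_lam: "red\<^sup>*\<^sup>* t t' \<Longrightarrow> red\<^sup>*\<^sup>* (Lam \<tau> t) (Lam \<tau> t')"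
  by (induction rule: rtranclp_induct) (auto intro: red.intros rtranclp.rtrancl_into_rtrancl)

lemma reds_psubst_pointwise:
  assumes "\<And>i. red\<^sup>*\<^sup>* (s (Bound i)) (s' (Bound i))" "\<And>x. red\<^sup>*\<^sup>* (s (Var x)) (s' (Var x))"
    "\<And>a. red\<^sup>*\<^sup>* (s (Nom a)) (s' (Nom a))"
  shows "red\<^sup>*\<^sup>* (psubst s t) (psubst s' t)"
  using assms
proof (induction t arbitrary: s s')
  case (Lam \<tau> t)
  have "red\<^sup>*\<^sup>* (psubst (up s) t) (psubst (up s') t)"
  proof (rule Lam.IH)
    show "red\<^sup>*\<^sup>* (up s (Bound i)) (up s' (Bound i))" for i
      by (cases i) (auto simp: Lam.prems reds_lift)
  qed (auto simp: Lam.prems reds_lift)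
  then show ?case by (simp add: reds_lam)
qed (auto intro: reds_app)

lemma reds_subst_bound_arg: "red u u' \<Longrightarrow> red\<^sup>*\<^sup>* (subst_bound k u t) (subst_bound k u' t)"
  by (subst (1 2) subst_bound_eq_psubst, rule reds_psubst_pointwise) auto

inductive_cases red_BoundE: "red (Bound i) t"
inductive_cases red_VarE: "red (Var x) t"
inductive_cases red_NomE: "red (Nom a) t"
inductive_cases red_CstE: "red (Cst c) t"

lemma red_AppE [consumes 1, case_names head fn arg]:
  assumes "red (t \<cdot> u) v"
  obtains \<tau> b where "t = Lam \<tau> b" "v = subst_bound 0 u b"
  | t' where "v = t' \<cdot> u" "red t t'"
  | u' where "v = t \<cdot> u'" "red u u'"
  using assms by (auto elim: red.cases)

lemma red_LamE [consumes 1, case_names eta_head body]: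
  assumes "red (Lam \<tau> t) v"
  obtains "t = lift 0 v \<cdot> Bound 0" | t' where "v = Lam \<tau> t'" "red t t'"
  using assms by (auto elim: red.cases)

lemma lift_eq_simps:
  "lift k t = Lam \<tau> u \<longleftrightarrow> (\<exists>t'. t = Lam \<tau> t' \<and> u = lift (Suc k) t')"
  "lift k t = u \<cdot> v \<longleftrightarrow> (\<exists>u' v'. t = u' \<cdot> v' \<and> u = lift k u' \<and> v = lift k v')"
  "lift k t = Cst c \<longleftrightarrow> t = Cst c"
  "lift (Suc k) t = Bound 0 \<longleftrightarrow> t = Bound 0"
  by (cases t; auto)+

lemma lift_subst_bound:
  "lift k (subst_bound 0 u t) = subst_bound 0 (lift k u) (lift (Suc k) t)"
proof -
  have "psubst (up (lift k)) t = psubst (lift (Suc k)) t"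
  proof (rule psubst_cong)
    show "up (lift k) (Bound i) = lift (Suc k) (Bound i)" for i
      by (cases i) auto
  qed auto
  then show ?thesis
    using psubst_subst_bound[of "lift k" u t] by (simp flip: lift_eq_psubst)
qed

lemma lift_Suc_eq_lift_0:
  assumes "lift (Suc k) s = lift 0 t"
  obtains t' where "s = lift 0 t'" "t = lift k t'"
proof -
  \<comment> \<open>Index 0 does not occur in \<open>s\<close>, so substituting any term for it,
    here \<open>Top\<close>, merely lowers the other indices.\<close>
  define t' where "t' = subst_bound 0 (Cst CTop) s"
  have *: "lift k t' = t"
    unfolding t'_def lift_subst_bound assms by (rule subst_bound_lift)
  have "lift (Suc k) (lift 0 t') = lift (Suc k) s"
    by (simp add: * assms flip: lift_lift)
  then have "s = lift 0 t'" by (simp add: lift_inject)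
  then show ?thesis using that *[symmetric] by blast
qed

text \<open>Serves the eta-redex \<open>Lam \<sigma> (lift 0 t \<cdot> Bound 0)\<close>: a reduction
  inside \<open>lift 0 t\<close> has to be matched by one of \<open>t\<close>.\<close>

lemma red_lift_inv:
  assumes "red (lift k t) u"
  obtains t' where "u = lift k t'" "red t t'"
proof -
  have "red v u \<Longrightarrow> v = lift k t \<Longrightarrow> \<exists>t'. u = lift k t' \<and> red t t'" for v
  proof (induction arbitrary: k t rule: red.induct)
    case (beta \<tau> b a)
    then obtain b' a' where "t = Lam \<tau> b' \<cdot> a'" "b = lift (Suc k) b'" "a = lift k a'"
      by (metis lift_eq_simps(1,2))
    then show ?case by (auto simp: lift_subst_bound[symmetric] intro: red.beta)
  next
    case (eta \<tau> b)
    then obtain b' where b': "t = Lam \<tau> b'" "lift (Suc k) b' = lift 0 b \<cdot> Bound 0"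
      by (metis lift_eq_simps(1))
    then obtain c where c: "b' = c \<cdot> Bound 0" "lift (Suc k) c = lift 0 b"
      by (metis lift_eq_simps(2,4))
    then obtain d where "c = lift 0 d" "b = lift k d"
      using lift_Suc_eq_lift_0 by blast
    then show ?case using b' c by (auto intro: red.eta)
  next
    case (appL s s' u)
    then obtain a b where "t = a \<cdot> b" "s = lift k a" "u = lift k b"
      by (metis lift_eq_simps(2))
    then show ?case using appL.IH by (metis lift.simps(5) red.appL)
  next
    case (appR s s' u)
    then obtain a b where "t = a \<cdot> b" "u = lift k a" "s = lift k b"
      by (metis lift_eq_simps(2))
    then show ?case using appR.IH by (metis lift.simps(5) red.appR)
  next
    case (lam s s' \<tau>)
    then obtain a where "t = Lam \<tau> a" "s = lift (Suc k) a"
      by (metis lift_eq_simps(1))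
    then show ?case using lam.IH by (metis lift.simps(6) red.lam)
  qed
  then show ?thesis using assms that by blast
qed

subsection \<open>Strong normalization\<close>

inductive SN :: "('b, 'k, 'n) tm \<Rightarrow> bool" where
  SN_I: "(\<And>t'. red t t' \<Longrightarrow> SN t') \<Longrightarrow> SN t"

lemma SN_red: "SN t \<Longrightarrow> red t t' \<Longrightarrow> SN t'"
  by (auto elim: SN.cases)

lemma SN_of_image:
  assumes "SN (f t)" "\<And>t t'. red t t' \<Longrightarrow> red (f t) (f t')"
  shows "SN t"
proof -
  have "SN v \<Longrightarrow> v = f t \<Longrightarrow> SN t" for v
  proof (induction arbitrary: t rule: SN.induct)
    case (SN_I v)
    show ?case
      by (rule SN.SN_I) (use SN_I assms(2) in blast)
  qed
  then show ?thesis using assms(1) by blast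
qed

text \<open>Tait's reducibility predicates, stated for raw terms; typing enters only in
  \<open>has_type_RED\<close>, the fundamental lemma.\<close>

primrec RED :: "'b ty \<Rightarrow> ('b, 'k, 'n) tm \<Rightarrow> bool" where
  "RED (Base b) = SN"
| "RED Prop = SN"
| "RED Nt = SN"
| "RED (\<sigma> \<rightarrow> \<tau>) = (\<lambda>t. \<forall>u. RED \<sigma> u \<longrightarrow> RED \<tau> (t \<cdot> u))"

definition is_lam :: "('b, 'k, 'n) tm \<Rightarrow> bool" where
  "is_lam t \<longleftrightarrow> (\<exists>\<tau> u. t = Lam \<tau> u)"

text \<open>Girard's three conditions on reducibility candidates. They are proved together because
  strong normalization at an arrow type applies the term to \<open>Bound 0\<close>, whose
  reducibility is an instance of the third condition at the argument type.\<close>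

lemma RED_props:
  fixes t t' :: "('b, 'k, 'n) tm"
  shows "(RED \<tau> t \<longrightarrow> SN t) \<and> (RED \<tau> t \<longrightarrow> red t t' \<longrightarrow> RED \<tau> t') \<and>
   (\<not> is_lam t \<longrightarrow> (\<forall>t'. red t t' \<longrightarrow> RED \<tau> t') \<longrightarrow> RED \<tau> t)"
proof (induction \<tau> arbitrary: t t')
  case (Arr \<sigma> \<tau>)
  have RED_0: "RED \<sigma> (Bound 0 :: ('b, 'k, 'n) tm)"
  proof -
    have "\<not> is_lam (Bound 0 :: ('b, 'k, 'n) tm)" "\<And>t'. \<not> red (Bound 0 :: ('b, 'k, 'n) tm) t'"
      by (auto simp: is_lam_def elim: red_BoundE)
    then show ?thesis using Arr.IH(1)[of "Bound 0" undefined] by blast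
  qed
  show ?case
  proof (intro conjI impI)
    assume "RED (\<sigma> \<rightarrow> \<tau>) t"
    then have "SN (t \<cdot> Bound 0)" using RED_0 Arr.IH(2) by auto
    then show "SN t" by (rule SN_of_image) (rule red.appL)
  next
    assume "RED (\<sigma> \<rightarrow> \<tau>) t" "red t t'"
    then show "RED (\<sigma> \<rightarrow> \<tau>) t'" using Arr.IH(2) by (auto intro: red.appL)
  next
    assume t: "\<not> is_lam t" "\<forall>t'. red t t' \<longrightarrow> RED (\<sigma> \<rightarrow> \<tau>) t'"
    have "RED \<tau> (t \<cdot> u)" if "SN u" "RED \<sigma> u" for u
      using that
    proof (induction rule: SN.induct)
      case (SN_I u)
      have "RED \<tau> v" if "red (t \<cdot> u) v" for v
        using that
      proof (cases rule: red_AppE)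
        case (head \<tau>' b')
        then show ?thesis using t(1) by (auto simp: is_lam_def)
      next
        case (fn s')
        then show ?thesis using t(2) SN_I.prems by auto
      next
        case (arg u')
        then show ?thesis using SN_I.IH SN_I.prems Arr.IH(1) by blast
      qed
      then show ?case using Arr.IH(2) by (auto simp: is_lam_def)
    qed
    then show "RED (\<sigma> \<rightarrow> \<tau>) t" using Arr.IH(1) by auto
  qed
qed (auto intro: SN_I SN_red)

lemma RED_SN: "RED \<tau> t \<Longrightarrow> SN t"
  and RED_red: "RED \<tau> t \<Longrightarrow> red t t' \<Longrightarrow> RED \<tau> t'"
  and RED_neutral: "\<not> is_lam t \<Longrightarrow> (\<And>t'. red t t' \<Longrightarrow> RED \<tau> t') \<Longrightarrow> RED \<tau> t"
  using RED_props by blast+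

lemma RED_Lam:
  assumes "\<And>u. RED \<sigma> u \<Longrightarrow> RED \<tau> (subst_bound 0 u t)"
  shows "RED (\<sigma> \<rightarrow> \<tau>) (Lam \<sigma>' t)"
proof -
  have "RED \<tau> (Lam \<sigma>' t \<cdot> u)" if "SN t" "SN u" "RED \<sigma> u"
    "\<And>u. RED \<sigma> u \<Longrightarrow> RED \<tau> (subst_bound 0 u t)" for t u
    using that
  proof (induction arbitrary: u rule: SN.induct)
    case (SN_I t)
    note IHt = SN_I.IH and t = SN_I.prems(3)
    show ?case using SN_I.prems(1,2)
    proof (induction rule: SN.induct)
      case (SN_I u)
      have "RED \<tau> v" if "red (Lam \<sigma>' t \<cdot> u) v" for v
        using that
      proof (cases rule: red_AppE)
        case (head \<tau>' b')
        then show ?thesis using t SN_I.prems by auto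
      next
        case (fn s')
        from fn(2) show ?thesis
        proof (cases rule: red_LamE)
          \<comment> \<open>If the abstraction itself eta-reduces, applying the result to
            \<open>u\<close> gives exactly the beta-contractum.\<close>
          case eta_head
          have "subst_bound 0 u t = s' \<cdot> u" by (simp add: eta_head subst_bound_lift)
          then show ?thesis using t[OF SN_I.prems] fn by simp
        next
          case (body t')
          have "RED \<tau> (Lam \<sigma>' t' \<cdot> u)"
          proof (rule IHt)
            show "red t t'" by fact
            show "SN u" "RED \<sigma> u" using SN_I.prems RED_SN by auto
            show "RED \<tau> (subst_bound 0 u t')" if "RED \<sigma> u" for u
              using t[OF that] \<open>red t t'\<close> by (blast intro: RED_red red_subst_bound)
          qed
          then show ?thesis using body \<open>v = s' \<cdot> u\<close> by simp
        qed
      next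
        case (arg u')
        then show ?thesis using SN_I RED_red by blast
      qed
      then show ?case by (auto intro: RED_neutral simp: is_lam_def)
    qed
  qed
  moreover have "SN t"
  proof (rule SN_of_image)
    have "RED \<sigma> (Bound 0)" by (rule RED_neutral) (auto simp: is_lam_def elim: red_BoundE)
    then show "SN (subst_bound 0 (Bound 0) t)" using assms RED_SN by blast
  qed (rule red_subst_bound)
  ultimately show ?thesis using assms unfolding RED.simps by (blast intro: RED_SN)
qed

context LG
begin

inductive_cases has_type_BoundE: "has_type \<Delta> (Bound i) \<tau>"
inductive_cases has_type_VarE: "has_type \<Delta> (Var x) \<tau>"
inductive_cases has_type_NomE: "has_type \<Delta> (Nom a) \<tau>"
inductive_cases has_type_CstE: "has_type \<Delta> (Cst c) \<tau>"
inductive_cases has_type_AppE: "has_type \<Delta> (t \<cdot> u) \<tau>"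
inductive_cases has_type_LamE: "has_type \<Delta> (Lam \<sigma> t) \<tau>"

lemma RED_atoms: "RED \<tau> (Bound i)" "RED \<tau> (Var x)" "RED \<tau> (Nom a)" "RED \<tau> (Cst c)"
  by (rule RED_neutral; auto simp: is_lam_def elim: red_BoundE red_VarE red_NomE red_CstE)+

lemma has_type_RED:
  assumes "has_type \<Delta> t \<tau>" "\<And>i. i < length \<Delta> \<Longrightarrow> RED (\<Delta> ! i) (s (Bound i))"
    "\<And>x. s (Var x) = Var x" "\<And>a. s (Nom a) = Nom a"
  shows "RED \<tau> (psubst s t)"
  using assms
proof (induction arbitrary: s rule: has_type.induct)
  case (6 \<sigma> \<Delta> t \<tau>)
  have "RED \<tau> (subst_bound 0 u (psubst (up s) t))" if "RED \<sigma> u" for u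
    unfolding subst_bound_psubst_up
  proof (rule "6.IH")
    show "RED ((\<sigma> # \<Delta>) ! i) (scons u s (Bound i))" if "i < length (\<sigma> # \<Delta>)" for i
      using that \<open>RED \<sigma> u\<close> "6.prems"(1) by (cases i) auto
  qed (auto simp: "6.prems")
  then show ?case unfolding psubst.simps by (rule RED_Lam)
qed (auto simp: RED_atoms)

lemma has_type_SN: "has_type \<Delta> t \<tau> \<Longrightarrow> SN t"
  using has_type_RED[of \<Delta> t \<tau> id] by (simp add: RED_atoms RED_SN psubst_id)

subsection \<open>Typing and confluence\<close>

lemma has_type_lift:
  "has_type \<Delta> t \<tau> \<Longrightarrow> \<Delta> = \<Delta>1 @ \<Delta>2 \<Longrightarrow> has_type (\<Delta>1 @ \<sigma> # \<Delta>2) (lift (length \<Delta>1) t) \<tau>"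
proof (induction arbitrary: \<Delta>1 rule: has_type.induct)
  case (1 i \<Delta>)
  then show ?case
    using has_type.intros(1)[of i "\<Delta>1 @ \<sigma> # \<Delta>2"] has_type.intros(1)[of "Suc i" "\<Delta>1 @ \<sigma> # \<Delta>2"]
    by (auto simp: nth_append Suc_diff_le)
next
  case (6 \<rho> \<Delta> t \<tau>)
  from "6.IH"[of "\<rho> # \<Delta>1"] "6.prems" show ?case by (auto intro: has_type.intros)
next
  case (5 \<Delta> t \<rho> \<tau> u)
  show ?case using has_type.intros(5)[OF "5.IH"(1)[OF "5.prems"] "5.IH"(2)[OF "5.prems"]] by simp
qed (auto intro: has_type.intros)

text \<open>Strengthening of the context, which subject reduction needs for eta.\<close>

lemma has_type_lift_inv:
  "has_type \<Delta> t' \<tau> \<Longrightarrow> t' = lift (length \<Delta>1) t \<Longrightarrow> \<Delta> = \<Delta>1 @ \<sigma> # \<Delta>2 \<Longrightarrow> has_type (\<Delta>1 @ \<Delta>2) t \<tau>"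
proof (induction arbitrary: \<Delta>1 t rule: has_type.induct)
  case (1 i \<Delta>)
  then obtain j where t: "t = Bound j" by (cases t) (auto split: if_splits)
  then show ?case
    using 1 has_type.intros(1)[of j "\<Delta>1 @ \<Delta>2"]
    by (auto simp: nth_append Suc_diff_le split: if_splits)
next
  case (5 \<Delta> t' \<sigma>' \<tau> u')
  then obtain u v where t: "t = u \<cdot> v" "t' = lift (length \<Delta>1) u" "u' = lift (length \<Delta>1) v"
    by (metis lift_eq_simps(2))
  show ?case
    using "5.IH"(1)[OF t(2) "5.prems"(2)] "5.IH"(2)[OF t(3) "5.prems"(2)] t(1)
    by (auto intro: has_type.intros)
next
  case (6 \<rho> \<Delta> t' \<tau>)
  then obtain b where "t = Lam \<rho> b" "t' = lift (Suc (length \<Delta>1)) b" by (metis lift_eq_simps(1))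
  with "6.IH"[of "\<rho> # \<Delta>1" b] "6.prems" show ?case by (auto intro: has_type.intros)
next
  case (2 \<Delta> x) then show ?case by (cases t) (auto intro: has_type.intros split: if_splits)
next
  case (3 \<Delta> x) then show ?case by (cases t) (auto intro: has_type.intros split: if_splits)
next
  case (4 \<Delta> x) then show ?case by (cases t) (auto intro: has_type.intros split: if_splits)
qed

lemma has_type_psubst:
  assumes "has_type \<Delta> t \<tau>" "\<And>i. i < length \<Delta> \<Longrightarrow> has_type \<Delta>' (s (Bound i)) (\<Delta> ! i)"
    "\<And>x. x \<in> fv t \<Longrightarrow> has_type \<Delta>' (s (Var x)) (snd x)"
    "\<And>a. a \<in> supp t \<Longrightarrow> ntype a \<in> nominal \<Longrightarrow> has_type \<Delta>' (s (Nom a)) (ntype a)"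
  shows "has_type \<Delta>' (psubst s t) \<tau>"
  using assms
proof (induction arbitrary: s \<Delta>' rule: has_type.induct)
  case (6 \<sigma> \<Delta> t \<tau>)
  have L: "has_type \<Delta>' u \<rho> \<Longrightarrow> has_type (\<sigma> # \<Delta>') (lift 0 u) \<rho>" for u \<rho>
    using has_type_lift[of \<Delta>' u \<rho> "[]" \<Delta>'] by simp
  have "has_type (\<sigma> # \<Delta>') (psubst (up s) t) \<tau>"
  proof (rule "6.IH")
    show "has_type (\<sigma> # \<Delta>') (up s (Bound i)) ((\<sigma> # \<Delta>) ! i)" if "i < length (\<sigma> # \<Delta>)" for i
      using that "6.prems"(1) has_type.intros(1)[of 0 "\<sigma> # \<Delta>'"] by (cases i) (auto intro: L)
  qed (use "6.prems" in \<open>auto intro: L\<close>)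
  then show ?case by (auto intro: has_type.intros)
next
  case (5 \<Delta> t \<sigma> \<tau> u)
  then have "has_type \<Delta>' (psubst s t) (\<sigma> \<rightarrow> \<tau>)" "has_type \<Delta>' (psubst s u) \<sigma>" by auto
  then show ?case by (auto intro: has_type.intros)
qed (auto intro: has_type.intros)

lemma has_type_subst_bound:
  assumes "has_type (\<sigma> # \<Delta>) t \<tau>" "has_type \<Delta> u \<sigma>"
  shows "has_type \<Delta> (subst_bound 0 u t) \<tau>"
  unfolding subst_bound_eq_psubst[of 0 u t]
proof (rule has_type_psubst[OF assms(1)])
  show "has_type \<Delta> (subst_bound 0 u (Bound i)) ((\<sigma> # \<Delta>) ! i)" if "i < length (\<sigma> # \<Delta>)" for i
    using that assms(2) by (cases i) (auto intro: has_type.intros)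
qed (auto intro: has_type.intros)

lemma red_has_type: "red t t' \<Longrightarrow> has_type \<Delta> t \<tau> \<Longrightarrow> has_type \<Delta> t' \<tau>"
proof (induction arbitrary: \<Delta> \<tau> rule: red.induct)
  case (beta \<sigma> t u)
  then show ?case by (auto elim!: has_type_AppE has_type_LamE intro: has_type_subst_bound)
next
  case (eta \<sigma> t)
  then show ?case
    by (auto elim!: has_type_AppE has_type_LamE has_type_BoundE
        dest: has_type_lift_inv[of _ _ _ "[]", simplified])
qed (auto elim!: has_type_AppE has_type_LamE intro: has_type.intros)

lemma reds_has_type: "red\<^sup>*\<^sup>* t t' \<Longrightarrow> has_type \<Delta> t \<tau> \<Longrightarrow> has_type \<Delta> t' \<tau>"
  by (induction rule: rtranclp_induct) (auto intro: red_has_type)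

text \<open>The one critical pair that depends on typing: for \<open>t = Lam \<sigma>' b'\<close>,
  contracting the inner beta-redex leaves \<open>Lam \<sigma> b'\<close> while eta leaves
  \<open>Lam \<sigma>' b'\<close>, and only typing forces the two annotations to agree.\<close>

lemma eta_diamond:
  assumes "has_type \<Delta> (Lam \<sigma> (lift 0 t \<cdot> Bound 0)) \<tau>" "red (lift 0 t \<cdot> Bound 0) v"
  shows "\<exists>w. red\<^sup>*\<^sup>* (Lam \<sigma> v) w \<and> red\<^sup>*\<^sup>* t w"
  using assms(2)
proof (cases rule: red_AppE)
  case (head \<sigma>' b)
  then obtain b' where b': "t = Lam \<sigma>' b'" "b = lift (Suc 0) b'" by (metis lift_eq_simps(1))
  have "psubst (\<lambda>a. psubst (subst_bound 0 (Bound 0)) (lift (Suc 0) a)) b' = b'"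
  proof (rule psubst_id)
    show "psubst (subst_bound 0 (Bound 0)) (lift (Suc 0) (Bound i)) = Bound i" for i
      by (cases i) auto
  qed auto
  then have "v = b'"
    using head b' by (subst (asm) subst_bound_eq_psubst, subst (asm) lift_eq_psubst) (simp add: psubst_psubst)
  moreover have "\<sigma> = \<sigma>'"
    using assms(1) head(1) by (auto elim!: has_type_AppE has_type_LamE has_type_BoundE)
  ultimately show ?thesis using b' by auto
next
  case (fn s')
  then obtain t' where "s' = lift 0 t'" "red t t'" using red_lift_inv by blast
  then show ?thesis using fn red.eta by (metis r_into_rtranclp)
qed (auto elim: red_BoundE)

lemma beta_diamond:
  assumes "red (Lam \<sigma> b \<cdot> u) v"
  shows "\<exists>w. red\<^sup>*\<^sup>* (subst_bound 0 u b) w \<and> red\<^sup>*\<^sup>* v w"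
  using assms
proof (cases rule: red_AppE)
  case (head \<tau>' b')
  then show ?thesis by auto
next
  case (fn s')
  from fn(2) show ?thesis
  proof (cases rule: red_LamE)
    case eta_head
    then have "subst_bound 0 u b = v" by (simp add: fn subst_bound_lift)
    then show ?thesis by auto
  next
    case (body t')
    then show ?thesis using \<open>v = s' \<cdot> u\<close> by (metis red.beta r_into_rtranclp red_subst_bound)
  qed
next
  case (arg u')
  then show ?thesis by (metis red.beta r_into_rtranclp reds_subst_bound_arg)
qed

lemma red_local_confluent:
  "red t t1 \<Longrightarrow> has_type \<Delta> t \<tau> \<Longrightarrow> red t t2 \<Longrightarrow> \<exists>u. red\<^sup>*\<^sup>* t1 u \<and> red\<^sup>*\<^sup>* t2 u"
proof (induction arbitrary: t2 \<Delta> \<tau> rule: red.induct)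
  case (beta \<sigma> b u)
  show ?case by (rule beta_diamond[OF beta.prems(2)])
next
  case (eta \<sigma> t)
  from eta.prems(2) show ?case
  proof (cases rule: red_LamE)
    case eta_head
    then show ?thesis by (auto simp: lift_inject)
  next
    case (body t')
    then show ?thesis using eta_diamond[OF eta.prems(1)] by blast
  qed
next
  case (appL s s' t)
  from appL.prems(2) show ?case
  proof (cases rule: red_AppE)
    case (head \<tau>' b')
    then show ?thesis using beta_diamond[of _ _ t "s' \<cdot> t"] appL.hyps red.appL by blast
  next
    case (fn s')
    obtain \<sigma> where "has_type \<Delta> s (\<sigma> \<rightarrow> \<tau>)" using appL.prems(1) by (auto elim: has_type_AppE)
    then show ?thesis using appL.IH fn reds_appL by blast
  next
    case (arg u')
    then show ?thesis using appL.hyps by (meson r_into_rtranclp red.appL red.appR)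
  qed
next
  case (appR u u' t)
  from appR.prems(2) show ?case
  proof (cases rule: red_AppE)
    case (head \<tau>' b')
    then show ?thesis using beta_diamond[of _ _ u "t \<cdot> u'"] appR.hyps red.appR by blast
  next
    case (fn s')
    then show ?thesis using appR.hyps by (meson r_into_rtranclp red.appL red.appR)
  next
    case (arg u')
    obtain \<sigma> where "has_type \<Delta> u \<sigma>" using appR.prems(1) by (auto elim: has_type_AppE)
    then show ?thesis using appR.IH arg reds_appR by blast
  qed
next
  case (lam t t' \<sigma>)
  from lam.prems(2) show ?case
  proof (cases rule: red_LamE)
    case eta_head
    then show ?thesis using eta_diamond lam.prems(1) lam.hyps by blast
  next
    case (body t')
    obtain \<rho> where "has_type (\<sigma> # \<Delta>) t \<rho>" using lam.prems(1) by (auto elim: has_type_LamE)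
    then show ?thesis using lam.IH body reds_lam by blast
  qed
qed

text \<open>Newman's lemma; the typing is carried along by subject reduction because local
  confluence holds for typed terms only.\<close>

lemma red_confluent:
  assumes "has_type \<Delta> t \<tau>" "red\<^sup>*\<^sup>* t t1" "red\<^sup>*\<^sup>* t t2"
  shows "\<exists>u. red\<^sup>*\<^sup>* t1 u \<and> red\<^sup>*\<^sup>* t2 u"
proof -
  from assms(1) have "SN t" by (rule has_type_SN)
  then show ?thesis using assms
  proof (induction arbitrary: t1 t2 rule: SN.induct)
    case (SN_I t)
    show ?case
    proof (cases "t = t1 \<or> t = t2")
      case True
      then show ?thesis using SN_I.prems by blast
    next
      case False
      then obtain s1 s2 where s: "red t s1" "red\<^sup>*\<^sup>* s1 t1" "red t s2" "red\<^sup>*\<^sup>* s2 t2"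
        using SN_I.prems by (metis converse_rtranclpE)
      then have ty: "has_type \<Delta> s1 \<tau>" "has_type \<Delta> s2 \<tau>"
        using SN_I.prems red_has_type by auto
      obtain v where v: "red\<^sup>*\<^sup>* s1 v" "red\<^sup>*\<^sup>* s2 v"
        using s SN_I.prems red_local_confluent by blast
      obtain u1 where u1: "red\<^sup>*\<^sup>* t1 u1" "red\<^sup>*\<^sup>* v u1"
        using SN_I.IH[OF s(1) ty(1) s(2) v(1)] by blast
      obtain u where u: "red\<^sup>*\<^sup>* u1 u" "red\<^sup>*\<^sup>* t2 u"
        using SN_I.IH[OF s(3) ty(2) rtranclp_trans[OF v(2) u1(2)] s(4)] by blast
      then show ?thesis using u1 by (meson rtranclp_trans)
    qed
  qed
qed

lemma SN_normalizes: "SN t \<Longrightarrow> \<exists>u. red\<^sup>*\<^sup>* t u \<and> normal u"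
proof (induction rule: SN.induct)
  case (SN_I t)
  then show ?case unfolding normal_def by (metis converse_rtranclp_into_rtranclp rtranclp.rtrancl_refl)
qed

lemma normal_reds: "normal t \<Longrightarrow> red\<^sup>*\<^sup>* t u \<Longrightarrow> u = t"
  by (metis converse_rtranclpE normal_def)

lemma nf_unique:
  assumes "has_type \<Delta> t \<tau>" "red\<^sup>*\<^sup>* t u" "normal u"
  shows "nf t = u"
  unfolding nf_def
proof (rule the_equality)
  show "v = u" if "red\<^sup>*\<^sup>* t v \<and> normal v" for v
    using red_confluent[OF assms(1,2), of v] that assms(3) normal_reds by metis
qed (use assms in auto)

lemma nf_works:
  assumes "has_type \<Delta> t \<tau>"
  shows reds_nf: "red\<^sup>*\<^sup>* t (nf t)" and normal_nf: "normal (nf t)" and has_type_nf: "has_type \<Delta> (nf t) \<tau>"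
proof -
  obtain u where "red\<^sup>*\<^sup>* t u" "normal u" using SN_normalizes has_type_SN[OF assms] by blast
  with nf_unique[OF assms] show "red\<^sup>*\<^sup>* t (nf t)" "normal (nf t)" by auto
  with assms reds_has_type show "has_type \<Delta> (nf t) \<tau>" by blast
qed

lemma nf_reds: "has_type \<Delta> t \<tau> \<Longrightarrow> red\<^sup>*\<^sup>* t u \<Longrightarrow> nf t = nf u"
  by (meson nf_unique normal_nf reds_has_type reds_nf rtranclp_trans)

lemma nf_normal: "normal t \<Longrightarrow> nf t = t"
  unfolding nf_def by (rule the_equality) (auto dest: normal_reds)

end

section \<open>Variables and nominal constants under substitution and reduction\<close>

lemma fv_lift [simp]: "fv (lift k t) = fv t"
  by (induction t arbitrary: k) auto

lemma supp_lift [simp]: "supp (lift k t) = supp t"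
  by (induction t arbitrary: k) auto

lemma fv_subst_bound: "fv (subst_bound k u t) \<subseteq> fv t \<union> fv u"
proof (induction t arbitrary: k u)
  case (Lam \<tau> t)
  show ?case using Lam[of "Suc k" "lift 0 u"] by simp
next
  case (App t1 t2)
  from App.IH[of k u] show ?case by auto
qed auto

lemma supp_subst_bound: "supp (subst_bound k u t) \<subseteq> supp t \<union> supp u"
proof (induction t arbitrary: k u)
  case (Lam \<tau> t)
  show ?case using Lam[of "Suc k" "lift 0 u"] by simp
next
  case (App t1 t2)
  from App.IH[of k u] show ?case by auto
qed auto

lemma red_fv: "red t t' \<Longrightarrow> fv t' \<subseteq> fv t"
proof (induction rule: red.induct)
  case (beta \<tau> t u)
  show ?case using fv_subst_bound[of 0 u t] by auto
qed auto

lemma red_supp: "red t t' \<Longrightarrow> supp t' \<subseteq> supp t"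
proof (induction rule: red.induct)
  case (beta \<tau> t u)
  show ?case using supp_subst_bound[of 0 u t] by auto
qed auto

lemma reds_fv: "red\<^sup>*\<^sup>* t t' \<Longrightarrow> fv t' \<subseteq> fv t"
  by (induction rule: rtranclp_induct) (auto dest: red_fv)

lemma reds_supp: "red\<^sup>*\<^sup>* t t' \<Longrightarrow> supp t' \<subseteq> supp t"
  by (induction rule: rtranclp_induct) (auto dest: red_supp)

lemma finite_fv [simp]: "finite (fv t)"
  by (induction t) auto

lemma finite_supp [simp]: "finite (supp t)"
  by (induction t) auto

lemma fv_psubst: "fv (psubst s t) \<subseteq> (\<Union>i. fv (s (Bound i))) \<union> (\<Union>x\<in>fv t. fv (s (Var x))) \<union> (\<Union>a\<in>supp t. fv (s (Nom a)))"
proof (induction t arbitrary: s)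
  case (Lam \<tau> t)
  have "(\<Union>i. fv (up s (Bound i))) \<subseteq> (\<Union>i. fv (s (Bound i)))"
  proof
    fix x assume "x \<in> (\<Union>i. fv (up s (Bound i)))"
    then obtain i where "x \<in> fv (up s (Bound i))" by blast
    then show "x \<in> (\<Union>i. fv (s (Bound i)))" by (cases i) auto
  qed
  with Lam[of "up s"] show ?case by auto
next
  case (App t u)
  from App.IH[of s] show ?case by auto
qed auto

lemma supp_psubst: "supp (psubst s t) \<subseteq> (\<Union>i. supp (s (Bound i))) \<union> (\<Union>x\<in>fv t. supp (s (Var x))) \<union> (\<Union>a\<in>supp t. supp (s (Nom a)))"
proof (induction t arbitrary: s)
  case (Lam \<tau> t)
  have "(\<Union>i. supp (up s (Bound i))) \<subseteq> (\<Union>i. supp (s (Bound i)))"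
  proof
    fix x assume "x \<in> (\<Union>i. supp (up s (Bound i)))"
    then obtain i where "x \<in> supp (up s (Bound i))" by blast
    then show "x \<in> (\<Union>i. supp (s (Bound i)))" by (cases i) auto
  qed
  with Lam[of "up s"] show ?case by auto
next
  case (App t u)
  from App.IH[of s] show ?case by auto
qed auto

section \<open>Normal applications, head symbols and renaming\<close>

lemma normal_Cst [simp]: "normal (Cst c)"
  by (auto simp: normal_def elim: red_CstE)

lemma normal_atoms [simp]: "normal (Var x)" "normal (Nom a)"
  by (auto simp: normal_def elim: red_VarE red_NomE)

lemma apps_neq_Lam_iff: "apps t us = Lam \<tau> b \<longleftrightarrow> us = [] \<and> t = Lam \<tau> b"
  by (cases us rule: rev_cases) auto

lemma normal_App: "normal (t \<cdot> u) \<longleftrightarrow> normal t \<and> normal u \<and> \<not> is_lam t"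
  unfolding normal_def is_lam_def by (metis red_AppE red.beta red.appL red.appR)

lemma normal_apps: "\<not> is_lam t \<Longrightarrow> normal (apps t us) \<longleftrightarrow> normal t \<and> (\<forall>u\<in>set us. normal u)"
proof (induction us rule: rev_induct)
  case (snoc u us)
  then show ?case by (auto simp: normal_App is_lam_def apps_neq_Lam_iff)
qed auto

lemma not_is_lam [simp]: "\<not> is_lam (t \<cdot> u)" "\<not> is_lam (Cst c)" "\<not> is_lam (Var x)" "\<not> is_lam (Nom a)"
  by (auto simp: is_lam_def)

lemma reds_apps_args: "list_all2 (red\<^sup>*\<^sup>*) us vs \<Longrightarrow> red\<^sup>*\<^sup>* (apps t us) (apps t vs)"
proof (induction us arbitrary: vs rule: rev_induct)
  case (snoc u us)
  from snoc.prems obtain v vs' where v: "vs = vs' @ [v]" "list_all2 (red\<^sup>*\<^sup>*) us vs'" "red\<^sup>*\<^sup>* u v"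
    by (auto simp: list_all2_append1 list_all2_Cons1)
  then show ?case using reds_app[OF snoc.IH[OF v(2)] v(3)] by simp
qed simp

lemma reds_apps_fun: "red\<^sup>*\<^sup>* t t' \<Longrightarrow> red\<^sup>*\<^sup>* (apps t us) (apps t' us)"
  by (induction us arbitrary: t t') (auto intro: reds_appL)

primrec head :: "('b, 'k, 'n) tm \<Rightarrow> ('b, 'k, 'n) tm" where
  "head (Bound i) = Bound i"
| "head (Var x) = Var x"
| "head (Nom a) = Nom a"
| "head (Cst c) = Cst c"
| "head (t \<cdot> u) = head t"
| "head (Lam \<tau> t) = Lam \<tau> t"

lemma head_apps [simp]: "head (apps t us) = head t"
  by (induction us arbitrary: t) auto

lemma head_apps_exists: "\<exists>us. t = apps (head t) us"
proof (induction t)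
  case (App t u)
  then obtain us where "t = apps (head t) us" by blast
  then have "t \<cdot> u = apps (head (t \<cdot> u)) (us @ [u])" by simp
  then show ?case by blast
qed (auto intro: exI[of _ "[]"])

lemma head_psubst: "head t = Cst c \<Longrightarrow> head (psubst s t) = Cst c"
  by (induction t) auto

lemma head_red: "red t t' \<Longrightarrow> head t = Cst c \<Longrightarrow> head t' = Cst c"
  by (induction rule: red.induct) auto

lemma perm_perm: "perm \<pi> (perm \<pi>' t) = perm (\<pi> \<circ> \<pi>') t"
  by (simp add: tm.map_comp)

lemma perm_cong: "(\<And>a. a \<in> supp t \<Longrightarrow> \<pi> a = \<pi>' a) \<Longrightarrow> perm \<pi> t = perm \<pi>' t"
  by (rule tm.map_cong0)

lemma perm_idle: "(\<And>a. a \<in> supp t \<Longrightarrow> \<pi> a = a) \<Longrightarrow> perm \<pi> t = t"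
  using perm_cong[of t \<pi> id] by (simp add: tm.map_id)

lemma red_perm: "red t t' \<Longrightarrow> red (perm (\<pi> :: 'n \<Rightarrow> 'n) t) (perm \<pi> t')"
  using red_psubst[of t t' "perm \<pi>"] by (simp flip: perm_eq_psubst)

lemma normal_perm:
  fixes \<pi> :: "'n \<Rightarrow> 'n"
  assumes "inj \<pi>" "normal t"
  shows "normal (perm \<pi> t)"
  unfolding normal_def
proof
  assume "\<exists>u. red (perm \<pi> t) u"
  then obtain u where "red (perm (inv \<pi>) (perm \<pi> t)) (perm (inv \<pi>) u)" using red_perm by blast
  then show False using assms by (auto simp: perm_perm perm_idle normal_def)
qed

lemma supp_perm [simp]: "supp (perm \<pi> t) = \<pi> ` supp t"
  by (simp add: tm.set_map)

lemma fv_perm [simp]: "fv (perm \<pi> t) = fv t"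
  by (induction t) auto

context LG
begin

abbreviation "tyd \<equiv> has_type []"

lemma psubst_cong_typed:
  assumes "has_type \<Delta> t \<tau>" "\<And>i. i < length \<Delta> \<Longrightarrow> s (Bound i) = s' (Bound i)"
    "\<And>x. x \<in> fv t \<Longrightarrow> s (Var x) = s' (Var x)"
    "\<And>a. a \<in> supp t \<Longrightarrow> s (Nom a) = s' (Nom a)"
  shows "psubst s t = psubst s' t"
  using assms
proof (induction arbitrary: s s' rule: has_type.induct)
  case (6 \<sigma> \<Delta> t \<tau>)
  have "psubst (up s) t = psubst (up s') t"
  proof (rule "6.IH")
    show "i < length (\<sigma> # \<Delta>) \<Longrightarrow> up s (Bound i) = up s' (Bound i)" for i
      by (cases i) (auto simp: "6.prems")
  qed (auto simp: "6.prems")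
  then show ?case by simp
next
  case (5 \<Delta> t \<sigma> \<tau> u)
  have "psubst s t = psubst s' t" "psubst s u = psubst s' u"
    by (rule "5.IH"; simp add: "5.prems")+
  then show ?case by simp
qed simp_all

lemma psubst_idle:
  assumes "tyd t \<tau>" "\<And>x. x \<in> fv t \<Longrightarrow> s (Var x) = Var x" "\<And>a. a \<in> supp t \<Longrightarrow> s (Nom a) = Nom a"
  shows "psubst s t = t"
  using psubst_cong_typed[OF assms(1), of s id] assms(2,3) by (simp add: psubst_id)

lemma lift_tyd: "tyd t \<tau> \<Longrightarrow> lift k t = t"
  by (subst lift_eq_psubst, rule psubst_idle) auto

lemma has_type_supp: "has_type \<Delta> t \<tau> \<Longrightarrow> a \<in> supp t \<Longrightarrow> ntype a \<in> nominal"
  by (induction rule: has_type.induct) auto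

lemma tyd_weaken: "tyd t \<tau> \<Longrightarrow> has_type \<Delta> t \<tau>"
  using has_type_psubst[of "[]" t \<tau> \<Delta> id] by (auto simp: psubst_id intro: has_type.intros)

lemma has_type_apps:
  "has_type \<Delta> (apps t us) \<tau> \<Longrightarrow>
   \<exists>\<tau>s. has_type \<Delta> t (foldr (\<rightarrow>) \<tau>s \<tau>) \<and> list_all2 (has_type \<Delta>) us \<tau>s"
proof (induction us arbitrary: \<tau> rule: rev_induct)
  case (snoc u us)
  then obtain \<sigma> where "has_type \<Delta> (apps t us) (\<sigma> \<rightarrow> \<tau>)" "has_type \<Delta> u \<sigma>"
    by (auto elim: has_type_AppE)
  with snoc.IH obtain \<tau>s where "has_type \<Delta> t (foldr (\<rightarrow>) \<tau>s (\<sigma> \<rightarrow> \<tau>))" "list_all2 (has_type \<Delta>) us \<tau>s"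
    by blast
  then have "has_type \<Delta> t (foldr (\<rightarrow>) (\<tau>s @ [\<sigma>]) \<tau>)" "list_all2 (has_type \<Delta>) (us @ [u]) (\<tau>s @ [\<sigma>])"
    using \<open>has_type \<Delta> u \<sigma>\<close> by (auto intro: list_all2_appendI)
  then show ?case by blast
qed auto

lemma nf_apps_Cst:
  assumes "has_type \<Delta> (apps (Cst c) ts) \<tau>"
  shows "nf (apps (Cst c) ts) = apps (Cst c) (map nf ts)"
proof (rule nf_unique[OF assms])
  obtain \<tau>s where ts: "list_all2 (has_type \<Delta>) ts \<tau>s" using has_type_apps[OF assms] by blast
  then have *: "\<exists>\<tau>. has_type \<Delta> t \<tau>" if "t \<in> set ts" for t
    using that by (metis in_set_conv_nth list_all2_conv_all_nth)
  show "red\<^sup>*\<^sup>* (apps (Cst c) ts) (apps (Cst c) (map nf ts))"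
    by (rule reds_apps_args) (use * reds_nf in \<open>auto simp: list_all2_conv_all_nth, metis nth_mem\<close>)
  show "normal (apps (Cst c) (map nf ts))"
    using * normal_nf by (subst normal_apps) auto
qed

subsection \<open>Well-typed substitutions\<close>

text \<open>The action of substitutions on normal forms, that is, on beta-eta-classes of typed
  terms; \<open>act_act\<close> says that it respects composition.\<close>

definition act :: "(('b, 'k, 'n) tm \<Rightarrow> ('b, 'k, 'n) tm) \<Rightarrow> ('b, 'k, 'n) tm \<Rightarrow> ('b, 'k, 'n) tm" where
  "act s t = nf (psubst s t)"

text \<open>Nominal constants may go to arbitrary terms of their type, not only to nominal
  constants; \<open>unifier_without_nominals\<close> uses this to trade them for variables.\<close>

definition tsub :: "'b var set \<Rightarrow> (('b, 'k, 'n) tm \<Rightarrow> ('b, 'k, 'n) tm) \<Rightarrow> bool" where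
  "tsub \<Sigma> s \<longleftrightarrow> (\<forall>x\<in>\<Sigma>. tyd (s (Var x)) (snd x)) \<and>
     (\<forall>a. ntype a \<in> nominal \<longrightarrow> tyd (s (Nom a)) (ntype a))"

lemma tyd_psubst: "tyd t \<tau> \<Longrightarrow> fv t \<subseteq> \<Sigma> \<Longrightarrow> tsub \<Sigma> s \<Longrightarrow> tyd (psubst s t) \<tau>"
  by (rule has_type_psubst) (auto simp: tsub_def)

lemma tyd_act: "tyd t \<tau> \<Longrightarrow> fv t \<subseteq> \<Sigma> \<Longrightarrow> tsub \<Sigma> s \<Longrightarrow> tyd (act s t) \<tau>"
  unfolding act_def by (intro has_type_nf tyd_psubst)

lemma normal_act: "tyd t \<tau> \<Longrightarrow> fv t \<subseteq> \<Sigma> \<Longrightarrow> tsub \<Sigma> s \<Longrightarrow> normal (act s t)"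
  unfolding act_def by (rule normal_nf[OF tyd_psubst])

lemma act_nf: "tyd t \<tau> \<Longrightarrow> fv t \<subseteq> \<Sigma> \<Longrightarrow> tsub \<Sigma> s \<Longrightarrow> act s (nf t) = act s t"
  unfolding act_def by (rule nf_reds[symmetric, OF tyd_psubst reds_psubst[OF reds_nf]])

lemma act_act:
  assumes "tyd t \<tau>" "fv t \<subseteq> \<Sigma>" "tsub \<Sigma> s'" "fv (psubst s' t) \<subseteq> \<Sigma>'" "tsub \<Sigma>' s"
  shows "act s (act s' t) = act (\<lambda>a. psubst s (s' a)) t"
  using act_nf[OF tyd_psubst[OF assms(1-3)] assms(4,5)] by (simp add: act_def psubst_psubst)

lemma nf_App_nf: "tyd (t \<cdot> u) \<tau> \<Longrightarrow> nf (nf t \<cdot> nf u) = nf (t \<cdot> u)"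
  by (rule nf_reds[symmetric]) (auto elim!: has_type_AppE intro!: reds_app reds_nf)

lemma act_App:
  assumes "tyd (t \<cdot> u) \<tau>" "fv (t \<cdot> u) \<subseteq> \<Sigma>" "tsub \<Sigma> s"
  shows "act s (nf (t \<cdot> u)) = nf (act s t \<cdot> act s u)"
  using act_nf[OF assms] nf_App_nf[of "psubst s t" "psubst s u"] tyd_psubst[OF assms] by (simp add: act_def)

lemma act_apps_Cst:
  assumes "tyd (apps (Cst c) ts) \<tau>" "fv (apps (Cst c) ts) \<subseteq> \<Sigma>" "tsub \<Sigma> s"
  shows "act s (apps (Cst c) ts) = apps (Cst c) (map (act s) ts)"
  using nf_apps_Cst[of "[]" c "map (psubst s) ts"] tyd_psubst[OF assms] by (simp add: act_def[abs_def] psubst_apps o_def)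

lemma tyd_const_iff:
  "tyd (Conj B C) Prop \<longleftrightarrow> tyd B Prop \<and> tyd C Prop"
  "tyd (Disj B C) Prop \<longleftrightarrow> tyd B Prop \<and> tyd C Prop"
  "tyd (Imp B C) Prop \<longleftrightarrow> tyd B Prop \<and> tyd C Prop"
  "tyd (Eq \<tau> s t) Prop \<longleftrightarrow> tyd s \<tau> \<and> tyd t \<tau>"
  "tyd (Forall \<tau> F) Prop \<longleftrightarrow> o_free \<tau> \<and> tyd F (\<tau> \<rightarrow> Prop)"
  "tyd (Exists \<tau> F) Prop \<longleftrightarrow> o_free \<tau> \<and> tyd F (\<tau> \<rightarrow> Prop)"
  "tyd (Nabla \<tau> F) Prop \<longleftrightarrow> \<tau> \<in> nominal \<and> tyd F (\<tau> \<rightarrow> Prop)"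
  "tyd (NatP t) Prop \<longleftrightarrow> tyd t Nt"
  "tyd (Succ t) Nt \<longleftrightarrow> tyd t Nt"
  "tyd Bot Prop" "tyd Top Prop" "tyd Zero Nt"
proof -
  have c: "cst_ok c \<Longrightarrow> cst_type c = \<tau> \<Longrightarrow> tyd (Cst c) \<tau>" for c \<tau>
    using has_type.intros(4) by blast
  have 2: "tyd (Cst c \<cdot> B \<cdot> C) \<tau>'' \<longleftrightarrow> tyd B \<tau> \<and> tyd C \<tau>'"
    if "cst_ok c" "cst_type c = \<tau> \<rightarrow> \<tau>' \<rightarrow> \<tau>''" for c B C \<tau> \<tau>' \<tau>''
    using that by (auto elim!: has_type_AppE has_type_CstE intro!: has_type.intros(5) c)
  have 1: "tyd (Cst c \<cdot> B) \<tau>' \<longleftrightarrow> cst_ok c \<and> tyd B \<tau>"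
    if "cst_type c = \<tau> \<rightarrow> \<tau>'" for c B \<tau> \<tau>'
    using that by (auto elim!: has_type_AppE has_type_CstE intro!: has_type.intros(5) c)
  show "tyd (Conj B C) Prop \<longleftrightarrow> tyd B Prop \<and> tyd C Prop"
    "tyd (Disj B C) Prop \<longleftrightarrow> tyd B Prop \<and> tyd C Prop"
    "tyd (Imp B C) Prop \<longleftrightarrow> tyd B Prop \<and> tyd C Prop"
    "tyd (Eq \<tau> s t) Prop \<longleftrightarrow> tyd s \<tau> \<and> tyd t \<tau>"
    by (rule 2; simp)+
  show "tyd (Forall \<tau> F) Prop \<longleftrightarrow> o_free \<tau> \<and> tyd F (\<tau> \<rightarrow> Prop)"
    "tyd (Exists \<tau> F) Prop \<longleftrightarrow> o_free \<tau> \<and> tyd F (\<tau> \<rightarrow> Prop)"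
    "tyd (Nabla \<tau> F) Prop \<longleftrightarrow> \<tau> \<in> nominal \<and> tyd F (\<tau> \<rightarrow> Prop)"
    "tyd (NatP t) Prop \<longleftrightarrow> tyd t Nt" "tyd (Succ t) Nt \<longleftrightarrow> tyd t Nt"
    by (subst 1; simp)+
qed (auto intro: has_type.intros(4)[of _ "[]", simplified]
      has_type.intros(4)[of CBot "[]", simplified] has_type.intros(4)[of CTop "[]", simplified]
      has_type.intros(4)[of CZero "[]", simplified])

lemma is_term_const_iff:
  "is_term \<Sigma> (Conj B C) Prop \<longleftrightarrow> is_term \<Sigma> B Prop \<and> is_term \<Sigma> C Prop"
  "is_term \<Sigma> (Disj B C) Prop \<longleftrightarrow> is_term \<Sigma> B Prop \<and> is_term \<Sigma> C Prop"
  "is_term \<Sigma> (Imp B C) Prop \<longleftrightarrow> is_term \<Sigma> B Prop \<and> is_term \<Sigma> C Prop"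
  "is_term \<Sigma> (Eq \<tau> s t) Prop \<longleftrightarrow> is_term \<Sigma> s \<tau> \<and> is_term \<Sigma> t \<tau>"
  "is_term \<Sigma> (Forall \<tau> F) Prop \<longleftrightarrow> o_free \<tau> \<and> is_term \<Sigma> F (\<tau> \<rightarrow> Prop)"
  "is_term \<Sigma> (Exists \<tau> F) Prop \<longleftrightarrow> o_free \<tau> \<and> is_term \<Sigma> F (\<tau> \<rightarrow> Prop)"
  "is_term \<Sigma> (Nabla \<tau> F) Prop \<longleftrightarrow> \<tau> \<in> nominal \<and> is_term \<Sigma> F (\<tau> \<rightarrow> Prop)"
  "is_term \<Sigma> (NatP t) Prop \<longleftrightarrow> is_term \<Sigma> t Nt"
  "is_term \<Sigma> (Succ t) Nt \<longleftrightarrow> is_term \<Sigma> t Nt"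
  "is_term \<Sigma> Bot Prop" "is_term \<Sigma> Top Prop" "is_term \<Sigma> Zero Nt"
  by (auto simp: is_term_def tyd_const_iff normal_App)

lemma is_term_nf_App:
  "is_term \<Sigma> F (\<tau> \<rightarrow> \<tau>') \<Longrightarrow> is_term \<Sigma> t \<tau> \<Longrightarrow> is_term \<Sigma> (nf (F \<cdot> t)) \<tau>'"
  unfolding is_term_def using has_type.intros(5)[of "[]" F \<tau> \<tau>' t]
  by (auto simp: normal_nf has_type_nf dest!: subsetD[OF reds_fv[OF reds_nf]])

subsection \<open>Permutations of nominal constants\<close>

lemma is_perm_id [simp]: "is_perm id" "is_perm (\<lambda>a. a)"
  by (auto simp: is_perm_def id_def[symmetric])

lemma is_perm_comp:
  assumes "is_perm \<pi>" "is_perm \<pi>'"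
  shows "is_perm (\<pi> \<circ> \<pi>')"
  unfolding is_perm_def
proof (intro conjI)
  have "{a. (\<pi> \<circ> \<pi>') a \<noteq> a} \<subseteq> {a. \<pi> a \<noteq> a} \<union> {a. \<pi>' a \<noteq> a}" by auto
  then show "finite {a. (\<pi> \<circ> \<pi>') a \<noteq> a}"
    using assms unfolding is_perm_def by (metis (no_types, lifting) finite_UnI finite_subset)
qed (use assms in \<open>auto simp: is_perm_def bij_comp\<close>)

lemma is_perm_inv:
  assumes "is_perm \<pi>"
  shows "is_perm (inv \<pi>)"
proof -
  have b: "bij \<pi>" using assms by (simp add: is_perm_def)
  then have [simp]: "\<pi> (inv \<pi> a) = a" "inv \<pi> (\<pi> a) = a" for a
    by (simp_all add: bij_is_surj surj_f_inv_f bij_is_inj)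
  have "{a. inv \<pi> a \<noteq> a} = {a. \<pi> a \<noteq> a}"
    by (metis \<open>\<And>a. \<pi> (inv \<pi> a) = a\<close> \<open>\<And>a. inv \<pi> (\<pi> a) = a\<close>)
  moreover have "ntype (inv \<pi> a) = ntype a" for a
    using assms by (metis \<open>\<And>a. \<pi> (inv \<pi> a) = a\<close> is_perm_def)
  ultimately show ?thesis using assms b by (simp add: is_perm_def bij_imp_bij_inv)
qed

lemma is_perm_swap:
  assumes "ntype a = ntype b"
  shows "is_perm (id(a := b, b := a))"
  unfolding is_perm_def
proof (intro conjI allI)
  have "(id(a := b, b := a)) \<circ> (id(a := b, b := a)) = id" by (auto simp: fun_eq_iff)
  then show "bij (id(a := b, b := a))" using o_bij by blast
  have "{c. (id(a := b, b := a)) c \<noteq> c} \<subseteq> {a, b}" by auto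
  then show "finite {c. (id(a := b, b := a)) c \<noteq> c}" by (rule finite_subset) simp
  show "ntype ((id(a := b, b := a)) c) = ntype c" for c using assms by simp
qed

lemma perm_inv:
  assumes "is_perm \<pi>"
  shows "perm (inv \<pi>) (perm \<pi> t) = t" "perm \<pi> (perm (inv \<pi>) t) = t"
proof -
  have "inv \<pi> \<circ> \<pi> = id" "\<pi> \<circ> inv \<pi> = id"
    using assms by (auto simp: is_perm_def bij_is_inj bij_is_surj surj_iff[symmetric])
  then show "perm (inv \<pi>) (perm \<pi> t) = t" "perm \<pi> (perm (inv \<pi>) t) = t"
    by (simp_all add: perm_perm tm.map_id)
qed

text \<open>One point is added at a time: the permutation found for \<open>A\<close> is followed by
  the swap of \<open>\<pi> a\<close> and \<open>f a\<close>, which by injectivity moves none of the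
  values already fixed.\<close>

lemma perm_extend:
  assumes "finite A" "inj_on f A" "\<And>a. a \<in> A \<Longrightarrow> ntype (f a) = ntype a"
  obtains \<pi> where "is_perm \<pi>" "\<And>a. a \<in> A \<Longrightarrow> \<pi> a = f a"
proof -
  have "\<exists>\<pi>. is_perm \<pi> \<and> (\<forall>a\<in>A. \<pi> a = f a)"
    using assms
  proof (induction A)
    case (insert a A)
    then obtain \<pi> where \<pi>: "is_perm \<pi>" "\<forall>a\<in>A. \<pi> a = f a" by auto
    have ty: "ntype (\<pi> a) = ntype (f a)" using \<pi>(1) insert.prems by (simp add: is_perm_def)
    have "inj \<pi>" using \<pi>(1) by (simp add: is_perm_def bij_is_inj)
    then have ne: "\<pi> b \<noteq> \<pi> a" "\<pi> b \<noteq> f a" if "b \<in> A" for b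
    proof -
      have "b \<noteq> a" using that insert.hyps by auto
      then show "\<pi> b \<noteq> \<pi> a" using \<open>inj \<pi>\<close> by (auto dest: injD)
      have "f b \<noteq> f a" using inj_onD[OF insert.prems(1), of b a] \<open>b \<noteq> a\<close> that by auto
      then show "\<pi> b \<noteq> f a" using that \<pi>(2) by auto
    qed
    have "is_perm (id(\<pi> a := f a, f a := \<pi> a) \<circ> \<pi>)"
      by (rule is_perm_comp[OF is_perm_swap[OF ty] \<pi>(1)])
    moreover have "\<forall>b\<in>insert a A. (id(\<pi> a := f a, f a := \<pi> a) \<circ> \<pi>) b = f b"
      using ne \<pi>(2) by auto
    ultimately show ?case by blast
  next
    case empty
    show ?case using is_perm_id(1) by blast
  qed
  then show ?thesis using that by blast
qed

text \<open>Each \<open>a\<close> whose image lies in \<open>S\<close> gets a fresh image of its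
  type by a swap, infinitely many being at hand. The values on \<open>A0\<close> do not move, as
  they lie outside \<open>S\<close> and differ from the fresh one.\<close>

lemma perm_avoid:
  assumes "nominal_types_ok" "finite A" "finite S" "finite A0" "is_perm \<pi>0" "\<pi>0 ` A0 \<inter> S = {}"
    "\<And>a. a \<in> A \<Longrightarrow> ntype a \<in> nominal"
  obtains \<pi> where "is_perm \<pi>" "\<And>a. a \<in> A0 \<Longrightarrow> \<pi> a = \<pi>0 a" "\<pi> ` A \<inter> S = {}"
proof -
  have "\<exists>\<pi>. is_perm \<pi> \<and> (\<forall>a\<in>A0. \<pi> a = \<pi>0 a) \<and> \<pi> ` A \<inter> S = {}"
    using assms(2,7)
  proof (induction A)
    case empty
    then show ?case using assms(5) by auto
  next
    case (insert a A)
    then obtain \<pi> where \<pi>: "is_perm \<pi>" "\<forall>a\<in>A0. \<pi> a = \<pi>0 a" "\<pi> ` A \<inter> S = {}" by auto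
    show ?case
    proof (cases "\<pi> a \<in> S")
      case True
      have "infinite {b. ntype b = ntype a}"
        using assms(1) insert.prems by (auto simp: nominal_types_ok_def)
      then have "infinite ({b. ntype b = ntype a} - (S \<union> \<pi> ` A \<union> \<pi> ` A0))"
        using assms(3,4) insert.hyps(1) by (intro Diff_infinite_finite) auto
      then have "{b. ntype b = ntype a} - (S \<union> \<pi> ` A \<union> \<pi> ` A0) \<noteq> {}" using infinite_imp_nonempty by blast
      then obtain b where b: "ntype b = ntype a" "b \<notin> S" "b \<notin> \<pi> ` A" "b \<notin> \<pi> ` A0" by blast
      have ty: "ntype (\<pi> a) = ntype b" using \<pi>(1) b by (simp add: is_perm_def)
      let ?\<pi>' = "(id(\<pi> a := b, b := \<pi> a)) \<circ> \<pi>"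
      have "is_perm ?\<pi>'" by (intro is_perm_comp is_perm_swap[OF ty] \<pi>)
      moreover have "\<pi> c \<noteq> \<pi> a" "\<pi> c \<noteq> b" if "c \<in> A0" for c
        using that b(4) True \<pi>(2) assms(6) by auto
      then have "\<forall>c\<in>A0. ?\<pi>' c = \<pi>0 c" using \<pi>(2) by auto
      moreover have "\<pi> c \<noteq> \<pi> a" "\<pi> c \<noteq> b" if "c \<in> A" for c
        using that b(3) True \<pi>(3) by auto
      then have "?\<pi>' ` insert a A \<inter> S = {}" using \<pi>(3) b(2) by auto
      ultimately show ?thesis by blast
    next
      case False
      then show ?thesis using \<pi> by auto
    qed
  qed
  then show ?thesis using that by blast
qed

lemma fresh_nominal:
  assumes "nominal_types_ok" "\<tau> \<in> nominal" "finite S"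
  obtains a where "ntype a = \<tau>" "a \<notin> S"
proof -
  have "infinite ({b. ntype b = \<tau>} - S)"
    using assms by (auto simp: nominal_types_ok_def intro: Diff_infinite_finite)
  then have "{b. ntype b = \<tau>} - S \<noteq> {}" using infinite_imp_nonempty by blast
  then show ?thesis using that by blast
qed

subsection \<open>Abstraction over nominal constants\<close>

lemma abs_noms_simps [simp]:
  "abs_noms [] t = t" "abs_noms (c # cs) t = Lam (ntype c) (bind_nom c 0 (abs_noms cs t))"
  by (simp_all add: abs_noms_def)

lemma raised_simps [simp]: "raised [] \<tau> = \<tau>" "raised (c # cs) \<tau> = ntype c \<rightarrow> raised cs \<tau>"
  by (simp_all add: raised_def)

lemma tyd_bind_nom:
  assumes "tyd t \<tau>" "ntype c \<in> nominal"
  shows "has_type [ntype c] (bind_nom c 0 t) \<tau>"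
  unfolding bind_nom_eq_psubst[of c 0 t]
proof (rule has_type_psubst[OF assms(1)])
  show "has_type [ntype c] (bind_nom c 0 (Nom a)) (ntype a)" if "ntype a \<in> nominal" for a
    using that has_type.intros(1)[of 0 "[ntype c]"] by (auto intro: has_type.intros)
qed (auto intro: has_type.intros)

lemma tyd_abs_noms:
  "tyd t \<tau> \<Longrightarrow> (\<And>c. c \<in> set cs \<Longrightarrow> ntype c \<in> nominal) \<Longrightarrow> tyd (abs_noms cs t) (raised cs \<tau>)"
  by (induction cs) (auto intro!: has_type.intros(6) tyd_bind_nom)

lemma fv_bind_nom [simp]: "fv (bind_nom c k t) = fv t"
  by (induction t arbitrary: k) auto

lemma supp_bind_nom [simp]: "supp (bind_nom c k t) = supp t - {c}"
  by (induction t arbitrary: k) auto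

lemma fv_abs_noms [simp]: "fv (abs_noms cs t) = fv t"
  by (induction cs) auto

lemma supp_abs_noms [simp]: "supp (abs_noms cs t) = supp t - set cs"
  by (induction cs) auto

lemma subst_bound_bind_nom:
  assumes "tyd t \<tau>"
  shows "subst_bound 0 (Nom c) (bind_nom c 0 t) = t"
  by (subst subst_bound_eq_psubst, subst bind_nom_eq_psubst) (auto simp: psubst_psubst intro!: psubst_idle[OF assms])

lemma reds_apps_abs_noms:
  assumes "tyd t \<tau>" "\<And>c. c \<in> set cs \<Longrightarrow> ntype c \<in> nominal"
  shows "red\<^sup>*\<^sup>* (apps (abs_noms cs t) (map Nom cs)) t"
  using assms(2)
proof (induction cs)
  case (Cons c cs)
  have "tyd (abs_noms cs t) (raised cs \<tau>)" using Cons.prems assms(1) by (intro tyd_abs_noms) auto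
  then have "red (abs_noms (c # cs) t \<cdot> Nom c) (abs_noms cs t)"
    using red.beta[of "ntype c" "bind_nom c 0 (abs_noms cs t)" "Nom c"] by (simp add: subst_bound_bind_nom)
  then have "red\<^sup>*\<^sup>* (apps (abs_noms (c # cs) t) (map Nom (c # cs))) (apps (abs_noms cs t) (map Nom cs))"
    using reds_apps_fun by auto
  also have "red\<^sup>*\<^sup>* \<dots> t" using Cons by simp
  finally show ?case .
qed simp

lemma reds_abs_noms: "red\<^sup>*\<^sup>* t u \<Longrightarrow> red\<^sup>*\<^sup>* (abs_noms cs t) (abs_noms cs u)"
proof (induction cs)
  case (Cons c cs)
  then show ?case
    using reds_psubst[of "abs_noms cs t" "abs_noms cs u" "bind_nom c 0"]
    by (auto intro!: reds_lam simp flip: bind_nom_eq_psubst)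
qed simp

lemma psubst_abs_noms:
  assumes "tyd t \<tau>" "\<And>c. c \<in> set cs \<Longrightarrow> ntype c \<in> nominal" "\<And>a. s (Nom a) = Nom a"
    "\<And>x. x \<in> fv t \<Longrightarrow> tyd (s (Var x)) (snd x) \<and> supp (s (Var x)) \<inter> set cs = {}"
  shows "psubst s (abs_noms cs t) = abs_noms cs (psubst s t)"
  using assms(2,4)
proof (induction cs)
  case (Cons c cs)
  have ty: "tyd (abs_noms cs t) (raised cs \<tau>)" using Cons.prems assms(1) by (intro tyd_abs_noms) auto
  have "psubst (up s) (bind_nom c 0 (abs_noms cs t)) = psubst (\<lambda>a. psubst (up s) (bind_nom c 0 a)) (abs_noms cs t)"
    by (subst bind_nom_eq_psubst) (simp add: psubst_psubst)
  also have "\<dots> = psubst (\<lambda>a. psubst (bind_nom c 0) (s a)) (abs_noms cs t)"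
  proof (rule psubst_cong_typed[OF ty])
    show "psubst (up s) (bind_nom c 0 (Var x)) = psubst (bind_nom c 0) (s (Var x))" if "x \<in> fv (abs_noms cs t)" for x
    proof -
      have x: "tyd (s (Var x)) (snd x)" "supp (s (Var x)) \<inter> set (c # cs) = {}" using that Cons.prems by auto
      then have "psubst (bind_nom c 0) (s (Var x)) = s (Var x)" by (intro psubst_idle[OF x(1)]) auto
      then show ?thesis using lift_tyd[OF x(1)] by simp
    qed
  qed (auto simp: assms(3))
  also have "\<dots> = bind_nom c 0 (psubst s (abs_noms cs t))"
    by (subst bind_nom_eq_psubst) (simp add: psubst_psubst)
  finally show ?case using Cons by auto
qed simp

lemma lists_supp_exists: "\<exists>cs. lists_supp cs t"
  unfolding lists_supp_def by (metis finite_distinct_list finite_supp)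

lemma tyd_apps_Nom:
  assumes "tyd t (raised cs \<tau>)" "\<And>c. c \<in> set cs \<Longrightarrow> ntype c \<in> nominal"
  shows "tyd (apps t (map Nom cs)) \<tau>"
  using assms
  by (induction cs arbitrary: t) (auto intro: has_type.intros)

lemma fv_apps [simp]: "fv (apps t us) = fv t \<union> (\<Union>u\<in>set us. fv u)"
  by (induction us arbitrary: t) auto

lemma supp_apps [simp]: "supp (apps t us) = supp t \<union> (\<Union>u\<in>set us. supp u)"
  by (induction us arbitrary: t) auto

lemma o_free_raised:
  "nominal_types_ok \<Longrightarrow> o_free \<tau> \<Longrightarrow> (\<And>c. c \<in> set cs \<Longrightarrow> ntype c \<in> nominal) \<Longrightarrow> o_free (raised cs \<tau>)"
  by (induction cs) (auto simp: nominal_types_ok_def)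

lemma act_cong_reds:
  assumes "tyd t \<tau>" "fv t \<subseteq> \<Sigma>" "tsub \<Sigma> f" "\<And>i. f (Bound i) = Bound i" "\<And>i. g (Bound i) = Bound i"
    "\<And>x. x \<in> fv t \<Longrightarrow> red\<^sup>*\<^sup>* (f (Var x)) (g (Var x))" "\<And>a. a \<in> supp t \<Longrightarrow> f (Nom a) = g (Nom a)"
  shows "act f t = act g t"
proof -
  \<comment> \<open>\<open>f\<close> is altered to agree with \<open>g\<close> outside
    \<open>t\<close>, because \<open>reds_psubst_pointwise\<close> asks for a reduction at every
    variable and not just at those of \<open>t\<close>.\<close>
  let ?f = "\<lambda>a. case a of Var x \<Rightarrow> if x \<in> fv t then f a else g a | _ \<Rightarrow> g a"
  have "psubst f t = psubst ?f t" by (rule psubst_cong) (use assms in auto)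
  moreover have "red\<^sup>*\<^sup>* (psubst ?f t) (psubst g t)"
    by (rule reds_psubst_pointwise) (use assms(6) in auto)
  ultimately show ?thesis
    unfolding act_def by (intro nf_reds[OF tyd_psubst[OF assms(1-3)]]) simp
qed

text \<open>\<open>psubst\<close> shifts the substituted terms under binders and
  \<open>msubst\<close> does not; on terms typed in the empty context, shifting is the
  identity.\<close>

lemma msubst_eq_psubst:
  assumes "\<And>x. x \<in> fv t \<Longrightarrow> \<exists>\<tau>. tyd (\<theta> x) \<tau>"
  shows "msubst \<theta> t = psubst (msubst \<theta>) t"
  using assms
proof (induction t)
  case (Lam \<tau> t)
  have "psubst (up (msubst \<theta>)) t = psubst (msubst \<theta>) t"
  proof (rule psubst_cong)
    show "up (msubst \<theta>) (Bound i) = msubst \<theta> (Bound i)" for i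
      by (cases i) auto
    show "up (msubst \<theta>) (Var x) = msubst \<theta> (Var x)" if "x \<in> fv t" for x
      using Lam.prems that lift_tyd by fastforce
  qed auto
  then show ?case using Lam by simp
qed auto

end

section \<open>Logical structure of formulas\<close>

lemma normal_LamD: "normal (Lam \<tau> t) \<Longrightarrow> normal t"
  unfolding normal_def using red.lam by blast

text \<open>The heads for which neither the level nor the number of connectives of a formula depends
  on the arguments.\<close>

fun atomic_cst :: "('b, 'k) cst \<Rightarrow> bool" where
  "atomic_cst (K p) = True"
| "atomic_cst CNat = True"
| "atomic_cst CBot = True"
| "atomic_cst CTop = True"
| "atomic_cst (CEq \<tau>) = True"
| "atomic_cst _ = False"

fun quant_cst :: "('b, 'k) cst \<Rightarrow> bool" where
  "quant_cst (CAll \<tau>) = True"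
| "quant_cst (CEx \<tau>) = True"
| "quant_cst (CNabla \<tau>) = True"
| "quant_cst _ = False"

text \<open>
  \<open>skel l ln B n m\<close>: the formula \<open>B\<close>, not necessarily normal, has \<open>n\<close> connectives and level \<open>m\<close>.
  The argument of a quantifier may be an eta-reduced atom, but never anything else that is not an
  abstraction.
\<close>

inductive skel :: "('k \<Rightarrow> nat) \<Rightarrow> nat \<Rightarrow> ('b, 'k, 'n) tm \<Rightarrow> nat \<Rightarrow> nat \<Rightarrow> bool" for l ln where
  skel_atom: "head t = Cst c \<Longrightarrow> atomic_cst c \<Longrightarrow> skel l ln t 0 (level_cst l ln c [])"
| skel_conj: "skel l ln B n m \<Longrightarrow> skel l ln C n' m' \<Longrightarrow> skel l ln (Conj B C) (Suc (n + n')) (max m m')"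
| skel_disj: "skel l ln B n m \<Longrightarrow> skel l ln C n' m' \<Longrightarrow> skel l ln (Disj B C) (Suc (n + n')) (max m m')"
| skel_imp: "skel l ln B n m \<Longrightarrow> skel l ln C n' m' \<Longrightarrow> skel l ln (Imp B C) (Suc (n + n')) (max (Suc m) m')"
| skel_quant: "quant_cst q \<Longrightarrow> skel l ln B n m \<Longrightarrow> skel l ln (Cst q \<cdot> Lam \<tau> B) (Suc n) m"
| skel_quant_eta: "quant_cst q \<Longrightarrow> head t = Cst c \<Longrightarrow> atomic_cst c \<Longrightarrow>
    skel l ln (Cst q \<cdot> t) (Suc 0) (level_cst l ln c [])"

lemma skel_head: "skel l ln t n m \<Longrightarrow> \<exists>c. head t = Cst c"
  by (induction rule: skel.induct) auto

text \<open>Every leaf of a skeleton is headed by a constant, and no substitution replaces a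
  constant.\<close>

lemma skel_psubst: "skel l ln t n m \<Longrightarrow> skel l ln (psubst s t) n m"
  by (induction arbitrary: s rule: skel.induct) (auto intro: skel.intros head_psubst)

lemma head_lift: "head (lift k t) = Cst c \<Longrightarrow> head t = Cst c"
  by (induction t) (auto split: if_splits)

lemma skel_red: "skel l ln t n m \<Longrightarrow> red t t' \<Longrightarrow> skel l ln t' n m"
proof (induction arbitrary: t' rule: skel.induct)
  case (skel_quant q B n m \<tau>)
  from skel_quant.prems show ?case
  proof (cases rule: red_AppE)
    case (arg u')
    from arg(2) show ?thesis
    proof (cases rule: red_LamE)
      \<comment> \<open>The body ends in \<open>\<cdot> Bound 0\<close>. An index is no formula, so
        it is not the last argument of a connective, nor is it a possible argument of a quantifier;
        the body must be an atom.\<close>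
      case eta_head
      from skel_quant.hyps(2) show ?thesis
        by cases (use eta_head skel_quant.hyps(1) arg(1) lift_eq_simps in
          \<open>auto intro!: skel.skel_quant_eta dest!: head_lift skel_head dest: sym\<close>)
    qed (use skel_quant arg in \<open>auto intro: skel.skel_quant\<close>)
  qed (auto elim: red_CstE)
qed (auto elim!: red_AppE elim: red_CstE intro: skel.intros head_red)

lemma skel_reds: "red\<^sup>*\<^sup>* t t' \<Longrightarrow> skel l ln t n m \<Longrightarrow> skel l ln t' n m"
  by (induction rule: rtranclp_induct) (auto intro: skel_red)

lemma level_args_atomic:
  "head t = Cst c \<Longrightarrow> atomic_cst c \<Longrightarrow> level_args l ln t ns = level_cst l ln c []"
proof (induction t arbitrary: ns)
  case (Cst c')
  then show ?case by (cases c) auto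
qed auto

lemma skel_level: "skel l ln t n m \<Longrightarrow> level l ln t = m"
  by (induction rule: skel.induct)
    (auto simp: level_def level_args_atomic elim!: quant_cst.elims)

context LG
begin

text \<open>Bound variables, variables and nominal constants have types without \<open>o\<close>,
  and applying a term of such a type yields another one. This is where the restriction on quantified
  types enters: no formula is headed by a variable.\<close>

lemma neutral_head:
  assumes "has_type \<Delta> t \<tau>" "normal t" "\<not> is_lam t" "\<forall>\<delta>\<in>set \<Delta>. o_free \<delta>"
    "\<forall>x\<in>fv t. o_free (snd x)" "nominal_types_ok"
  shows "o_free \<tau> \<or> (\<exists>c. head t = Cst c)"
  using assms
  by (induction rule: has_type.induct) (auto simp: nominal_types_ok_def normal_App is_lam_def)

lemma foldr_Arr_eq_iff:
  "foldr (\<rightarrow>) \<tau>s \<tau> = \<sigma> \<rightarrow> \<rho> \<longleftrightarrow>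
    \<tau>s = [] \<and> \<tau> = \<sigma> \<rightarrow> \<rho> \<or> (\<exists>\<tau>s'. \<tau>s = \<sigma> # \<tau>s' \<and> foldr (\<rightarrow>) \<tau>s' \<tau> = \<rho>)"
  "foldr (\<rightarrow>) \<tau>s \<tau> = Prop \<longleftrightarrow> \<tau>s = [] \<and> \<tau> = Prop"
  "foldr (\<rightarrow>) \<tau>s \<tau> = Nt \<longleftrightarrow> \<tau>s = [] \<and> \<tau> = Nt"
  by (cases \<tau>s; auto)+

lemma apps_Cst_typing:
  assumes "has_type \<Delta> t \<tau>" "head t = Cst c"
  obtains us \<tau>s where "t = apps (Cst c) us" "cst_type c = foldr (\<rightarrow>) \<tau>s \<tau>"
    "list_all2 (has_type \<Delta>) us \<tau>s" "cst_ok c"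
proof -
  obtain us where t: "t = apps (Cst c) us" using head_apps_exists[of t] assms(2) by auto
  then obtain \<tau>s where "has_type \<Delta> (Cst c) (foldr (\<rightarrow>) \<tau>s \<tau>)" "list_all2 (has_type \<Delta>) us \<tau>s"
    using has_type_apps assms(1) by blast
  moreover from this(1) have "cst_type c = foldr (\<rightarrow>) \<tau>s \<tau>" "cst_ok c" by (auto elim: has_type_CstE)
  ultimately show ?thesis using that t by blast
qed

text \<open>A partially applied connective or a bare quantifier expects an argument whose type
  contains \<open>o\<close>, which \<open>o_free \<tau>\<close> excludes.\<close>

lemma quant_arg_head:
  assumes "has_type \<Delta> F (\<tau> \<rightarrow> Prop)" "head F = Cst c" "o_free \<tau>"
  shows "atomic_cst c"
proof -
  obtain us \<tau>s where "cst_type c = foldr (\<rightarrow>) \<tau>s (\<tau> \<rightarrow> Prop)"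
    using apps_Cst_typing[OF assms(1,2)] by metis
  then show ?thesis using assms(3)
    by (cases c) (auto simp: foldr_Arr_eq_iff dest: sym)
qed

lemma formula_shape:
  assumes "has_type \<Delta> t Prop" "normal t" "\<forall>\<delta>\<in>set \<Delta>. o_free \<delta>" "\<forall>x\<in>fv t. o_free (snd x)" "nominal_types_ok"
  obtains (atom) p where "head t = Cst (K p)"
  | (bot) "t = Bot" | (top) "t = Top"
  | (conj) B C where "t = Conj B C" "has_type \<Delta> B Prop" "has_type \<Delta> C Prop"
  | (disj) B C where "t = Disj B C" "has_type \<Delta> B Prop" "has_type \<Delta> C Prop"
  | (imp) B C where "t = Imp B C" "has_type \<Delta> B Prop" "has_type \<Delta> C Prop"
  | (eq) \<tau> s u where "t = Eq \<tau> s u"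
  | (all) \<tau> F where "t = Forall \<tau> F" "has_type \<Delta> F (\<tau> \<rightarrow> Prop)" "o_free \<tau>"
  | (ex) \<tau> F where "t = Exists \<tau> F" "has_type \<Delta> F (\<tau> \<rightarrow> Prop)" "o_free \<tau>"
  | (nabla) \<tau> F where "t = Nabla \<tau> F" "has_type \<Delta> F (\<tau> \<rightarrow> Prop)" "o_free \<tau>"
  | (nat) I where "t = NatP I"
proof -
  have "\<not> is_lam t" using assms(1) by (auto simp: is_lam_def elim: has_type_LamE)
  then obtain c where c: "head t = Cst c" using neutral_head[OF assms(1,2) _ assms(3-5)] by auto
  obtain us \<tau>s where t: "t = apps (Cst c) us" "cst_type c = foldr (\<rightarrow>) \<tau>s Prop"
    "list_all2 (has_type \<Delta>) us \<tau>s" "cst_ok c"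
    using apps_Cst_typing[OF assms(1) c] by metis
  show ?thesis
  proof (cases c)
    case (K p)
    then show ?thesis using c atom by auto
  qed (use t that assms(5) in \<open>auto simp: foldr_Arr_eq_iff list_all2_Cons2 nominal_types_ok_def dest!: sym[of _ "foldr _ _ _"]\<close>)
qed

lemma skel_exists:
  assumes "has_type \<Delta> t Prop" "normal t" "\<forall>\<delta>\<in>set \<Delta>. o_free \<delta>" "\<forall>x\<in>fv t. o_free (snd x)" "nominal_types_ok"
  shows "\<exists>n m. skel l ln t n m"
  using assms(1-4)
proof (induction "size t" arbitrary: t \<Delta> rule: less_induct)
  case less
  have Q: "\<exists>n m. skel l ln (Cst q \<cdot> F) n m"
    if q: "quant_cst q" "t = Cst q \<cdot> F" "has_type \<Delta> F (\<tau> \<rightarrow> Prop)" "o_free \<tau>" for q \<tau> F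
  proof (cases "is_lam F")
    case True
    then obtain B where B: "F = Lam \<tau> B" "has_type (\<tau> # \<Delta>) B Prop"
      using q(3) by (auto simp: is_lam_def elim: has_type_LamE)
    have "normal B" using less.prems(2) B q(2) by (auto simp: normal_App dest: normal_LamD)
    then have "\<exists>n m. skel l ln B n m"
      using B q less.prems by (intro less.hyps[of B "\<tau> # \<Delta>"]) auto
    then show ?thesis using B q skel_quant by blast
  next
    case False
    then obtain c where "head F = Cst c"
      using neutral_head[OF q(3) _ False less.prems(3)] less.prems q assms(5) by (auto simp: normal_App)
    then show ?thesis using quant_arg_head[OF q(3) _ q(4)] skel_quant_eta q(1) by blast
  qed
  have IH: "\<exists>n m. skel l ln B n m" if "size B < size t" "normal B" "fv B \<subseteq> fv t" "has_type \<Delta> B Prop" for B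
    using less.hyps[OF that(1,4,2)] less.prems that(3) by blast
  from less.prems assms(5) show ?case
  proof (cases rule: formula_shape)
    case (conj B C)
    then obtain n m n' m' where "skel l ln B n m" "skel l ln C n' m'"
      using IH[of B] IH[of C] less.prems(2) by (auto simp: normal_App)
    then show ?thesis using conj skel_conj by blast
  next
    case (disj B C)
    then obtain n m n' m' where "skel l ln B n m" "skel l ln C n' m'"
      using IH[of B] IH[of C] less.prems(2) by (auto simp: normal_App)
    then show ?thesis using disj skel_disj by blast
  next
    case (imp B C)
    then obtain n m n' m' where "skel l ln B n m" "skel l ln C n' m'"
      using IH[of B] IH[of C] less.prems(2) by (auto simp: normal_App)
    then show ?thesis using imp skel_imp by blast
  next
    case (all \<tau> F)
    then show ?thesis using Q[of "CAll \<tau>"] by simp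
  next
    case (ex \<tau> F)
    then show ?thesis using Q[of "CEx \<tau>"] by simp
  next
    case (nabla \<tau> F)
    then show ?thesis using Q[of "CNabla \<tau>"] by simp
  next
    case (atom p)
    then show ?thesis using skel_atom[of t "K p"] by auto
  next
    case bot
    then show ?thesis using skel_atom[of t CBot] by auto
  next
    case top
    then show ?thesis using skel_atom[of t CTop] by auto
  next
    case (eq \<tau> s u)
    then show ?thesis using skel_atom[of t "CEq \<tau>"] by auto
  next
    case (nat I)
    then show ?thesis using skel_atom[of t CNat] by auto
  qed
qed

lemma skel_nf: "tyd t \<tau> \<Longrightarrow> skel l ln t n m \<Longrightarrow> skel l ln (nf t) n m"
  by (rule skel_reds[OF reds_nf])

text \<open>Instantiating a quantifier can enlarge the term, but it removes one connective and keeps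
  the level. The number of connectives is therefore the measure for inductions on formulas.\<close>

lemma skel_instance:
  assumes "skel l ln (Cst q \<cdot> F) n m" "quant_cst q" "tyd (F \<cdot> t) \<tau>"
  obtains n' where "n' < n" "skel l ln (nf (F \<cdot> t)) n' m"
  using assms(1)
proof cases
  case (skel_quant B n' \<tau>)
  then have "skel l ln (subst_bound 0 t B) n' m"
    by (subst subst_bound_eq_psubst) (rule skel_psubst)
  moreover have "red\<^sup>*\<^sup>* (subst_bound 0 t B) (nf (F \<cdot> t))"
  proof -
    have r: "red (F \<cdot> t) (subst_bound 0 t B)" unfolding skel_quant by (rule red.beta)
    have "tyd (subst_bound 0 t B) \<tau>'" if "tyd (F \<cdot> t) \<tau>'" for \<tau>' using red_has_type[OF r that] .
    from reds_nf[OF this[OF assms(3)]] show ?thesis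
      using nf_reds[OF assms(3), of "subst_bound 0 t B"] r by (metis r_into_rtranclp)
  qed
  ultimately show ?thesis using that skel_reds skel_quant by (metis lessI)
next
  case (skel_quant_eta c)
  then show ?thesis using that[of 0] skel_nf[OF assms(3)] skel_atom[of "F \<cdot> t" c l ln] by auto
qed (use assms(2) in \<open>auto elim: quant_cst.elims\<close>)

end

section \<open>Worlds\<close>

type_synonym ('b, 'k, 'n) world = "'b var set \<times> ('b, 'k, 'n) tm multiset"
type_synonym ('b, 'k, 'n) subst = "('b, 'k, 'n) tm \<Rightarrow> ('b, 'k, 'n) tm"

definition cmp :: "('b, 'k, 'n) subst \<Rightarrow> ('b, 'k, 'n) subst \<Rightarrow> ('b, 'k, 'n) subst" where
  "cmp r s = (\<lambda>a. psubst r (s a))"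

lemma cmp_assoc: "cmp (cmp r s) s' = cmp r (cmp s s')"
  by (simp add: cmp_def psubst_psubst)

lemma cmp_id [simp]: "cmp id s = s"
  by (simp add: cmp_def psubst_id)

lemma foldr_Arr_inject: "foldr (\<rightarrow>) \<tau>s Prop = foldr (\<rightarrow>) \<tau>s' Prop \<longleftrightarrow> \<tau>s = \<tau>s'"
proof (induction \<tau>s arbitrary: \<tau>s')
  case Nil
  show ?case by (cases \<tau>s') auto
next
  case (Cons \<tau> \<tau>s)
  then show ?case by (cases \<tau>s') auto
qed

lemma apps_Cst_inject: "apps (Cst c) us = apps (Cst c) ts \<Longrightarrow> us = ts"
proof (induction us arbitrary: ts rule: rev_induct)
  case Nil
  then show ?case by (cases ts rule: rev_cases) auto
next
  case (snoc u us)
  then show ?case by (cases ts rule: rev_cases) auto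
qed

lemma Atom_inject: "Atom p ts = Atom q us \<Longrightarrow> p = q \<and> ts = us"
  using head_apps[of "Cst (K p)" ts] head_apps[of "Cst (K q)" us] apps_Cst_inject[of "K p" ts us] by auto

locale stratified_LG = LG ktype ntype nominal clause
  for ktype :: "'k \<Rightarrow> 'b ty" and ntype :: "'n \<Rightarrow> 'b ty" and nominal :: "'b ty set"
    and clause :: "'k \<Rightarrow> ('b var list \<times> ('b, 'k, 'n) tm) option" +
  fixes lvl :: "'k \<Rightarrow> nat" and lvl_nat :: nat
  assumes nominal_ok: nominal_types_ok and strat: "stratified lvl lvl_nat"
begin

abbreviation lev :: "('b, 'k, 'n) tm \<Rightarrow> nat" where
  "lev \<equiv> level lvl lvl_nat"

text \<open>The values at variables may contain nominal constants here, as needed for valuations of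
  sequents; \<open>khom\<close> below is the restriction for morphisms. In both, nominal constants
  are only renamed.\<close>

definition ghom :: "'b var set \<Rightarrow> 'b var set \<Rightarrow> ('b, 'k, 'n) subst \<Rightarrow> bool" where
  "ghom \<Sigma> \<Sigma>' s \<longleftrightarrow> (\<forall>i. s (Bound i) = Bound i) \<and>
     (\<forall>x\<in>\<Sigma>. tyd (s (Var x)) (snd x) \<and> fv (s (Var x)) \<subseteq> \<Sigma>') \<and>
     (\<exists>\<pi>. is_perm \<pi> \<and> (\<forall>a. s (Nom a) = Nom (\<pi> a)))"

definition khom :: "'b var set \<Rightarrow> 'b var set \<Rightarrow> ('b, 'k, 'n) subst \<Rightarrow> bool" where
  "khom \<Sigma> \<Sigma>' s \<longleftrightarrow> ghom \<Sigma> \<Sigma>' s \<and> (\<forall>x\<in>\<Sigma>. supp (s (Var x)) = {})"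

lemma khom_ghom: "khom \<Sigma> \<Sigma>' s \<Longrightarrow> ghom \<Sigma> \<Sigma>' s"
  by (simp add: khom_def)

lemma ghom_tsub: "ghom \<Sigma> \<Sigma>' s \<Longrightarrow> tsub \<Sigma> s"
  unfolding ghom_def tsub_def by (metis LG.has_type.intros(3) is_perm_def)

lemma ghom_fv:
  assumes "ghom \<Sigma> \<Sigma>' s" "fv t \<subseteq> \<Sigma>"
  shows "fv (psubst s t) \<subseteq> \<Sigma>'"
proof -
  obtain \<pi> where "\<And>a. s (Nom a) = Nom (\<pi> a)" "\<And>i. s (Bound i) = Bound i"
    using assms(1) by (auto simp: ghom_def)
  then have "fv (psubst s t) \<subseteq> (\<Union>x\<in>fv t. fv (s (Var x)))" using fv_psubst[of s t] by simp
  also have "\<dots> \<subseteq> \<Sigma>'" using assms unfolding ghom_def by blast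
  finally show ?thesis .
qed

lemma ghom_supp:
  assumes "ghom \<Sigma> \<Sigma>' s" "\<forall>a. s (Nom a) = Nom (\<pi> a)"
  shows "supp (psubst s t) \<subseteq> (\<Union>x\<in>fv t. supp (s (Var x))) \<union> \<pi> ` supp t"
proof -
  have "\<And>i. s (Bound i) = Bound i" using assms(1) by (auto simp: ghom_def)
  then show ?thesis using supp_psubst[of s t] assms(2) by auto
qed

lemma act_supp:
  assumes "ghom \<Sigma> \<Sigma>' s" "\<forall>a. s (Nom a) = Nom (\<pi> a)" "is_term \<Sigma> t \<tau>"
  shows "supp (act s t) \<subseteq> (\<Union>x\<in>fv t. supp (s (Var x))) \<union> \<pi> ` supp t"
proof -
  have "tyd (psubst s t) \<tau>"
    by (rule tyd_psubst[OF _ _ ghom_tsub[OF assms(1)]]) (use assms(3) in \<open>auto simp: is_term_def\<close>)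
  then have "supp (act s t) \<subseteq> supp (psubst s t)" unfolding act_def by (rule reds_supp[OF reds_nf])
  also note ghom_supp[OF assms(1,2)]
  finally show ?thesis .
qed

lemma is_term_act:
  assumes "ghom \<Sigma> \<Sigma>' s" "is_term \<Sigma> t \<tau>"
  shows "is_term \<Sigma>' (act s t) \<tau>"
proof -
  have t: "tyd t \<tau>" "fv t \<subseteq> \<Sigma>" using assms(2) by (auto simp: is_term_def)
  have "fv (act s t) \<subseteq> \<Sigma>'"
    using reds_fv[OF reds_nf[OF tyd_psubst[OF t ghom_tsub[OF assms(1)]]]] ghom_fv[OF assms(1) t(2)]
    by (auto simp: act_def)
  then show ?thesis
    using tyd_act[OF t ghom_tsub[OF assms(1)]] normal_act[OF t ghom_tsub[OF assms(1)]]
    by (simp add: is_term_def)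
qed

lemma ghom_cmp:
  assumes "ghom \<Sigma> \<Sigma>' s" "ghom \<Sigma>' \<Sigma>'' r"
  shows "ghom \<Sigma> \<Sigma>'' (cmp r s)"
proof -
  obtain \<pi> \<pi>' where \<pi>: "is_perm \<pi>" "\<forall>a. s (Nom a) = Nom (\<pi> a)" "is_perm \<pi>'" "\<forall>a. r (Nom a) = Nom (\<pi>' a)"
    using assms by (auto simp: ghom_def)
  have "is_perm (\<pi>' \<circ> \<pi>)" using \<pi> by (simp add: is_perm_comp)
  moreover have "\<forall>a. cmp r s (Nom a) = Nom ((\<pi>' \<circ> \<pi>) a)" using \<pi> by (simp add: cmp_def)
  moreover have "tyd (cmp r s (Var x)) (snd x)" "fv (cmp r s (Var x)) \<subseteq> \<Sigma>''" if "x \<in> \<Sigma>" for x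
    using that assms(1) tyd_psubst[OF _ _ ghom_tsub[OF assms(2)]] ghom_fv[OF assms(2)]
    unfolding cmp_def ghom_def by blast+
  ultimately show ?thesis
    using assms by (auto simp: ghom_def cmp_def simp del: comp_apply)
qed

lemma khom_cmp:
  assumes "khom \<Sigma> \<Sigma>' s" "khom \<Sigma>' \<Sigma>'' r"
  shows "khom \<Sigma> \<Sigma>'' (cmp r s)"
  unfolding khom_def
proof (intro conjI ballI)
  show "ghom \<Sigma> \<Sigma>'' (cmp r s)" using assms ghom_cmp khom_ghom by blast
  fix x assume x: "x \<in> \<Sigma>"
  obtain \<pi> where "\<forall>a. r (Nom a) = Nom (\<pi> a)" using assms(2) by (auto simp: ghom_def khom_def)
  from ghom_supp[OF khom_ghom[OF assms(2)] this, of "s (Var x)"]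
  have "supp (psubst r (s (Var x))) \<subseteq> (\<Union>y\<in>fv (s (Var x)). supp (r (Var y))) \<union> \<pi> ` supp (s (Var x))" .
  also have "\<dots> = {}" using assms x by (fastforce simp: khom_def ghom_def)
  finally show "supp (cmp r s (Var x)) = {}" by (simp add: cmp_def)
qed

lemma act_cmp:
  assumes "ghom \<Sigma> \<Sigma>' s" "ghom \<Sigma>' \<Sigma>'' r" "is_term \<Sigma> t \<tau>"
  shows "act (cmp r s) t = act r (act s t)"
  unfolding cmp_def
  by (rule act_act[OF _ _ ghom_tsub[OF assms(1)] ghom_fv[OF assms(1)] ghom_tsub[OF assms(2)], symmetric])
    (use assms(3) in \<open>auto simp: is_term_def\<close>)

lemma khom_id: "\<Sigma> \<subseteq> \<Sigma>' \<Longrightarrow> khom \<Sigma> \<Sigma>' id"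
  by (auto simp: khom_def ghom_def intro: has_type.intros exI[of _ id])

lemma act_id [simp]: "is_term \<Sigma> t \<tau> \<Longrightarrow> act id t = t"
  by (simp add: act_def psubst_id is_term_def nf_normal)

lemma khom_perm: "is_perm \<pi> \<Longrightarrow> khom \<Sigma> \<Sigma> (perm \<pi>)"
  by (auto simp: khom_def ghom_def intro: has_type.intros)

lemma act_perm: "is_perm \<pi> \<Longrightarrow> is_term \<Sigma> t \<tau> \<Longrightarrow> act (perm \<pi>) t = perm \<pi> t"
  by (simp add: act_def is_term_def nf_normal normal_perm bij_is_inj is_perm_def flip: perm_eq_psubst)

lemma is_term_perm: "is_perm \<pi> \<Longrightarrow> is_term \<Sigma> t \<tau> \<Longrightarrow> is_term \<Sigma> (perm \<pi> t) \<tau>"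
  using is_term_act[OF khom_ghom[OF khom_perm]] by (simp add: act_perm)

lemma act_form:
  assumes "ghom \<Sigma> \<Sigma>' s"
  shows "act s Bot = Bot" "act s Top = Top" "act s Zero = Zero"
    "is_term \<Sigma> (Conj B C) Prop \<Longrightarrow> act s (Conj B C) = Conj (act s B) (act s C)"
    "is_term \<Sigma> (Disj B C) Prop \<Longrightarrow> act s (Disj B C) = Disj (act s B) (act s C)"
    "is_term \<Sigma> (Imp B C) Prop \<Longrightarrow> act s (Imp B C) = Imp (act s B) (act s C)"
    "is_term \<Sigma> (Eq \<tau> t u) Prop \<Longrightarrow> act s (Eq \<tau> t u) = Eq \<tau> (act s t) (act s u)"
    "is_term \<Sigma> (Forall \<tau> F) Prop \<Longrightarrow> act s (Forall \<tau> F) = Forall \<tau> (act s F)"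
    "is_term \<Sigma> (Exists \<tau> F) Prop \<Longrightarrow> act s (Exists \<tau> F) = Exists \<tau> (act s F)"
    "is_term \<Sigma> (Nabla \<tau> F) Prop \<Longrightarrow> act s (Nabla \<tau> F) = Nabla \<tau> (act s F)"
    "is_term \<Sigma> (NatP I) Prop \<Longrightarrow> act s (NatP I) = NatP (act s I)"
    "is_term \<Sigma> (Succ I) Nt \<Longrightarrow> act s (Succ I) = Succ (act s I)"
    "is_term \<Sigma> (Atom p ts) Prop \<Longrightarrow> act s (Atom p ts) = Atom p (map (act s) ts)"
proof -
  have A: "is_term \<Sigma> (apps (Cst c) ts) \<tau> \<Longrightarrow> act s (apps (Cst c) ts) = apps (Cst c) (map (act s) ts)"
    for c ts \<tau>
    using act_apps_Cst ghom_tsub[OF assms] unfolding is_term_def by blast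
  show "act s Bot = Bot" "act s Top = Top" "act s Zero = Zero"
    by (simp_all add: act_def nf_normal)
  have "is_term \<Sigma> (Cst c \<cdot> B \<cdot> C) Prop \<Longrightarrow> act s (Cst c \<cdot> B \<cdot> C) = Cst c \<cdot> act s B \<cdot> act s C" for c B C
    using A[of c "[B, C]"] by simp
  moreover have "is_term \<Sigma> (Cst c \<cdot> B) \<tau> \<Longrightarrow> act s (Cst c \<cdot> B) = Cst c \<cdot> act s B" for c B \<tau>
    using A[of c "[B]"] by simp
  ultimately show "is_term \<Sigma> (Conj B C) Prop \<Longrightarrow> act s (Conj B C) = Conj (act s B) (act s C)"
    "is_term \<Sigma> (Disj B C) Prop \<Longrightarrow> act s (Disj B C) = Disj (act s B) (act s C)"
    "is_term \<Sigma> (Imp B C) Prop \<Longrightarrow> act s (Imp B C) = Imp (act s B) (act s C)"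
    "is_term \<Sigma> (Eq \<tau> t u) Prop \<Longrightarrow> act s (Eq \<tau> t u) = Eq \<tau> (act s t) (act s u)"
    "is_term \<Sigma> (Forall \<tau> F) Prop \<Longrightarrow> act s (Forall \<tau> F) = Forall \<tau> (act s F)"
    "is_term \<Sigma> (Exists \<tau> F) Prop \<Longrightarrow> act s (Exists \<tau> F) = Exists \<tau> (act s F)"
    "is_term \<Sigma> (Nabla \<tau> F) Prop \<Longrightarrow> act s (Nabla \<tau> F) = Nabla \<tau> (act s F)"
    "is_term \<Sigma> (NatP I) Prop \<Longrightarrow> act s (NatP I) = NatP (act s I)"
    "is_term \<Sigma> (Succ I) Nt \<Longrightarrow> act s (Succ I) = Succ (act s I)"
    by blast+
  show "is_term \<Sigma> (Atom p ts) Prop \<Longrightarrow> act s (Atom p ts) = Atom p (map (act s) ts)"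
    by (rule A)
qed

lemma act_instance:
  assumes "ghom \<Sigma> \<Sigma>' s" "is_term \<Sigma> F (\<sigma> \<rightarrow> \<tau>)" "is_term \<Sigma> t \<sigma>"
  shows "act s (nf (F \<cdot> t)) = nf (act s F \<cdot> act s t)"
proof (rule act_App)
  show "tyd (F \<cdot> t) \<tau>" using assms by (auto simp: is_term_def intro: has_type.intros(5))
  show "fv (F \<cdot> t) \<subseteq> \<Sigma>" using assms by (auto simp: is_term_def)
qed (rule ghom_tsub[OF assms(1)])

lemma perm_instance:
  assumes "is_perm \<pi>" "is_term \<Sigma> F (\<sigma> \<rightarrow> \<tau>)" "is_term \<Sigma> t \<sigma>"
  shows "perm \<pi> (nf (F \<cdot> t)) = nf (perm \<pi> F \<cdot> perm \<pi> t)"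
  using act_instance[OF khom_ghom[OF khom_perm[OF assms(1)]] assms(2,3)]
  by (simp add: act_perm[OF assms(1)] assms(2,3) act_perm[OF assms(1) is_term_nf_App[OF assms(2,3)]]
      act_perm[OF assms(1,2)] act_perm[OF assms(1,3)])

lemma head_act:
  assumes "ghom \<Sigma> \<Sigma>' s" "is_term \<Sigma> t \<tau>" "head t = Cst c"
  shows "head (act s t) = Cst c"
proof -
  have "red\<^sup>*\<^sup>* (psubst s t) (act s t)"
    using assms tyd_psubst ghom_tsub unfolding act_def is_term_def by (blast intro: reds_nf)
  then show ?thesis
    by (induction rule: rtranclp_induct) (auto intro: head_psubst head_red assms(3))
qed

subsection \<open>Skeletons of well-formed formulas\<close>

lemma is_sig_o_free: "is_sig \<Sigma> \<Longrightarrow> is_term \<Sigma> B \<tau> \<Longrightarrow> \<forall>x\<in>fv B. o_free (snd x)"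
  by (auto simp: is_sig_def is_term_def)

lemma formula_skel:
  assumes "is_sig \<Sigma>" "is_term \<Sigma> B Prop"
  obtains n where "skel lvl lvl_nat B n (lev B)"
proof -
  obtain n m where "skel lvl lvl_nat B n m"
    using skel_exists[of "[]" B lvl lvl_nat] assms is_sig_o_free[OF assms] nominal_ok
    by (auto simp: is_term_def)
  then show ?thesis using that skel_level by metis
qed

lemma skel_act:
  assumes "ghom \<Sigma> \<Sigma>' s" "is_term \<Sigma> B \<tau>" "skel l ln B n m"
  shows "skel l ln (act s B) n m"
  unfolding act_def
  by (rule skel_nf[OF tyd_psubst[of _ \<tau> \<Sigma>] skel_psubst]) (use assms ghom_tsub in \<open>auto simp: is_term_def\<close>)

lemma lev_act:
  assumes "ghom \<Sigma> \<Sigma>' s" "is_sig \<Sigma>" "is_term \<Sigma> B Prop"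
  shows "lev (act s B) = lev B"
  using formula_skel[OF assms(2,3)] skel_act[OF assms(1,3)] skel_level by metis

lemma quant_skel:
  assumes "is_sig \<Sigma>" "is_term \<Sigma> (Cst q \<cdot> F) Prop" "quant_cst q" "is_term \<Sigma> F (\<tau> \<rightarrow> Prop)" "is_term \<Sigma>' t \<tau>"
    "skel l ln (Cst q \<cdot> F) n m"
  obtains n' where "n' < n" "skel l ln (nf (F \<cdot> t)) n' m"
proof -
  have "tyd (F \<cdot> t) Prop" using assms(4,5) by (auto simp: is_term_def intro: has_type.intros(5))
  then show ?thesis using skel_instance[OF assms(6,3)] that by blast
qed

lemma lev_instance:
  assumes "is_sig \<Sigma>" "is_term \<Sigma> (Cst q \<cdot> F) Prop" "quant_cst q" "is_term \<Sigma> F (\<tau> \<rightarrow> Prop)" "is_term \<Sigma>' t \<tau>"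
  shows "lev (nf (F \<cdot> t)) = lev (Cst q \<cdot> F)"
  using formula_skel[OF assms(1,2)] quant_skel[OF assms] skel_level by metis

subsection \<open>Unfolding a definition\<close>

lemma Atom_args:
  assumes "clause p = Some (xs, B)" "is_term \<Sigma> (Atom p ts) Prop"
  shows "list_all2 (\<lambda>x t. is_term \<Sigma> t (snd x)) xs ts"
proof -
  have k: "ktype p = foldr (\<rightarrow>) (map snd xs) Prop"
    using strat assms(1) by (simp add: stratified_def foldr_map o_def)
  obtain us \<tau>s where "Atom p ts = apps (Cst (K p)) us" "ktype p = foldr (\<rightarrow>) \<tau>s Prop" "list_all2 tyd us \<tau>s"
    using apps_Cst_typing[of "[]" "Atom p ts" Prop "K p"] assms(2) by (auto simp: is_term_def)
  then have "list_all2 tyd ts (map snd xs)" using k apps_Cst_inject by (metis foldr_Arr_inject)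
  moreover have "\<forall>t\<in>set ts. normal t \<and> fv t \<subseteq> \<Sigma>"
    using assms(2) normal_apps[of "Cst (K p)" ts] by (auto simp: is_term_def)
  ultimately show ?thesis
    by (auto simp: list_all2_conv_all_nth is_term_def)
qed

definition inst_fun :: "'b var list \<Rightarrow> ('b, 'k, 'n) tm list \<Rightarrow> 'b var \<Rightarrow> ('b, 'k, 'n) tm" where
  "inst_fun xs ts x = (case map_of (zip xs ts) x of Some t \<Rightarrow> t | None \<Rightarrow> Var x)"

lemma inst_fun_nth: "distinct xs \<Longrightarrow> length ts = length xs \<Longrightarrow> i < length xs \<Longrightarrow> inst_fun xs ts (xs ! i) = ts ! i"
  by (simp add: inst_fun_def map_of_zip_nth)

lemma inst_fun_other: "length ts = length xs \<Longrightarrow> x \<notin> set xs \<Longrightarrow> inst_fun xs ts x = Var x"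
  by (auto simp: inst_fun_def dest: map_of_SomeD set_zip_leftD split: option.splits)

text \<open>Stratification bounds the level of the clause body only. The bound passes to its
  instances because substitution and normalization keep the skeleton.\<close>

lemma inst_props:
  assumes "clause p = Some (xs, B)" "is_term \<Sigma> (Atom p ts) Prop"
  shows inst_act: "inst B xs ts = act (msubst (inst_fun xs ts)) B"
    and tsub_inst: "tsub (set xs) (msubst (inst_fun xs ts))"
    and inst_is_term: "is_term \<Sigma> (inst B xs ts) Prop"
    and inst_level: "lev (inst B xs ts) \<le> lvl p"
proof -
  have B: "distinct xs" "is_sig (set xs)" "is_term (set xs) B Prop" "supp B = {}" "lev B \<le> lvl p"
    using strat assms(1) by (auto simp: stratified_def)
  have ts: "list_all2 (\<lambda>x t. is_term \<Sigma> t (snd x)) xs ts" by (rule Atom_args[OF assms])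
  then have len: "length ts = length xs" by (simp add: list_all2_lengthD)
  have \<theta>: "is_term \<Sigma> (inst_fun xs ts x) (snd x)" if "x \<in> set xs" for x
    using that ts len inst_fun_nth[OF B(1) len] by (auto simp: in_set_conv_nth list_all2_conv_all_nth)
  have fvB: "fv B \<subseteq> set xs" and tB: "tyd B Prop" using B by (auto simp: is_term_def)
  show 1: "inst B xs ts = act (msubst (inst_fun xs ts)) B"
  proof -
    have "msubst (inst_fun xs ts) B = psubst (msubst (inst_fun xs ts)) B"
      by (rule msubst_eq_psubst) (use \<theta> fvB in \<open>auto simp: is_term_def\<close>)
    then show ?thesis by (simp add: inst_def act_def inst_fun_def[abs_def])
  qed
  show 2: "tsub (set xs) (msubst (inst_fun xs ts))"
    using \<theta> by (auto simp: tsub_def is_term_def intro: has_type.intros)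
  have "fv (psubst (msubst (inst_fun xs ts)) B) \<subseteq> \<Sigma>"
    using fv_psubst[of "msubst (inst_fun xs ts)" B] \<theta> fvB B(4) by (force simp: is_term_def)
  then have "fv (inst B xs ts) \<subseteq> \<Sigma>"
    using reds_fv[OF reds_nf[OF tyd_psubst[OF tB fvB 2]]] by (auto simp: 1 act_def)
  then show "is_term \<Sigma> (inst B xs ts) Prop"
    using tyd_act[OF tB fvB 2] normal_act[OF tB fvB 2] by (simp add: is_term_def 1)
  obtain n where "skel lvl lvl_nat B n (lev B)" using formula_skel[OF B(2,3)] .
  then have "skel lvl lvl_nat (inst B xs ts) n (lev B)"
    unfolding 1 act_def by (intro skel_nf[OF tyd_psubst[OF tB fvB 2]] skel_psubst)
  then show "lev (inst B xs ts) \<le> lvl p" using skel_level B(5) by metis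
qed

lemma act_inst:
  assumes "ghom \<Sigma> \<Sigma>' s" "clause p = Some (xs, B)" "is_term \<Sigma> (Atom p ts) Prop"
  shows "act s (inst B xs ts) = inst B xs (map (act s) ts)"
proof -
  \<comment> \<open>The two sides differ in whether the arguments are normalized before they are
    substituted. \<open>?f\<close> is the unnormalized version, set to the identity outside
    \<open>xs\<close>, so that it reduces pointwise to the normalized one.\<close>
  let ?f = "\<lambda>a. case a of Var x \<Rightarrow> if x \<in> set xs then psubst s (inst_fun xs ts x) else Var x | _ \<Rightarrow> a"
  have B: "distinct xs" "is_term (set xs) B Prop" "supp B = {}"
    using strat assms(2) by (auto simp: stratified_def)
  have fvB: "fv B \<subseteq> set xs" and tB: "tyd B Prop" using B by (auto simp: is_term_def)
  have ts: "list_all2 (\<lambda>x t. is_term \<Sigma> t (snd x)) xs ts" by (rule Atom_args[OF assms(2,3)])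
  then have len: "length ts = length xs" by (simp add: list_all2_lengthD)
  have ts': "is_term \<Sigma> (ts ! i) (snd (xs ! i))" if "i < length xs" for i
    using that ts by (simp add: list_all2_conv_all_nth)
  have at: "is_term \<Sigma>' (Atom p (map (act s) ts)) Prop"
    using is_term_act[OF assms(1,3)] by (simp add: act_form(13)[OF assms(1,3)])
  have ts0: "tsub (set xs) (msubst (inst_fun xs ts))" by (rule tsub_inst[OF assms(2,3)])
  have "fv (psubst (msubst (inst_fun xs ts)) B) \<subseteq> \<Sigma>"
  proof -
    have "fv (inst_fun xs ts x) \<subseteq> \<Sigma>" if "x \<in> set xs" for x
      using that ts' inst_fun_nth[OF B(1) len] unfolding in_set_conv_nth is_term_def by force
    then show ?thesis using fv_psubst[of "msubst (inst_fun xs ts)" B] fvB B(3) by force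
  qed
  then have 1: "act s (inst B xs ts) = act (\<lambda>a. psubst s (msubst (inst_fun xs ts) a)) B"
    unfolding inst_act[OF assms(2,3)]
    by (intro act_act[OF tB fvB ts0 _ ghom_tsub[OF assms(1)]])
  have "psubst (\<lambda>a. psubst s (msubst (inst_fun xs ts) a)) B = psubst ?f B"
    by (rule psubst_cong) (use assms(1) fvB B(3) in \<open>auto simp: ghom_def\<close>)
  moreover have "red\<^sup>*\<^sup>* (psubst ?f B) (psubst (msubst (inst_fun xs (map (act s) ts))) B)"
  proof (rule reds_psubst_pointwise)
    fix x
    show "red\<^sup>*\<^sup>* (?f (Var x)) (msubst (inst_fun xs (map (act s) ts)) (Var x))"
    proof (cases "x \<in> set xs")
      case True
      then obtain i where i: "i < length xs" "x = xs ! i" by (auto simp: in_set_conv_nth)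
      have "red\<^sup>*\<^sup>* (psubst s (ts ! i)) (act s (ts ! i))"
        unfolding act_def
        by (rule reds_nf[OF tyd_psubst[OF _ _ ghom_tsub[OF assms(1)]]]) (use ts'[OF i(1)] in \<open>auto simp: is_term_def\<close>)
      then show ?thesis
        using i len inst_fun_nth[OF B(1) len i(1)] inst_fun_nth[OF B(1), of "map (act s) ts" i] by simp
    qed (simp add: inst_fun_other len)
  qed auto
  moreover have "tyd (psubst (\<lambda>a. psubst s (msubst (inst_fun xs ts) a)) B) Prop"
  proof -
    have "tyd (psubst s (psubst (msubst (inst_fun xs ts)) B)) Prop"
      by (rule tyd_psubst[OF tyd_psubst[OF tB fvB ts0] _ ghom_tsub[OF assms(1)]]) fact
    then show ?thesis by (simp add: psubst_psubst)
  qed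
  ultimately have "act (\<lambda>a. psubst s (msubst (inst_fun xs ts) a)) B = act (msubst (inst_fun xs (map (act s) ts))) B"
    unfolding act_def by (intro nf_reds[of "[]" _ Prop]) simp_all
  then show ?thesis by (simp only: 1 inst_act[OF assms(2) at])
qed

section \<open>Morphisms of worlds and renaming of single formulas\<close>

definition wf_world :: "('b, 'k, 'n) world \<Rightarrow> bool" where
  "wf_world w \<longleftrightarrow> is_sig (fst w) \<and> (\<forall>B\<in>#snd w. is_term (fst w) B Prop)"

definition eqv :: "('b, 'k, 'n) tm \<Rightarrow> ('b, 'k, 'n) tm \<Rightarrow> bool" where
  "eqv B B' \<longleftrightarrow> (\<exists>\<pi>. is_perm \<pi> \<and> perm \<pi> B = B')"

text \<open>
  A morphism of worlds instantiates the variables by terms without nominal constants.  As the rule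
  \<open>id_perm\<close> identifies formulas up to renaming of nominal constants, each assumption may be renamed
  on its own.
\<close>

definition mor :: "('b, 'k, 'n) subst \<Rightarrow> ('b, 'k, 'n) world \<Rightarrow> ('b, 'k, 'n) world \<Rightarrow> bool" where
  "mor s w w' \<longleftrightarrow> wf_world w' \<and> khom (fst w) (fst w') s \<and>
     (\<forall>B\<in>#snd w. \<exists>B'\<in>#snd w'. eqv (act s B) B')"

definition der :: "('b, 'k, 'n) world \<Rightarrow> ('b, 'k, 'n) tm \<Rightarrow> bool" where
  "der w C \<longleftrightarrow> derivable_mc_free (fst w;; snd w \<turnstile> C)"

lemma eqv_refl [simp]: "eqv B B"
  unfolding eqv_def by (rule exI[of _ id]) (simp add: tm.map_id)

lemma eqv_trans: "eqv A B \<Longrightarrow> eqv B C \<Longrightarrow> eqv A C"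
  unfolding eqv_def using is_perm_comp perm_perm by metis

lemma eqv_perm: "is_perm \<pi> \<Longrightarrow> eqv B (perm \<pi> B)"
  by (auto simp: eqv_def)

lemma eqv_sym: "eqv A B \<Longrightarrow> eqv B A"
  unfolding eqv_def using is_perm_inv perm_inv by metis

text \<open>The morphism \<open>s\<close> itself renames by \<rho>, so a renaming done before
  \<open>s\<close> reappears after it conjugated by \<rho>. The values of \<open>s\<close> at
  variables are unaffected because they have no nominal constants; with a mere \<open>ghom\<close>
  this would fail.\<close>

lemma act_perm_conj:
  assumes "khom \<Sigma> \<Sigma>' s" "is_perm \<rho>" "\<forall>a. s (Nom a) = Nom (\<rho> a)" "is_perm \<pi>" "is_term \<Sigma> B \<tau>"
  shows "act s (perm \<pi> B) = perm (\<rho> \<circ> \<pi> \<circ> inv \<rho>) (act s B)"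
proof -
  let ?\<pi> = "\<rho> \<circ> \<pi> \<circ> inv \<rho>"
  have \<pi>': "is_perm ?\<pi>" using assms(2,4) by (simp add: is_perm_comp is_perm_inv)
  have inv: "inv \<rho> (\<rho> a) = a" for a using assms(2) by (simp add: is_perm_def bij_is_inj)
  note g = khom_ghom[OF assms(1)]
  have "act s (perm \<pi> B) = act (cmp s (perm \<pi>)) B"
    using act_cmp[OF khom_ghom[OF khom_perm[OF assms(4)]] g assms(5)] by (simp add: act_perm[OF assms(4,5)])
  also have "\<dots> = act (cmp (perm ?\<pi>) s) B"
    unfolding act_def
  proof (rule arg_cong[of _ _ nf], rule psubst_cong)
    show "cmp s (perm \<pi>) (Bound i) = cmp (perm ?\<pi>) s (Bound i)" for i
      using g by (simp add: cmp_def ghom_def)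
    show "cmp s (perm \<pi>) (Nom a) = cmp (perm ?\<pi>) s (Nom a)" for a
      using assms(3) inv by (simp add: cmp_def)
    show "cmp s (perm \<pi>) (Var x) = cmp (perm ?\<pi>) s (Var x)" if "x \<in> fv B" for x
    proof -
      have "supp (s (Var x)) = {}" using that assms(1,5) by (auto simp: khom_def is_term_def)
      then have "perm ?\<pi> (s (Var x)) = s (Var x)" by (intro perm_idle) auto
      then show ?thesis by (simp add: cmp_def flip: perm_eq_psubst)
    qed
  qed
  also have "\<dots> = perm ?\<pi> (act s B)"
    using act_cmp[OF g khom_ghom[OF khom_perm[OF \<pi>']] assms(5)]
    by (simp add: act_perm[OF \<pi>' is_term_act[OF g assms(5)]])
  finally show ?thesis .
qed

lemma eqv_act:
  assumes "khom \<Sigma> \<Sigma>' s" "eqv A B" "is_term \<Sigma> A \<tau>"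
  shows "eqv (act s A) (act s B)"
proof -
  obtain \<rho> where \<rho>: "is_perm \<rho>" "\<forall>a. s (Nom a) = Nom (\<rho> a)" using assms(1) by (auto simp: khom_def ghom_def)
  obtain \<pi> where \<pi>: "is_perm \<pi>" "perm \<pi> A = B" using assms(2) by (auto simp: eqv_def)
  show ?thesis
    unfolding \<pi>(2)[symmetric] act_perm_conj[OF assms(1) \<rho> \<pi>(1) assms(3)]
    by (intro eqv_perm is_perm_comp is_perm_inv \<rho> \<pi>)
qed

lemma mor_khom: "mor s w w' \<Longrightarrow> khom (fst w) (fst w') s"
  and mor_ghom: "mor s w w' \<Longrightarrow> ghom (fst w) (fst w') s"
  and mor_wf: "mor s w w' \<Longrightarrow> wf_world w'"
  by (simp_all add: mor_def khom_def)

lemma mor_cmp: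
  assumes "mor s w w'" "mor r w' w''" "wf_world w"
  shows "mor (cmp r s) w w''"
  unfolding mor_def
proof (intro conjI ballI)
  show "khom (fst w) (fst w'') (cmp r s)" using khom_cmp mor_khom assms by blast
  fix B assume B: "B \<in># snd w"
  then have tB: "is_term (fst w) B Prop" using assms(3) by (simp add: wf_world_def)
  obtain B' where B': "B' \<in># snd w'" "eqv (act s B) B'" using B assms(1) by (auto simp: mor_def)
  obtain B'' where B'': "B'' \<in># snd w''" "eqv (act r B') B''" using B' assms(2) by (auto simp: mor_def)
  have "eqv (act r (act s B)) (act r B')"
    using eqv_act[OF mor_khom[OF assms(2)] B'(2)] is_term_act[OF mor_ghom[OF assms(1)] tB] by blast
  then have "eqv (act (cmp r s) B) B''"
    using act_cmp[OF mor_ghom[OF assms(1)] mor_ghom[OF assms(2)] tB] B''(2) eqv_trans by metis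
  then show "\<exists>B''\<in>#snd w''. eqv (act (cmp r s) B) B''" using B'' by blast
qed (rule mor_wf[OF assms(2)])

lemma mor_weaken:
  assumes "wf_world w" "wf_world w'" "fst w \<subseteq> fst w'" "set_mset (snd w) \<subseteq> set_mset (snd w')"
  shows "mor id w w'"
  unfolding mor_def
proof (intro conjI ballI)
  fix B assume "B \<in># snd w"
  then have "act id B = B" "B \<in># snd w'" using assms by (auto simp: wf_world_def)
  then show "\<exists>B'\<in>#snd w'. eqv (act id B) B'" using eqv_refl by metis
qed (use assms khom_id in auto)

lemma mor_id: "wf_world w \<Longrightarrow> mor id w w"
  by (rule mor_weaken) auto

text \<open>Assumptions are compared up to \<open>eqv\<close>, so every permutation is an
  endomorphism of every world. This is why forcing is invariant under renaming.\<close>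

lemma mor_perm:
  assumes "wf_world w" "is_perm \<pi>"
  shows "mor (perm \<pi>) w w"
  unfolding mor_def
proof (intro conjI ballI)
  fix B assume B: "B \<in># snd w"
  then have "act (perm \<pi>) B = perm \<pi> B" using assms act_perm by (auto simp: wf_world_def)
  then show "\<exists>B'\<in>#snd w. eqv (act (perm \<pi>) B) B'" using B assms(2) eqv_perm eqv_sym by metis
qed (use assms khom_perm in auto)

lemma act_cmp_mor:
  "mor s w w' \<Longrightarrow> mor r w' w'' \<Longrightarrow> is_term (fst w) B \<tau> \<Longrightarrow> act (cmp r s) B = act r (act s B)"
  by (rule act_cmp[OF mor_ghom mor_ghom])

lemma is_term_mor: "mor s w w' \<Longrightarrow> is_term (fst w) t \<tau> \<Longrightarrow> is_term (fst w') (act s t) \<tau>"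
  by (rule is_term_act[OF mor_ghom])

lemma act_cmp_id: "act (cmp s id) t = act s t"
  unfolding act_def cmp_def psubst_psubst[symmetric] by (simp add: psubst_id)

text \<open>Freshness survives because the values of a morphism bring in no nominal constants and
  its renaming is injective.\<close>

lemma act_fresh:
  assumes "mor s w w'" "is_term (fst w) F \<tau>" "a \<notin> supp F"
  obtains b where "s (Nom a) = Nom b" "ntype b = ntype a" "b \<notin> supp (act s F)"
proof -
  obtain \<pi> where \<pi>: "is_perm \<pi>" "\<forall>a. s (Nom a) = Nom (\<pi> a)" using mor_ghom[OF assms(1)] by (auto simp: ghom_def)
  have "supp (act s F) \<subseteq> (\<Union>x\<in>fv F. supp (s (Var x))) \<union> \<pi> ` supp F"
    by (rule act_supp[OF mor_ghom[OF assms(1)] \<pi>(2) assms(2)])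
  also have "\<dots> = \<pi> ` supp F" using assms(2) mor_khom[OF assms(1)] by (auto simp: khom_def is_term_def)
  finally have "\<pi> a \<notin> supp (act s F)"
    using assms(3) \<pi>(1) by (auto simp: is_perm_def bij_def dest: injD)
  then show ?thesis using that \<pi> by (simp add: is_perm_def)
qed

section \<open>Forcing\<close>

text \<open>
  \<open>cps w P\<close> is the modality of the forcing interpretation: \<open>P\<close> need not hold at \<open>w\<close>, but every
  sequent that is cut-free derivable wherever \<open>P\<close> holds is cut-free derivable at \<open>w\<close>.
\<close>

definition cps :: "('b, 'k, 'n) world \<Rightarrow> (('b, 'k, 'n) world \<Rightarrow> ('b, 'k, 'n) subst \<Rightarrow> bool) \<Rightarrow> bool" where
  "cps w P \<longleftrightarrow> (\<forall>w' s E. mor s w w' \<longrightarrow> is_term (fst w') E Prop \<longrightarrow>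
     (\<forall>w'' r. mor r w' w'' \<longrightarrow> P w'' (cmp r s) \<longrightarrow> der w'' (act r E)) \<longrightarrow> der w' E)"

text \<open>Declared \<open>mono\<close> so that the inductive definition of \<open>frc\<close> may
  recurse through \<open>cps\<close>.\<close>

lemma cps_mono [mono]: "(\<And>w s. P w s \<longrightarrow> Q w s) \<Longrightarrow> cps w P \<longrightarrow> cps w Q"
  unfolding cps_def by metis

lemma cps_mp:
  assumes "cps w P" "wf_world w" "\<And>w' s. mor s w w' \<Longrightarrow> P w' s \<Longrightarrow> Q w' s"
  shows "cps w Q"
  unfolding cps_def
proof (intro allI impI)
  fix w' s E
  assume s: "mor s w w'" and E: "is_term (fst w') E Prop"
    and k: "\<forall>w'' r. mor r w' w'' \<longrightarrow> Q w'' (cmp r s) \<longrightarrow> der w'' (act r E)"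
  have "der w'' (act r E)" if "mor r w' w''" "P w'' (cmp r s)" for w'' r
    using k that assms(3)[OF mor_cmp[OF s that(1) assms(2)]] by blast
  then show "der w' E" using assms(1) s E unfolding cps_def by blast
qed

lemma cps_mor:
  assumes "cps w P" "wf_world w" "mor s w w'"
  shows "cps w' (\<lambda>w'' r. P w'' (cmp r s))"
  unfolding cps_def
proof (intro allI impI)
  fix w'' r E
  assume r: "mor r w' w''" and E: "is_term (fst w'') E Prop"
    and k: "\<forall>w''' r'. mor r' w'' w''' \<longrightarrow> P w''' (cmp (cmp r' r) s) \<longrightarrow> der w''' (act r' E)"
  have "mor (cmp r s) w w''" by (rule mor_cmp[OF assms(3) r assms(2)])
  then show "der w'' E" using assms(1) E k unfolding cps_def cmp_assoc by blast
qed

text \<open>The unit of the modality; \<open>cps_bind\<close> is its bind, with the morphisms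
  composed.\<close>

lemma cps_return:
  assumes "\<And>w' s. mor s w w' \<Longrightarrow> P w' s"
  shows "cps w P"
  unfolding cps_def
proof (intro allI impI)
  fix w' s E
  assume s: "mor s w w'" and E: "is_term (fst w') E Prop"
    and k: "\<forall>w'' r. mor r w' w'' \<longrightarrow> P w'' (cmp r s) \<longrightarrow> der w'' (act r E)"
  have "der w' (act id E)" using k mor_id[OF mor_wf[OF s]] assms[OF s] by (metis cmp_id)
  then show "der w' E" using E by simp
qed

lemma cps_bind:
  assumes "cps w P" "wf_world w" "\<And>w' s. mor s w w' \<Longrightarrow> P w' s \<Longrightarrow> cps w' (\<lambda>w'' r. Q w'' (cmp r s))"
  shows "cps w Q"
  unfolding cps_def
proof (intro allI impI)
  fix w' s E
  assume s: "mor s w w'" and E: "is_term (fst w') E Prop"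
    and k: "\<forall>w'' r. mor r w' w'' \<longrightarrow> Q w'' (cmp r s) \<longrightarrow> der w'' (act r E)"
  have "der w'' (act r E)" if r: "mor r w' w''" "P w'' (cmp r s)" for w'' r
  proof -
    have "cps w'' (\<lambda>w''' r'. Q w''' (cmp r' (cmp r s)))"
      using assms(3)[OF mor_cmp[OF s r(1) assms(2)] r(2)] .
    moreover have "der w''' (act r' (act r E))"
      if "mor r' w'' w'''" "Q w''' (cmp (cmp r' id) (cmp r s))" for w''' r'
    proof -
      have "cmp (cmp r' id) (cmp r s) = cmp (cmp r' r) s" by (simp add: cmp_assoc)
      then show ?thesis
        using k mor_cmp[OF r(1) that(1) mor_wf[OF s]] that(2) act_cmp_mor[OF r(1) that(1) E] by metis
    qed
    ultimately show "der w'' (act r E)"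
      using mor_id[OF mor_wf[OF r(1)]] is_term_mor[OF r(1) E] unfolding cps_def cmp_assoc by blast
  qed
  then show "der w' E" using assms(1) s E unfolding cps_def by blast
qed

text \<open>
  Forcing of formulas of a given level; \<open>R\<close> is forcing of formulas of lower levels, to which the
  left-hand sides of implications belong.
\<close>

inductive frc :: "(('b, 'k, 'n) world \<Rightarrow> ('b, 'k, 'n) tm \<Rightarrow> bool) \<Rightarrow>
    ('b, 'k, 'n) world \<Rightarrow> ('b, 'k, 'n) tm \<Rightarrow> bool" for R where
  frc_bot: "cps w (\<lambda>_ _. False) \<Longrightarrow> frc R w Bot"
| frc_top: "frc R w Top"
| frc_conj: "frc R w B \<Longrightarrow> frc R w C \<Longrightarrow> frc R w (Conj B C)"
| frc_disj: "cps w (\<lambda>w' s. frc R w' (act s B) \<or> frc R w' (act s C)) \<Longrightarrow> frc R w (Disj B C)"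
| frc_imp: "(\<And>w' s. mor s w w' \<Longrightarrow> R w' (act s B) \<Longrightarrow> frc R w' (act s C)) \<Longrightarrow> frc R w (Imp B C)"
| frc_all: "(\<And>w' s t. mor s w w' \<Longrightarrow> is_term (fst w') t \<tau> \<Longrightarrow> frc R w' (nf (act s F \<cdot> t))) \<Longrightarrow>
    frc R w (Forall \<tau> F)"
| frc_ex: "cps w (\<lambda>w' s. \<exists>t. is_term (fst w') t \<tau> \<and> frc R w' (nf (act s F \<cdot> t))) \<Longrightarrow> frc R w (Exists \<tau> F)"
| frc_nabla: "ntype a = \<tau> \<Longrightarrow> a \<notin> supp F \<Longrightarrow> frc R w (nf (F \<cdot> Nom a)) \<Longrightarrow> frc R w (Nabla \<tau> F)"
| frc_eq: "cps w (\<lambda>w' s. act s t = act s u) \<Longrightarrow> frc R w (Eq \<tau> t u)"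
| frc_atom: "head A = Cst (K p) \<Longrightarrow>
    cps w (\<lambda>w' s. (\<exists>X\<in>#snd w'. eqv (act s A) X) \<or>
      (\<exists>xs B ts. act s A = Atom p ts \<and> clause p = Some (xs, B) \<and> length ts = length xs \<and>
        frc R w' (inst B xs ts))) \<Longrightarrow>
    frc R w A"
| frc_nat: "cps w (\<lambda>w' s. (\<exists>X\<in>#snd w'. eqv (NatP (act s I)) X) \<or> act s I = Zero \<or>
      (\<exists>J. act s I = Succ J \<and> frc R w' (NatP J))) \<Longrightarrow>
    frc R w (NatP I)"

lemma frc_mor:
  assumes "frc R w B" "wf_world w" "is_term (fst w) B Prop" "mor s w w'"
  shows "frc R w' (act s B)"
  using assms
proof (induction arbitrary: s w' rule: frc.induct)
  case (frc_bot w)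
  then have "cps w' (\<lambda>_ _. False)" using cps_mor by blast
  then show ?case using frc.frc_bot act_form(1)[OF mor_ghom[OF frc_bot(4)]] by metis
next
  case (frc_top w)
  then show ?case using frc.frc_top act_form(2)[OF mor_ghom[OF frc_top(3)]] by metis
next
  case (frc_conj w B C)
  have t: "is_term (fst w) B Prop" "is_term (fst w) C Prop" using frc_conj.prems by (simp_all add: is_term_const_iff)
  show ?case
    unfolding act_form(4)[OF mor_ghom[OF frc_conj.prems(3)] frc_conj.prems(2)]
    using frc_conj t by (intro frc.frc_conj) blast+
next
  case (frc_disj w B C)
  have t: "is_term (fst w) B Prop" "is_term (fst w) C Prop" using frc_disj.prems by (simp_all add: is_term_const_iff)
  show ?case
    unfolding act_form(5)[OF mor_ghom[OF frc_disj.prems(3)] frc_disj.prems(2)]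
    by (rule frc.frc_disj, rule cps_mp[OF cps_mor[OF frc_disj.IH frc_disj.prems(1,3)] mor_wf[OF frc_disj.prems(3)]])
      (auto simp: act_cmp_mor[OF frc_disj.prems(3) _ t(1)] act_cmp_mor[OF frc_disj.prems(3) _ t(2)])
next
  case (frc_imp w B C)
  have t: "is_term (fst w) B Prop" "is_term (fst w) C Prop" using frc_imp.prems by (simp_all add: is_term_const_iff)
  show ?case
    unfolding act_form(6)[OF mor_ghom[OF frc_imp.prems(3)] frc_imp.prems(2)]
  proof (rule frc.frc_imp)
    fix w'' r assume r: "mor r w' w''" and R: "R w'' (act r (act s B))"
    show "frc R w'' (act r (act s C))"
      using frc_imp.hyps[OF mor_cmp[OF frc_imp.prems(3) r frc_imp.prems(1)]] R
      by (simp add: act_cmp_mor[OF frc_imp.prems(3) r t(1)] act_cmp_mor[OF frc_imp.prems(3) r t(2)])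
  qed
next
  case (frc_all w \<tau> F)
  have t: "is_term (fst w) F (\<tau> \<rightarrow> Prop)" using frc_all.prems by (simp_all add: is_term_const_iff)
  show ?case
    unfolding act_form(8)[OF mor_ghom[OF frc_all.prems(3)] frc_all.prems(2)]
  proof (rule frc.frc_all)
    fix w'' r u assume r: "mor r w' w''" and u: "is_term (fst w'') u \<tau>"
    show "frc R w'' (nf (act r (act s F) \<cdot> u))"
      using frc_all.hyps[OF mor_cmp[OF frc_all.prems(3) r frc_all.prems(1)] u]
      by (simp add: act_cmp_mor[OF frc_all.prems(3) r t])
  qed
next
  case (frc_ex w \<tau> F)
  have t: "is_term (fst w) F (\<tau> \<rightarrow> Prop)" using frc_ex.prems by (simp_all add: is_term_const_iff)
  show ?case
    unfolding act_form(9)[OF mor_ghom[OF frc_ex.prems(3)] frc_ex.prems(2)]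
    by (rule frc.frc_ex, rule cps_mp[OF cps_mor[OF frc_ex.IH frc_ex.prems(1,3)] mor_wf[OF frc_ex.prems(3)]])
      (auto simp: act_cmp_mor[OF frc_ex.prems(3) _ t])
next
  case (frc_nabla a \<tau> F w)
  have t: "is_term (fst w) F (\<tau> \<rightarrow> Prop)" "\<tau> \<in> nominal" using frc_nabla.prems by (simp_all add: is_term_const_iff)
  then have a: "is_term (fst w) (Nom a) \<tau>" using frc_nabla.hyps(1) by (auto simp: is_term_def intro: has_type.intros)
  note s = mor_ghom[OF frc_nabla.prems(3)]
  obtain b where b: "s (Nom a) = Nom b" "ntype b = ntype a" "b \<notin> supp (act s F)"
    using act_fresh[OF frc_nabla.prems(3) t(1) frc_nabla.hyps(2)] .
  have "frc R w' (nf (act s F \<cdot> Nom b))"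
    using frc_nabla.IH[OF frc_nabla.prems(1) is_term_nf_App[OF t(1) a] frc_nabla.prems(3)] act_instance[OF s t(1) a] b(1)
    by (simp add: act_def nf_normal)
  then show ?case
    unfolding act_form(10)[OF s frc_nabla.prems(2)] using b frc_nabla.hyps(1) by (intro frc.frc_nabla) auto
next
  case (frc_eq w t u \<tau>)
  have t: "is_term (fst w) t \<tau>" "is_term (fst w) u \<tau>" using frc_eq.prems by (simp_all add: is_term_const_iff)
  show ?case
    unfolding act_form(7)[OF mor_ghom[OF frc_eq.prems(3)] frc_eq.prems(2)]
    by (rule frc.frc_eq, rule cps_mp[OF cps_mor[OF frc_eq.hyps frc_eq.prems(1,3)] mor_wf[OF frc_eq.prems(3)]])
      (auto simp: act_cmp_mor[OF frc_eq.prems(3) _ t(1)] act_cmp_mor[OF frc_eq.prems(3) _ t(2)])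
next
  case (frc_atom A p w)
  show ?case
    by (rule frc.frc_atom[OF head_act[OF mor_ghom[OF frc_atom.prems(3)] frc_atom.prems(2) frc_atom.hyps(1)]],
        rule cps_mp[OF cps_mor[OF frc_atom.IH frc_atom.prems(1,3)] mor_wf[OF frc_atom.prems(3)]])
      (auto simp: act_cmp_mor[OF frc_atom.prems(3) _ frc_atom.prems(2)])
next
  case (frc_nat w I)
  have t: "is_term (fst w) I Nt" using frc_nat.prems by (simp add: is_term_const_iff)
  show ?case
    unfolding act_form(11)[OF mor_ghom[OF frc_nat.prems(3)] frc_nat.prems(2)]
    by (rule frc.frc_nat, rule cps_mp[OF cps_mor[OF frc_nat.IH frc_nat.prems(1,3)] mor_wf[OF frc_nat.prems(3)]])
      (auto simp: act_cmp_mor[OF frc_nat.prems(3) _ t])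
qed

text \<open>\<open>R\<close> is consulted only for antecedents of implications. So it occurs
  negatively, which reverses the inclusion between \<open>R\<close> and \<open>R'\<close>, and only
  at levels below \<open>n\<close>.\<close>

lemma frc_level:
  assumes "frc R w B" "wf_world w" "is_term (fst w) B Prop" "lev B \<le> n"
    and R: "\<And>w B. wf_world w \<Longrightarrow> is_term (fst w) B Prop \<Longrightarrow> lev B < n \<Longrightarrow> R' w B \<Longrightarrow> R w B"
  shows "frc R' w B"
  using assms(1-4)
proof (induction rule: frc.induct)
  case (frc_bot w)
  then show ?case by (intro frc.frc_bot)
next
  case (frc_top w)
  show ?case by (rule frc.frc_top)
next
  case (frc_conj w B C)
  then show ?case by (intro frc.frc_conj) (simp_all add: is_term_const_iff level_simps)
next
  case (frc_disj w B C)
  have t: "is_term (fst w) B Prop" "is_term (fst w) C Prop" "lev B \<le> n" "lev C \<le> n"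
    using frc_disj.prems by (simp_all add: is_term_const_iff level_simps)
  have "is_sig (fst w)" using frc_disj.prems(1) by (simp add: wf_world_def)
  note L = lev_act[OF mor_ghom this t(1)] lev_act[OF mor_ghom this t(2)]
  show ?case
    by (rule frc.frc_disj, rule cps_mp[OF frc_disj.IH frc_disj.prems(1)])
      (use t L is_term_mor mor_wf in auto)
next
  case (frc_imp w B C)
  have t: "is_term (fst w) B Prop" "is_term (fst w) C Prop" "lev B < n" "lev C \<le> n"
    using frc_imp.prems by (simp_all add: is_term_const_iff level_simps)
  have "is_sig (fst w)" using frc_imp.prems(1) by (simp add: wf_world_def)
  note L = lev_act[OF mor_ghom this t(1)] lev_act[OF mor_ghom this t(2)]
  show ?case
  proof (rule frc.frc_imp)
    fix w' s assume s: "mor s w w'" "R' w' (act s B)"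
    then have "R w' (act s B)" using R[OF mor_wf[OF s(1)] is_term_mor[OF s(1) t(1)]] L(1)[OF s(1)] t by simp
    then show "frc R' w' (act s C)"
      using frc_imp.IH[OF s(1) _ mor_wf[OF s(1)] is_term_mor[OF s(1) t(2)]] L(2)[OF s(1)] t by simp
  qed
next
  case (frc_all w \<tau> F)
  have t: "is_term (fst w) F (\<tau> \<rightarrow> Prop)" using frc_all.prems by (simp_all add: is_term_const_iff)
  show ?case
  proof (rule frc.frc_all)
    fix w' s u assume s: "mor s w w'" and u: "is_term (fst w') u \<tau>"
    have t': "is_term (fst w') (act s F) (\<tau> \<rightarrow> Prop)" "is_term (fst w') (Forall \<tau> (act s F)) Prop"
      using is_term_mor[OF s t] is_term_mor[OF s frc_all.prems(2)] act_form(8)[OF mor_ghom[OF s] frc_all.prems(2)] by auto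
    have "lev (nf (act s F \<cdot> u)) = lev (Forall \<tau> (act s F))"
      by (rule lev_instance[OF _ t'(2) _ t'(1) u]) (use mor_wf[OF s] in \<open>auto simp: wf_world_def\<close>)
    also have "\<dots> = lev (Forall \<tau> F)"
      using lev_act[OF mor_ghom[OF s] _ frc_all.prems(2)] act_form(8)[OF mor_ghom[OF s] frc_all.prems(2)] frc_all.prems(1)
      by (simp add: wf_world_def)
    finally show "frc R' w' (nf (act s F \<cdot> u))"
      using frc_all.IH[OF s u mor_wf[OF s] is_term_nf_App[OF t'(1) u]] frc_all.prems(3) by simp
  qed
next
  case (frc_ex w \<tau> F)
  have t: "is_term (fst w) F (\<tau> \<rightarrow> Prop)" using frc_ex.prems by (simp_all add: is_term_const_iff)
  show ?case
  proof (rule frc.frc_ex, rule cps_mp[OF frc_ex.IH frc_ex.prems(1)], elim exE conjE)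
    fix w' s u assume s: "mor s w w'" and u: "is_term (fst w') u \<tau>"
      and IH: "frc R w' (nf (act s F \<cdot> u))" "wf_world w' \<longrightarrow> is_term (fst w') (nf (act s F \<cdot> u)) Prop \<longrightarrow>
          lev (nf (act s F \<cdot> u)) \<le> n \<longrightarrow> frc R' w' (nf (act s F \<cdot> u))"
    have t': "is_term (fst w') (act s F) (\<tau> \<rightarrow> Prop)" "is_term (fst w') (Exists \<tau> (act s F)) Prop"
      using is_term_mor[OF s t] is_term_mor[OF s frc_ex.prems(2)] act_form(9)[OF mor_ghom[OF s] frc_ex.prems(2)] by auto
    have "lev (nf (act s F \<cdot> u)) = lev (Exists \<tau> (act s F))"
      by (rule lev_instance[OF _ t'(2) _ t'(1) u]) (use mor_wf[OF s] in \<open>auto simp: wf_world_def\<close>)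
    also have "\<dots> = lev (Exists \<tau> F)"
      using lev_act[OF mor_ghom[OF s] _ frc_ex.prems(2)] act_form(9)[OF mor_ghom[OF s] frc_ex.prems(2)] frc_ex.prems(1)
      by (simp add: wf_world_def)
    finally show "\<exists>t. is_term (fst w') t \<tau> \<and> frc R' w' (nf (act s F \<cdot> t))"
      using IH u mor_wf[OF s] is_term_nf_App[OF t'(1) u] frc_ex.prems(3) by auto
  qed
next
  case (frc_nabla a \<tau> F w)
  have t: "is_term (fst w) F (\<tau> \<rightarrow> Prop)" "\<tau> \<in> nominal" using frc_nabla.prems by (simp_all add: is_term_const_iff)
  then have a: "is_term (fst w) (Nom a) \<tau>" using frc_nabla.hyps(1) by (auto simp: is_term_def intro: has_type.intros)
  have "lev (nf (F \<cdot> Nom a)) = lev (Nabla \<tau> F)"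
    by (rule lev_instance[OF _ frc_nabla.prems(2) _ t(1) a]) (use frc_nabla.prems(1) in \<open>auto simp: wf_world_def\<close>)
  then show ?case
    using frc_nabla.IH[OF frc_nabla.prems(1) is_term_nf_App[OF t(1) a]] frc_nabla.prems(3) frc_nabla.hyps(1,2)
    by (intro frc.frc_nabla) auto
next
  case (frc_eq w t u \<tau>)
  then show ?case by (intro frc.frc_eq)
next
  case (frc_atom A p w)
  have lA: "lev A = lvl p"
    using frc_atom.hyps(1) head_apps_exists[of A] by (metis level_simps(1))
  show ?case
  proof (rule frc.frc_atom[OF frc_atom.hyps(1)], rule cps_mp[OF frc_atom.IH frc_atom.prems(1)], elim disjE exE conjE)
    fix w' s xs B ts
    assume s: "mor s w w'" and A: "act s A = Atom p ts" and c: "clause p = Some (xs, B)" "length ts = length xs"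
      and IH: "wf_world w' \<longrightarrow> is_term (fst w') (inst B xs ts) Prop \<longrightarrow> lev (inst B xs ts) \<le> n \<longrightarrow> frc R' w' (inst B xs ts)"
    have "is_term (fst w') (Atom p ts) Prop" using is_term_mor[OF s frc_atom.prems(2)] A by simp
    then have "frc R' w' (inst B xs ts)"
      using IH mor_wf[OF s] inst_is_term[OF c(1)] inst_level[OF c(1)] lA frc_atom.prems(3) by fastforce
    then show "(\<exists>X\<in>#snd w'. eqv (act s A) X) \<or> (\<exists>xs B ts. act s A = Atom p ts \<and> clause p = Some (xs, B) \<and>
        length ts = length xs \<and> frc R' w' (inst B xs ts))"
      using A c by blast
  qed blast
next
  case (frc_nat w I)
  have t: "is_term (fst w) I Nt" using frc_nat.prems by (simp add: is_term_const_iff)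
  show ?case
  proof (rule frc.frc_nat, rule cps_mp[OF frc_nat.IH frc_nat.prems(1)], elim disjE exE conjE)
    fix w' s J
    assume s: "mor s w w'" and J: "act s I = Succ J"
      and IH: "wf_world w' \<longrightarrow> is_term (fst w') (NatP J) Prop \<longrightarrow> lev (NatP J) \<le> n \<longrightarrow> frc R' w' (NatP J)"
    have "is_term (fst w') (NatP J) Prop" using is_term_mor[OF s t] J by (simp add: is_term_const_iff)
    then have "frc R' w' (NatP J)" using IH mor_wf[OF s] frc_nat.prems(3) by (simp add: level_simps)
    then show "(\<exists>X\<in>#snd w'. eqv (NatP (act s I)) X) \<or> act s I = Zero \<or> (\<exists>J. act s I = Succ J \<and> frc R' w' (NatP J))"
      using J by blast
  qed blast+
qed

section \<open>Forcing by recursion on levels\<close>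

text \<open>\<open>below n\<close> is forcing of formulas of level less than \<open>n\<close>, and
  \<open>frc (below n)\<close> that of formulas of level at most \<open>n\<close>; the latter agrees
  with \<open>forces\<close> by \<open>frc_below_iff_forces\<close>.\<close>

primrec below :: "nat \<Rightarrow> ('b, 'k, 'n) world \<Rightarrow> ('b, 'k, 'n) tm \<Rightarrow> bool" where
  "below 0 = (\<lambda>_ _. False)"
| "below (Suc n) = frc (below n)"

definition forces :: "('b, 'k, 'n) world \<Rightarrow> ('b, 'k, 'n) tm \<Rightarrow> bool" where
  "forces w B = frc (below (lev B)) w B"

text \<open>By \<open>frc_level\<close>, only the forcing of formulas of level less than
  \<open>lev B\<close> matters on either side, and there the induction hypothesis identifies the two
  relations.\<close>

lemma frc_below_cong:
  assumes "wf_world w" "is_term (fst w) B Prop" "lev B \<le> n" "lev B \<le> m"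
  shows "frc (below n) w B \<longleftrightarrow> frc (below m) w B"
  using assms
proof (induction n arbitrary: m w B)
  case 0
  then show ?case by (auto intro: frc_level[where n = 0])
next
  case (Suc n)
  show ?case
  proof (cases m)
    case 0
    with Suc.prems show ?thesis by (auto intro: frc_level[where n = 0])
  next
    case (Suc m')
    have "below (Suc n) w' C = below m w' C"
      if "wf_world w'" "is_term (fst w') C Prop" "lev C < lev B" for w' C
      using Suc.IH[OF that(1,2), of m'] that(3) Suc.prems Suc by simp
    then show ?thesis using Suc.prems by (blast intro: frc_level[OF _ _ _ order_refl])
  qed
qed

lemma frc_below_iff_forces:
  "wf_world w \<Longrightarrow> is_term (fst w) B Prop \<Longrightarrow> lev B \<le> n \<Longrightarrow> frc (below n) w B \<longleftrightarrow> forces w B"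
  unfolding forces_def by (rule frc_below_cong) auto

lemma below_iff_forces:
  "wf_world w \<Longrightarrow> is_term (fst w) B Prop \<Longrightarrow> lev B < n \<Longrightarrow> below n w B \<longleftrightarrow> forces w B"
  by (cases n) (auto simp: frc_below_iff_forces)

lemma forces_mor: "forces w B \<Longrightarrow> wf_world w \<Longrightarrow> is_term (fst w) B Prop \<Longrightarrow> mor s w w' \<Longrightarrow> forces w' (act s B)"
  unfolding forces_def using frc_mor lev_act[OF mor_ghom] by (simp add: wf_world_def)

lemma forces_perm:
  assumes "forces w B" "wf_world w" "is_term (fst w) B Prop" "is_perm \<pi>"
  shows "forces w (perm \<pi> B)"
  using forces_mor[OF assms(1-3) mor_perm[OF assms(2,4)]] act_perm[OF assms(4,3)] by simp

lemma wf_world_sig: "wf_world w \<Longrightarrow> is_sig (fst w)"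
  by (simp add: wf_world_def)

inductive_cases frc_BotE: "frc R w Bot"
inductive_cases frc_ConjE: "frc R w (Conj B C)"
inductive_cases frc_DisjE: "frc R w (Disj B C)"
inductive_cases frc_ImpE: "frc R w (Imp B C)"
inductive_cases frc_ForallE: "frc R w (Forall \<tau> F)"
inductive_cases frc_ExistsE: "frc R w (Exists \<tau> F)"
inductive_cases frc_NablaE: "frc R w (Nabla \<tau> F)"
inductive_cases frc_EqE: "frc R w (Eq \<tau> t u)"
inductive_cases frc_NatPE: "frc R w (NatP I)"

section \<open>Forcing clauses freed of levels\<close>

lemma forces_bot_iff: "forces w Bot \<longleftrightarrow> cps w (\<lambda>_ _. False)"
  unfolding forces_def by (auto intro: frc_bot elim: frc_BotE)

lemma forces_top: "forces w Top"
  unfolding forces_def by (rule frc_top)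

lemma cps_cong:
  assumes "wf_world w" "\<And>w' s. mor s w w' \<Longrightarrow> P w' s = Q w' s"
  shows "cps w P \<longleftrightarrow> cps w Q"
  using cps_mp[OF _ assms(1), of P Q] cps_mp[OF _ assms(1), of Q P] assms(2) by blast

lemma forces_conj_iff:
  assumes "wf_world w" "is_term (fst w) (Conj B C) Prop"
  shows "forces w (Conj B C) \<longleftrightarrow> forces w B \<and> forces w C"
proof -
  let ?n = "lev (Conj B C)"
  have t: "is_term (fst w) B Prop" "is_term (fst w) C Prop" "lev B \<le> ?n" "lev C \<le> ?n"
    using assms by (simp_all add: is_term_const_iff level_simps)
  have "forces w (Conj B C) \<longleftrightarrow> frc (below ?n) w B \<and> frc (below ?n) w C"
    unfolding forces_def by (auto intro: frc_conj elim: frc_ConjE)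
  then show ?thesis using t assms(1) by (simp add: frc_below_iff_forces)
qed

lemma forces_disj_iff:
  assumes "wf_world w" "is_term (fst w) (Disj B C) Prop"
  shows "forces w (Disj B C) \<longleftrightarrow> cps w (\<lambda>w' s. forces w' (act s B) \<or> forces w' (act s C))"
proof -
  let ?n = "lev (Disj B C)"
  have t: "is_term (fst w) B Prop" "is_term (fst w) C Prop" "lev B \<le> ?n" "lev C \<le> ?n"
    using assms by (simp_all add: is_term_const_iff level_simps)
  have "forces w (Disj B C) \<longleftrightarrow> cps w (\<lambda>w' s. frc (below ?n) w' (act s B) \<or> frc (below ?n) w' (act s C))"
    unfolding forces_def by (auto intro: frc_disj elim: frc_DisjE)
  also have "\<dots> \<longleftrightarrow> cps w (\<lambda>w' s. forces w' (act s B) \<or> forces w' (act s C))"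
    by (rule cps_cong[OF assms(1)])
      (use t assms(1) in \<open>simp add: frc_below_iff_forces mor_wf is_term_mor lev_act[OF mor_ghom] wf_world_sig\<close>)
  finally show ?thesis .
qed

lemma forces_imp_iff:
  assumes "wf_world w" "is_term (fst w) (Imp B C) Prop"
  shows "forces w (Imp B C) \<longleftrightarrow> (\<forall>w' s. mor s w w' \<longrightarrow> forces w' (act s B) \<longrightarrow> forces w' (act s C))"
proof -
  let ?n = "lev (Imp B C)"
  have t: "is_term (fst w) B Prop" "is_term (fst w) C Prop" "lev B < ?n" "lev C \<le> ?n"
    using assms by (simp_all add: is_term_const_iff level_simps)
  have "forces w (Imp B C) \<longleftrightarrow> (\<forall>w' s. mor s w w' \<longrightarrow> below ?n w' (act s B) \<longrightarrow> frc (below ?n) w' (act s C))"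
    unfolding forces_def by (auto intro: frc_imp elim: frc_ImpE)
  then show ?thesis
    using t assms(1) by (simp add: frc_below_iff_forces below_iff_forces mor_wf is_term_mor lev_act[OF mor_ghom] wf_world_sig)
qed

lemma lev_mor_instance:
  assumes "wf_world w" "is_term (fst w) (Cst q \<cdot> F) Prop" "quant_cst q" "is_term (fst w) F (\<tau> \<rightarrow> Prop)"
    "mor s w w'" "is_term (fst w') t \<tau>"
  shows "lev (nf (act s F \<cdot> t)) = lev (Cst q \<cdot> F)"
proof -
  have F: "is_term (fst w') (act s F) (\<tau> \<rightarrow> Prop)" by (rule is_term_mor[OF assms(5,4)])
  have qF: "act s (Cst q \<cdot> F) = Cst q \<cdot> act s F"
    using assms(2,3) by (cases q) (auto simp: act_form[OF mor_ghom[OF assms(5)]])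
  then have "is_term (fst w') (Cst q \<cdot> act s F) Prop" using is_term_mor[OF assms(5,2)] by simp
  from lev_instance[OF wf_world_sig[OF mor_wf[OF assms(5)]] this assms(3) F assms(6)]
  show ?thesis using lev_act[OF mor_ghom[OF assms(5)] wf_world_sig[OF assms(1)] assms(2)] qF by simp
qed

lemma forces_all_iff:
  assumes "wf_world w" "is_term (fst w) (Forall \<tau> F) Prop"
  shows "forces w (Forall \<tau> F) \<longleftrightarrow>
    (\<forall>w' s t. mor s w w' \<longrightarrow> is_term (fst w') t \<tau> \<longrightarrow> forces w' (nf (act s F \<cdot> t)))"
proof -
  let ?n = "lev (Forall \<tau> F)"
  have t: "is_term (fst w) F (\<tau> \<rightarrow> Prop)" using assms by (simp add: is_term_const_iff)
  have "forces w (Forall \<tau> F) \<longleftrightarrow>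
      (\<forall>w' s t. mor s w w' \<longrightarrow> is_term (fst w') t \<tau> \<longrightarrow> frc (below ?n) w' (nf (act s F \<cdot> t)))"
    unfolding forces_def by (auto intro: frc_all elim: frc_ForallE)
  then show ?thesis
    using lev_mor_instance[OF assms _ t]
    by (simp add: frc_below_iff_forces mor_wf is_term_nf_App[OF is_term_mor[OF _ t]])
qed

lemma forces_ex_iff:
  assumes "wf_world w" "is_term (fst w) (Exists \<tau> F) Prop"
  shows "forces w (Exists \<tau> F) \<longleftrightarrow> cps w (\<lambda>w' s. \<exists>t. is_term (fst w') t \<tau> \<and> forces w' (nf (act s F \<cdot> t)))"
proof -
  let ?n = "lev (Exists \<tau> F)"
  have t: "is_term (fst w) F (\<tau> \<rightarrow> Prop)" using assms by (simp add: is_term_const_iff)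
  have "forces w (Exists \<tau> F) \<longleftrightarrow>
      cps w (\<lambda>w' s. \<exists>t. is_term (fst w') t \<tau> \<and> frc (below ?n) w' (nf (act s F \<cdot> t)))"
    unfolding forces_def by (auto intro: frc_ex elim: frc_ExistsE)
  also have "\<dots> \<longleftrightarrow> cps w (\<lambda>w' s. \<exists>t. is_term (fst w') t \<tau> \<and> forces w' (nf (act s F \<cdot> t)))"
  proof (rule cps_cong[OF assms(1)])
    fix w' s assume s: "mor s w w'"
    have "frc (below ?n) w' (nf (act s F \<cdot> u)) \<longleftrightarrow> forces w' (nf (act s F \<cdot> u))" if "is_term (fst w') u \<tau>" for u
      using lev_mor_instance[OF assms _ t s that] that
      by (simp add: frc_below_iff_forces mor_wf[OF s] is_term_nf_App[OF is_term_mor[OF s t]])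
    then show "(\<exists>t. is_term (fst w') t \<tau> \<and> frc (below ?n) w' (nf (act s F \<cdot> t))) =
        (\<exists>t. is_term (fst w') t \<tau> \<and> forces w' (nf (act s F \<cdot> t)))" by blast
  qed
  finally show ?thesis .
qed

lemma is_term_Nom: "ntype a \<in> nominal \<Longrightarrow> is_term \<Sigma> (Nom a) (ntype a)"
  by (auto simp: is_term_def intro: has_type.intros)

text \<open>The some/any property of fresh names: \<open>frc_nabla\<close> provides one fresh
  nominal constant, and a swap that fixes \<open>F\<close> turns it into any other one.\<close>

lemma forces_nabla_iff:
  assumes "wf_world w" "is_term (fst w) (Nabla \<tau> F) Prop" "ntype a = \<tau>" "a \<notin> supp F"
  shows "forces w (Nabla \<tau> F) \<longleftrightarrow> forces w (nf (F \<cdot> Nom a))"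
proof -
  let ?n = "lev (Nabla \<tau> F)"
  have t: "is_term (fst w) F (\<tau> \<rightarrow> Prop)" "\<tau> \<in> nominal" using assms by (simp_all add: is_term_const_iff)
  have l: "frc (below ?n) w (nf (F \<cdot> Nom a)) \<longleftrightarrow> forces w (nf (F \<cdot> Nom a))" if "ntype a = \<tau>" for a
    using lev_mor_instance[OF assms(1,2) _ t(1) mor_id[OF assms(1)], of "Nom a"] is_term_Nom[of a] that t
    by (simp add: frc_below_iff_forces[OF assms(1)] is_term_nf_App[OF t(1)])
  show ?thesis
  proof
    assume "forces w (Nabla \<tau> F)"
    then have "frc (below ?n) w (Nabla \<tau> F)" by (simp add: forces_def)
    then obtain b where b: "ntype b = \<tau>" "b \<notin> supp F" "forces w (nf (F \<cdot> Nom b))"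
      by (rule frc_NablaE) (use l in auto)
    let ?\<pi> = "id(a := b, b := a)"
    have \<pi>: "is_perm ?\<pi>" by (rule is_perm_swap) (simp add: assms(3) b(1))
    have n: "is_term (fst w) (Nom b) \<tau>" using is_term_Nom[of b] b(1) t(2) by simp
    have "perm ?\<pi> F = F" using assms(4) b(2) by (intro perm_idle) auto
    moreover have "perm ?\<pi> (Nom b) = Nom a" by simp
    ultimately have "perm ?\<pi> (nf (F \<cdot> Nom b)) = nf (F \<cdot> Nom a)"
      using perm_instance[OF \<pi> t(1) n] by metis
    then show "forces w (nf (F \<cdot> Nom a))"
      using forces_perm[OF b(3) assms(1) is_term_nf_App[OF t(1) n] \<pi>] by simp
  next
    assume "forces w (nf (F \<cdot> Nom a))"
    then show "forces w (Nabla \<tau> F)"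
      unfolding forces_def[of w "Nabla \<tau> F"] using l[OF assms(3)] by (blast intro: frc_nabla[OF assms(3,4)])
  qed
qed

lemma forces_eq_iff: "forces w (Eq \<tau> t u) \<longleftrightarrow> cps w (\<lambda>w' s. act s t = act s u)"
  unfolding forces_def by (auto intro: frc_eq elim: frc_EqE)

text \<open>The first alternative corresponds to a neutral term of base type: an atom that is
  assumed counts as forced without its clause being unfolded.\<close>

definition unfolds :: "('b, 'k, 'n) world \<Rightarrow> ('b, 'k, 'n) tm \<Rightarrow> bool" where
  "unfolds w A \<longleftrightarrow> (\<exists>X\<in>#snd w. eqv A X) \<or>
    (\<exists>p xs B ts. A = Atom p ts \<and> clause p = Some (xs, B) \<and> length ts = length xs \<and> forces w (inst B xs ts))"

lemma K_head_unique: "head A = Cst (K p) \<Longrightarrow> A = Atom q ts \<Longrightarrow> q = p"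
  by auto

lemma forces_atom_iff:
  assumes "wf_world w" "is_term (fst w) A Prop" "head A = Cst (K p)"
  shows "forces w A \<longleftrightarrow> cps w (\<lambda>w' s. unfolds w' (act s A))"
proof -
  have n: "lev A = lvl p" using assms(3) head_apps_exists[of A] by (metis level_simps(1))
  let ?P = "\<lambda>R w' s. (\<exists>X\<in>#snd w'. eqv (act s A) X) \<or>
      (\<exists>xs B ts. act s A = Atom p ts \<and> clause p = Some (xs, B) \<and> length ts = length xs \<and>
        frc R w' (inst B xs ts))"
  have "frc R w A \<longleftrightarrow> cps w (?P R)" for R
  proof
    assume "frc R w A"
    then show "cps w (?P R)" by cases (use assms(3) in auto)
  qed (rule frc_atom[OF assms(3)])
  then have "forces w A \<longleftrightarrow> cps w (?P (below (lvl p)))" by (simp add: forces_def n)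
  also have "\<dots> \<longleftrightarrow> cps w (\<lambda>w' s. unfolds w' (act s A))"
  proof (rule cps_cong[OF assms(1)])
    fix w' s assume s: "mor s w w'"
    have h: "head (act s A) = Cst (K p)" by (rule head_act[OF mor_ghom[OF s] assms(2,3)])
    have "frc (below (lvl p)) w' (inst B xs ts) \<longleftrightarrow> forces w' (inst B xs ts)"
      if "act s A = Atom p ts" "clause p = Some (xs, B)" for xs B ts
    proof -
      have "is_term (fst w') (Atom p ts) Prop" using is_term_mor[OF s assms(2)] that(1) by simp
      then show ?thesis
        using frc_below_iff_forces[OF mor_wf[OF s]] inst_is_term[OF that(2)] inst_level[OF that(2)] by blast
    qed
    then show "?P (below (lvl p)) w' s = unfolds w' (act s A)"
      unfolding unfolds_def using K_head_unique[OF h] by blast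
  qed
  finally show ?thesis .
qed

lemma lev_NatP [simp]: "lev (NatP I) = lvl_nat"
  by (simp add: level_simps)

definition nat_unfolds :: "('b, 'k, 'n) world \<Rightarrow> ('b, 'k, 'n) tm \<Rightarrow> bool" where
  "nat_unfolds w I \<longleftrightarrow> (\<exists>X\<in>#snd w. eqv (NatP I) X) \<or> I = Zero \<or> (\<exists>J. I = Succ J \<and> forces w (NatP J))"

lemma forces_nat_iff: "forces w (NatP I) \<longleftrightarrow> cps w (\<lambda>w' s. nat_unfolds w' (act s I))"
  unfolding forces_def nat_unfolds_def lev_NatP by (auto intro: frc_nat elim: frc_NatPE)

text \<open>This is the induction principle of \<open>frc\<close> restricted to \<open>nat\<close>.
  \<open>P\<close> is an arbitrary predicate, so it may concern formulas of a higher level than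
  \<open>nat\<close>.\<close>

lemma forces_nat_induct [consumes 1, case_names step]:
  assumes "forces w (NatP I)"
    and step: "\<And>w I. cps w (\<lambda>w' s. (\<exists>X\<in>#snd w'. eqv (NatP (act s I)) X) \<or> act s I = Zero \<or>
      (\<exists>J. act s I = Succ J \<and> P w' J)) \<Longrightarrow> P w I"
  shows "P w I"
proof -
  have "frc R w B \<Longrightarrow> B = NatP I \<Longrightarrow> P w I" for R w B I
  proof (induction arbitrary: I rule: frc.induct)
    case (frc_nat w I')
    show ?case
    proof (rule step)
      show "cps w (\<lambda>w' s. (\<exists>X\<in>#snd w'. eqv (NatP (act s I)) X) \<or> act s I = Zero \<or>
          (\<exists>J. act s I = Succ J \<and> P w' J))"
        using frc_nat.IH frc_nat.prems by (auto elim!: cps_mono[rule_format, rotated])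
    qed
  qed auto
  then show ?thesis using assms(1) unfolding forces_def by blast
qed

section \<open>The number of connectives as a measure\<close>

lemma quant_not_atomic: "quant_cst q \<Longrightarrow> \<not> atomic_cst q"
  by (cases q) auto

lemma quant_neq: "quant_cst q \<Longrightarrow> q \<noteq> CConj \<and> q \<noteq> CDisj \<and> q \<noteq> CImp"
  by (cases q) auto

lemma skel_unique: "skel l ln t n m \<Longrightarrow> skel l ln t n' m' \<Longrightarrow> n = n'"
proof (induction arbitrary: n' m' rule: skel.induct)
  case (skel_atom t c)
  from skel_atom(3,1,2) show ?case by cases (auto dest: quant_not_atomic)
next
  case (skel_conj B n m C n1 m1)
  from skel_conj.prems show ?case by cases (auto dest!: skel_conj.IH dest: quant_neq)
next
  case (skel_disj B n m C n1 m1)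
  from skel_disj.prems show ?case by cases (auto dest!: skel_disj.IH dest: quant_neq)
next
  case (skel_imp B n m C n1 m1)
  from skel_imp.prems show ?case by cases (auto dest!: skel_imp.IH dest: quant_neq)
next
  case (skel_quant q B n m \<tau>)
  from skel_quant.prems show ?case
    by cases (use skel_quant.hyps(1) in \<open>auto dest!: skel_quant.IH dest: quant_not_atomic\<close>)
next
  case (skel_quant_eta q t c)
  from skel_quant_eta.prems show ?case
    by cases (use skel_quant_eta.hyps in \<open>auto dest: quant_not_atomic\<close>)
qed

text \<open>Defined through skeletons instead of recursion on terms, so that a quantifier over
  \<open>Lam \<tau> (t \<cdot> Bound 0)\<close> and one over its eta-reduct \<open>t\<close> get the
  same number, and substitution does not change it.\<close>

definition fsize :: "('b, 'k, 'n) tm \<Rightarrow> nat" where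
  "fsize B = (THE n. \<exists>m. skel lvl lvl_nat B n m)"

lemma fsize_eq: "skel lvl lvl_nat B n m \<Longrightarrow> fsize B = n"
  unfolding fsize_def by (rule the_equality) (use skel_unique in blast)+

lemma formula_fsize: "is_sig \<Sigma> \<Longrightarrow> is_term \<Sigma> B Prop \<Longrightarrow> skel lvl lvl_nat B (fsize B) (lev B)"
  using formula_skel fsize_eq by metis

lemma fsize_act: "mor s w w' \<Longrightarrow> wf_world w \<Longrightarrow> is_term (fst w) B Prop \<Longrightarrow> fsize (act s B) = fsize B"
  using fsize_eq[OF skel_act[OF mor_ghom _ formula_fsize]] wf_world_sig by blast

lemma fsize_less:
  assumes "is_sig \<Sigma>"
  shows "is_term \<Sigma> (Conj B C) Prop \<Longrightarrow> fsize B < fsize (Conj B C) \<and> fsize C < fsize (Conj B C)"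
    "is_term \<Sigma> (Disj B C) Prop \<Longrightarrow> fsize B < fsize (Disj B C) \<and> fsize C < fsize (Disj B C)"
    "is_term \<Sigma> (Imp B C) Prop \<Longrightarrow> fsize B < fsize (Imp B C) \<and> fsize C < fsize (Imp B C)"
proof -
  note f = formula_fsize[OF assms]
  show "is_term \<Sigma> (Conj B C) Prop \<Longrightarrow> fsize B < fsize (Conj B C) \<and> fsize C < fsize (Conj B C)"
    using fsize_eq[OF skel_conj[OF f f]] by (simp add: is_term_const_iff)
  show "is_term \<Sigma> (Disj B C) Prop \<Longrightarrow> fsize B < fsize (Disj B C) \<and> fsize C < fsize (Disj B C)"
    using fsize_eq[OF skel_disj[OF f f]] by (simp add: is_term_const_iff)
  show "is_term \<Sigma> (Imp B C) Prop \<Longrightarrow> fsize B < fsize (Imp B C) \<and> fsize C < fsize (Imp B C)"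
    using fsize_eq[OF skel_imp[OF f f]] by (simp add: is_term_const_iff)
qed

lemma fsize_instance:
  assumes "wf_world w" "is_term (fst w) (Cst q \<cdot> F) Prop" "quant_cst q" "is_term (fst w) F (\<tau> \<rightarrow> Prop)"
    "is_term (fst w) t \<tau>"
  shows "fsize (nf (F \<cdot> t)) < fsize (Cst q \<cdot> F)"
proof -
  note f = formula_fsize[OF wf_world_sig[OF assms(1)] assms(2)]
  obtain n' where "n' < fsize (Cst q \<cdot> F)" "skel lvl lvl_nat (nf (F \<cdot> t)) n' (lev (Cst q \<cdot> F))"
    using quant_skel[OF wf_world_sig[OF assms(1)] assms(2-5) f] by blast
  then show ?thesis using fsize_eq by metis
qed

lemma formula_cases [consumes 2]:
  assumes "is_sig \<Sigma>" "is_term \<Sigma> t Prop"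
  obtains (atom) p where "head t = Cst (K p)"
  | (bot) "t = Bot" | (top) "t = Top"
  | (conj) B C where "t = Conj B C"
  | (disj) B C where "t = Disj B C"
  | (imp) B C where "t = Imp B C"
  | (eq) \<tau> s u where "t = Eq \<tau> s u"
  | (all) \<tau> F where "t = Forall \<tau> F"
  | (ex) \<tau> F where "t = Exists \<tau> F"
  | (nabla) \<tau> F where "t = Nabla \<tau> F"
  | (nat) I where "t = NatP I"
proof -
  have t: "tyd t Prop" "normal t" using assms(2) by (auto simp: is_term_def)
  show ?thesis
    by (rule formula_shape[OF t _ is_sig_o_free[OF assms] nominal_ok]) (use that in auto)
qed

section \<open>Forcing and cut-free derivability\<close>

lemma der_rule:
  assumes "LG_rule Ps (fst w;; snd w \<turnstile> C)" "wf_world w" "is_term (fst w) C Prop"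
    "\<And>P. P \<in> Ps \<Longrightarrow> derivable_mc_free P"
  shows "der w C"
  unfolding der_def derivable_mc_free_def
  by (rule derivable.intros[of _ Ps])
    (use assms in \<open>auto simp: wf_world_def derivable_mc_free_def\<close>)

section \<open>Available formulas and the left rules\<close>

definition ext :: "('b, 'k, 'n) world \<Rightarrow> ('b, 'k, 'n) tm \<Rightarrow> ('b, 'k, 'n) world" where
  "ext w B = (fst w, add_mset B (snd w))"

lemma ext_simps [simp]: "fst (ext w B) = fst w" "snd (ext w B) = add_mset B (snd w)"
  by (simp_all add: ext_def)

lemma wf_ext: "wf_world w \<Longrightarrow> is_term (fst w) B Prop \<Longrightarrow> wf_world (ext w B)"
  by (auto simp: wf_world_def)

lemma mor_ext: "wf_world w \<Longrightarrow> is_term (fst w) B Prop \<Longrightarrow> mor id w (ext w B)"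
  by (rule mor_weaken) (auto intro: wf_ext)

lemma der_ext_rule:
  assumes "LG_rule Ps (fst w;; add_mset X (snd w) \<turnstile> E)" "wf_world w" "is_term (fst w) X Prop"
    "is_term (fst w) E Prop" "\<And>P. P \<in> Ps \<Longrightarrow> derivable_mc_free P"
  shows "der (ext w X) E"
  by (rule der_rule[of Ps]) (use assms wf_ext in auto)

text \<open>
  The counterpart of neutral terms in normalization by evaluation: \<open>B\<close> can be removed from the
  assumptions of any derivation above \<open>w\<close>.
\<close>

definition available :: "('b, 'k, 'n) world \<Rightarrow> ('b, 'k, 'n) tm \<Rightarrow> bool" where
  "available w B \<longleftrightarrow> (\<forall>w' s E. mor s w w' \<longrightarrow> is_term (fst w') E Prop \<longrightarrow>
     (\<forall>\<pi>. is_perm \<pi> \<longrightarrow> der (ext w' (perm \<pi> (act s B))) E) \<longrightarrow> der w' E)"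

lemma availD:
  "available w B \<Longrightarrow> mor s w w' \<Longrightarrow> is_term (fst w') E Prop \<Longrightarrow>
    (\<And>\<pi>. is_perm \<pi> \<Longrightarrow> der (ext w' (perm \<pi> (act s B))) E) \<Longrightarrow> der w' E"
  unfolding available_def by blast

text \<open>Contraction makes assumptions available: a derivation may use up a copy while the
  original, possibly renamed, stays in the world.\<close>

lemma available_context:
  assumes "X \<in># snd w" "eqv B X" "wf_world w" "is_term (fst w) B Prop"
  shows "available w B"
  unfolding available_def
proof (intro allI impI)
  fix w' s E
  assume s: "mor s w w'" and E: "is_term (fst w') E Prop"
    and k: "\<forall>\<pi>. is_perm \<pi> \<longrightarrow> der (ext w' (perm \<pi> (act s B))) E"
  obtain Y where Y: "Y \<in># snd w'" "eqv (act s X) Y" using s assms(1) by (auto simp: mor_def)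
  have "eqv (act s B) Y"
    using eqv_act[OF mor_khom[OF s] assms(2,4)] Y(2) eqv_trans by blast
  then obtain \<pi> where \<pi>: "is_perm \<pi>" "perm \<pi> (act s B) = Y" by (auto simp: eqv_def)
  obtain \<Gamma> where \<Gamma>: "snd w' = add_mset Y \<Gamma>" using Y(1) by (metis mset_add)
  show "der w' E"
  proof (rule der_rule)
    show "LG_rule {fst w';; add_mset Y (add_mset Y \<Gamma>) \<turnstile> E} (fst w';; snd w' \<turnstile> E)"
      unfolding \<Gamma> by (rule cL)
    show "derivable_mc_free P" if "P \<in> {fst w';; add_mset Y (add_mset Y \<Gamma>) \<turnstile> E}" for P
      using that k \<pi> \<Gamma> by (auto simp: der_def)
  qed (use mor_wf[OF s] E in auto)
qed

lemma available_mor: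
  assumes "available w B" "wf_world w" "is_term (fst w) B Prop" "mor s w w'"
  shows "available w' (act s B)"
  unfolding available_def
proof (intro allI impI)
  fix w'' r E
  assume r: "mor r w' w''" and E: "is_term (fst w'') E Prop"
    and k: "\<forall>\<pi>. is_perm \<pi> \<longrightarrow> der (ext w'' (perm \<pi> (act r (act s B)))) E"
  then show "der w'' E"
    using availD[OF assms(1) mor_cmp[OF assms(4) r assms(2)] E] act_cmp_mor[OF assms(4) r assms(3)] by simp
qed

lemma is_term_pa: "mor s w w' \<Longrightarrow> is_perm \<pi> \<Longrightarrow> is_term (fst w) t \<tau> \<Longrightarrow> is_term (fst w') (perm \<pi> (act s t)) \<tau>"
  by (intro is_term_perm is_term_mor)

text \<open>The common pattern of the left rules that replace \<open>A\<close> by \<open>B\<close>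
  in one premise; \<open>Ps\<close> collects the side premises, which must already be
  derivable.\<close>

lemma available_rule:
  assumes "available w A" "is_term (fst w) A Prop"
    and "\<And>w' s \<pi> E. mor s w w' \<Longrightarrow> is_perm \<pi> \<Longrightarrow> \<exists>Ps.
      LG_rule (insert (fst w';; add_mset (perm \<pi> (act s B)) (snd w') \<turnstile> E) Ps)
        (fst w';; add_mset (perm \<pi> (act s A)) (snd w') \<turnstile> E) \<and> (\<forall>P\<in>Ps. derivable_mc_free P)"
  shows "available w B"
  unfolding available_def
proof (intro allI impI)
  fix w' s E
  assume s: "mor s w w'" and E: "is_term (fst w') E Prop"
    and k: "\<forall>\<pi>. is_perm \<pi> \<longrightarrow> der (ext w' (perm \<pi> (act s B))) E"
  show "der w' E"
  proof (rule availD[OF assms(1) s E])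
    fix \<pi> assume \<pi>: "is_perm \<pi>"
    obtain Ps where Ps: "LG_rule (insert (fst w';; add_mset (perm \<pi> (act s B)) (snd w') \<turnstile> E) Ps)
        (fst w';; add_mset (perm \<pi> (act s A)) (snd w') \<turnstile> E)" "\<forall>P\<in>Ps. derivable_mc_free P"
      using assms(3)[OF s \<pi>] by blast
    show "der (ext w' (perm \<pi> (act s A))) E"
      by (rule der_ext_rule[OF Ps(1) mor_wf[OF s] is_term_pa[OF s \<pi> assms(2)] E])
        (use Ps(2) k \<pi> in \<open>auto simp: der_def\<close>)
  qed
qed

lemma available_conj:
  assumes "available w (Conj B C)" "is_term (fst w) (Conj B C) Prop"
  shows "available w B" "available w C"
  by (rule available_rule[OF assms], rule exI[of _ "{}"],
      simp add: act_form(4)[OF mor_ghom assms(2)] andL1 andL2)+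

lemma available_imp:
  assumes "available w (Imp B C)" "is_term (fst w) (Imp B C) Prop"
    and "\<And>w' s \<pi>. mor s w w' \<Longrightarrow> is_perm \<pi> \<Longrightarrow> der w' (perm \<pi> (act s B))"
  shows "available w C"
proof (rule available_rule[OF assms(1,2)])
  fix w' s \<pi> E
  assume s: "mor s w w'" and \<pi>: "is_perm \<pi>"
  show "\<exists>Ps. LG_rule (insert (fst w';; add_mset (perm \<pi> (act s C)) (snd w') \<turnstile> E) Ps)
      (fst w';; add_mset (perm \<pi> (act s (Imp B C))) (snd w') \<turnstile> E) \<and> (\<forall>P\<in>Ps. derivable_mc_free P)"
    using impL[of "fst w'" "snd w'" "perm \<pi> (act s B)" "perm \<pi> (act s C)" E] assms(3)[OF s \<pi>]
    by (intro exI[of _ "{fst w';; snd w' \<turnstile> perm \<pi> (act s B)}"])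
      (simp add: act_form(6)[OF mor_ghom[OF s] assms(2)] insert_commute der_def)
qed

lemma available_all:
  assumes "available w (Forall \<tau> F)" "is_term (fst w) (Forall \<tau> F) Prop" "is_term (fst w) t \<tau>"
  shows "available w (nf (F \<cdot> t))"
proof (rule available_rule[OF assms(1,2)])
  fix w' s \<pi> E
  assume s: "mor s w w'" and \<pi>: "is_perm \<pi>"
  have F: "is_term (fst w) F (\<tau> \<rightarrow> Prop)" using assms(2) by (simp add: is_term_const_iff)
  have "perm \<pi> (act s (nf (F \<cdot> t))) = nf (perm \<pi> (act s F) \<cdot> perm \<pi> (act s t))"
    unfolding act_instance[OF mor_ghom[OF s] F assms(3)]
    by (rule perm_instance[OF \<pi> is_term_mor[OF s F] is_term_mor[OF s assms(3)]])
  then show "\<exists>Ps. LG_rule (insert (fst w';; add_mset (perm \<pi> (act s (nf (F \<cdot> t)))) (snd w') \<turnstile> E) Ps)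
      (fst w';; add_mset (perm \<pi> (act s (Forall \<tau> F))) (snd w') \<turnstile> E) \<and> (\<forall>P\<in>Ps. derivable_mc_free P)"
    by (intro exI[of _ "{}"])
      (simp add: act_form(8)[OF mor_ghom[OF s] assms(2)] allL[OF is_term_pa[OF s \<pi> assms(3)]])
qed

lemma available_nabla:
  assumes "available w (Nabla \<tau> F)" "is_term (fst w) (Nabla \<tau> F) Prop" "ntype a = \<tau>" "a \<notin> supp F"
  shows "available w (nf (F \<cdot> Nom a))"
proof (rule available_rule[OF assms(1,2)])
  fix w' s \<pi> E
  assume s: "mor s w w'" and \<pi>: "is_perm \<pi>"
  have F: "is_term (fst w) F (\<tau> \<rightarrow> Prop)" "\<tau> \<in> nominal" using assms(2) by (simp_all add: is_term_const_iff)
  have a: "is_term (fst w) (Nom a) \<tau>" using is_term_Nom[of a] F assms(3) by simp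
  obtain b where b: "s (Nom a) = Nom b" "ntype b = ntype a" "b \<notin> supp (act s F)"
    using act_fresh[OF s F(1) assms(4)] .
  have sa: "act s (Nom a) = Nom b" by (simp add: act_def b(1) nf_normal)
  have "perm \<pi> (act s (nf (F \<cdot> Nom a))) = nf (perm \<pi> (act s F) \<cdot> Nom (\<pi> b))"
    unfolding act_instance[OF mor_ghom[OF s] F(1) a]
    using perm_instance[OF \<pi> is_term_mor[OF s F(1)] is_term_mor[OF s a]] by (simp add: sa)
  moreover have "ntype (\<pi> b) = \<tau>" using \<pi> b(2) assms(3) by (simp add: is_perm_def)
  moreover have "\<pi> b \<notin> supp (perm \<pi> (act s F))"
    using b(3) \<pi> by (auto simp: is_perm_def bij_def dest: injD)
  ultimately show "\<exists>Ps. LG_rule (insert (fst w';; add_mset (perm \<pi> (act s (nf (F \<cdot> Nom a)))) (snd w') \<turnstile> E) Ps)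
      (fst w';; add_mset (perm \<pi> (act s (Nabla \<tau> F))) (snd w') \<turnstile> E) \<and> (\<forall>P\<in>Ps. derivable_mc_free P)"
    by (intro exI[of _ "{}"]) (simp add: act_form(10)[OF mor_ghom[OF s] assms(2)] nablaL del: supp_perm)
qed

lemma available_cps_der:
  assumes "available w B"
    and "\<And>w' s E \<pi>. mor s w w' \<Longrightarrow> is_term (fst w') E Prop \<Longrightarrow> is_perm \<pi> \<Longrightarrow>
      (\<And>w'' r. mor r w' w'' \<Longrightarrow> P w'' (cmp r s) \<Longrightarrow> der w'' (act r E)) \<Longrightarrow>
      der (ext w' (perm \<pi> (act s B))) E"
  shows "cps w P"
  unfolding cps_def
proof (intro allI impI)
  fix w' s E
  assume s: "mor s w w'" and E: "is_term (fst w') E Prop"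
    and k: "\<forall>w'' r. mor r w' w'' \<longrightarrow> P w'' (cmp r s) \<longrightarrow> der w'' (act r E)"
  show "der w' E"
    by (rule availD[OF assms(1) s E], rule assms(2)[OF s E]) (use k in auto)
qed

lemma available_cps:
  assumes "available w B" "is_term (fst w) B Prop"
    and "\<And>w' s \<pi>. mor s w w' \<Longrightarrow> is_perm \<pi> \<Longrightarrow> P (ext w' (perm \<pi> (act s B))) s"
  shows "cps w P"
proof (rule available_cps_der[OF assms(1)])
  fix w' s E \<pi>
  assume s: "mor s w w'" and E: "is_term (fst w') E Prop" and \<pi>: "is_perm \<pi>"
    and k: "\<And>w'' r. mor r w' w'' \<Longrightarrow> P w'' (cmp r s) \<Longrightarrow> der w'' (act r E)"
  show "der (ext w' (perm \<pi> (act s B))) E"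
    using k[OF mor_ext[OF mor_wf[OF s] is_term_pa[OF s \<pi> assms(2)]]] assms(3)[OF s \<pi>] E by simp
qed

lemma eigenvariable:
  assumes "wf_world w" "is_term (fst w) F (\<tau> \<rightarrow> Prop)" "o_free \<tau>"
  obtains cs n h where "lists_supp cs F" "h = (n, raised cs \<tau>)" "h \<notin> fst w"
    "wf_world (insert h (fst w), snd w)" "is_term (insert h (fst w)) (apps (Var h) (map Nom cs)) \<tau>"
proof -
  obtain cs where cs: "lists_supp cs F" using lists_supp_exists by blast
  have ty: "ntype c \<in> nominal" if "c \<in> set cs" for c
    using that cs has_type_supp assms(2) by (auto simp: lists_supp_def is_term_def)
  have "finite (fst ` fst w)" using assms(1) by (simp add: wf_world_def is_sig_def)
  then obtain n where n: "n \<notin> fst ` fst w" using ex_new_if_finite infinite_UNIV_nat by blast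
  let ?h = "(n, raised cs \<tau>)"
  have "?h \<notin> fst w" using n by force
  moreover have "wf_world (insert ?h (fst w), snd w)"
    using assms(1) o_free_raised[OF nominal_ok assms(3)] ty
    by (auto simp: wf_world_def is_sig_def is_term_def)
  moreover have "is_term (insert ?h (fst w)) (apps (Var ?h) (map Nom cs)) \<tau>"
    unfolding is_term_def
  proof (intro conjI)
    have "tyd (Var ?h) (raised cs \<tau>)" using has_type.intros(2)[of "[]" ?h] by simp
    then show "tyd (apps (Var ?h) (map Nom cs)) \<tau>" using ty by (rule tyd_apps_Nom)
  qed (auto simp: normal_apps)
  ultimately show ?thesis using that cs by blast
qed

section \<open>From forcing to derivability\<close>

lemma der_id:
  assumes "X \<in># snd w" "eqv C X" "wf_world w" "is_term (fst w) C Prop"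
  shows "der w C"
proof -
  obtain \<pi> where \<pi>: "is_perm \<pi>" "perm \<pi> C = X" using assms(2) by (auto simp: eqv_def)
  obtain \<Gamma> where "snd w = add_mset X \<Gamma>" using assms(1) by (metis mset_add)
  then show ?thesis
    using id_perm[OF is_perm_id(1) \<pi>(1), of X C "fst w" \<Gamma>] \<pi>(2)
    by (intro der_rule[of "{}"]) (auto simp: tm.map_id assms(3,4))
qed

text \<open>The modality is run with the goal \<open>B\<close> itself as the answer.\<close>

lemma der_of_cps:
  assumes "cps w P" "wf_world w" "is_term (fst w) B Prop" "\<And>w' s. mor s w w' \<Longrightarrow> P w' s \<Longrightarrow> der w' (act s B)"
  shows "der w B"
proof -
  have "der w' (act r B)" if r: "mor r w w'" "P w' (cmp r id)" for w' r
    using assms(4)[OF mor_cmp[OF mor_id[OF assms(2)] r(1) assms(2)] r(2)] by (simp add: act_cmp_id)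
  then show ?thesis using assms(1,3) mor_id[OF assms(2)] unfolding cps_def by blast
qed

text \<open>In the case of an implication the antecedent is added to the world and has to be forced
  there. Its level is less than \<open>n\<close>, so this demand falls on \<open>R\<close>, and
  reflection is presupposed for lower levels only.\<close>

lemma reify_frc:
  assumes "frc R w B" "wf_world w" "is_term (fst w) B Prop" "lev B \<le> n"
    and R: "\<And>w B. wf_world w \<Longrightarrow> is_term (fst w) B Prop \<Longrightarrow> lev B < n \<Longrightarrow> available w B \<Longrightarrow> R w B"
  shows "der w B"
  using assms(1-4)
proof (induction rule: frc.induct)
  case (frc_bot w)
  then show ?case unfolding cps_def using mor_id by blast
next
  case (frc_top w)
  show ?case by (rule der_rule[OF topR]) (use frc_top in auto)
next
  case (frc_conj w B C)
  then have "der w B" "der w C" by (simp_all add: is_term_const_iff level_simps)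
  then show ?case by (intro der_rule[OF andR]) (use frc_conj.prems in \<open>auto simp: der_def\<close>)
next
  case (frc_disj w B C)
  have t: "is_term (fst w) B Prop" "is_term (fst w) C Prop" "lev B \<le> n" "lev C \<le> n"
    using frc_disj.prems by (simp_all add: is_term_const_iff level_simps)
  note sg = wf_world_sig[OF frc_disj.prems(1)]
  have "der w' (act s (Disj B C))" if s: "mor s w w'"
    and d: "(frc R w' (act s B) \<and> (wf_world w' \<longrightarrow> is_term (fst w') (act s B) Prop \<longrightarrow> lev (act s B) \<le> n \<longrightarrow> der w' (act s B))) \<or>
     (frc R w' (act s C) \<and> (wf_world w' \<longrightarrow> is_term (fst w') (act s C) Prop \<longrightarrow> lev (act s C) \<le> n \<longrightarrow> der w' (act s C)))" for w' s
  proof -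
    note wf = mor_wf[OF s] and eq = act_form(5)[OF mor_ghom[OF s] frc_disj.prems(2)]
    have T: "is_term (fst w') (Disj (act s B) (act s C)) Prop" using is_term_mor[OF s frc_disj.prems(2)] eq by simp
    from d have "der w' (act s B) \<or> der w' (act s C)"
      using wf is_term_mor[OF s] t lev_act[OF mor_ghom[OF s] sg] by auto
    then show ?thesis unfolding eq
      using der_rule[OF orR1 wf T] der_rule[OF orR2 wf T] by (auto simp: der_def)
  qed
  then show ?case by (intro der_of_cps[OF frc_disj.IH frc_disj.prems(1,2)]) blast
next
  case (frc_imp w B C)
  have t: "is_term (fst w) B Prop" "is_term (fst w) C Prop" "lev B < n" "lev C \<le> n"
    using frc_imp.prems by (simp_all add: is_term_const_iff level_simps)
  let ?w = "ext w B"
  have wf: "wf_world ?w" by (rule wf_ext[OF frc_imp.prems(1) t(1)])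
  have "R ?w (act id B)"
    by (rule R) (use wf t available_context[of B ?w B] in auto)
  from frc_imp.IH[OF mor_ext[OF frc_imp.prems(1) t(1)] this wf]
  have "der ?w C" using t by simp
  then show ?case by (intro der_rule[OF impR]) (use frc_imp.prems in \<open>auto simp: der_def\<close>)
next
  case (frc_all w \<tau> F)
  have t: "is_term (fst w) F (\<tau> \<rightarrow> Prop)" "o_free \<tau>" using frc_all.prems by (simp_all add: is_term_const_iff)
  obtain cs m h where h: "lists_supp cs F" "h = (m, raised cs \<tau>)" "h \<notin> fst w"
    "wf_world (insert h (fst w), snd w)" "is_term (insert h (fst w)) (apps (Var h) (map Nom cs)) \<tau>"
    using eigenvariable[OF frc_all.prems(1) t] .
  let ?w = "(insert h (fst w), snd w)"
  have m: "mor id w ?w" by (rule mor_weaken) (use h frc_all.prems in auto)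
  have F': "is_term (fst ?w) (act id F) (\<tau> \<rightarrow> Prop)" by (rule is_term_mor[OF m t(1)])
  \<comment> \<open>\<open>frc_all\<close> ranges over all terms, those with nominal constants
    included, hence over the raised eigenvariable applied to \<open>cs\<close>.\<close>
  have "der ?w (nf (act id F \<cdot> apps (Var h) (map Nom cs)))"
    using frc_all.IH[OF m _ h(4) is_term_nf_App[OF F']] h(5) frc_all.prems(3)
      lev_mor_instance[OF frc_all.prems(1,2) _ t(1) m] by simp
  then show ?case
    by (intro der_rule[OF allR[OF h(1,2,3)]]) (use frc_all.prems t in \<open>auto simp: der_def\<close>)
next
  case (frc_ex w \<tau> F)
  have t: "is_term (fst w) F (\<tau> \<rightarrow> Prop)" "o_free \<tau>" using frc_ex.prems by (simp_all add: is_term_const_iff)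
  have "der w' (act s (Exists \<tau> F))" if s: "mor s w w'" and u: "is_term (fst w') u \<tau>"
    and d: "wf_world w' \<longrightarrow> is_term (fst w') (nf (act s F \<cdot> u)) Prop \<longrightarrow> lev (nf (act s F \<cdot> u)) \<le> n \<longrightarrow> der w' (nf (act s F \<cdot> u))"
    for w' s u
  proof -
    have "der w' (nf (act s F \<cdot> u))"
      using d mor_wf[OF s] is_term_nf_App[OF is_term_mor[OF s t(1)] u] frc_ex.prems(3)
        lev_mor_instance[OF frc_ex.prems(1,2) _ t(1) s u] by simp
    moreover have eq: "act s (Exists \<tau> F) = Exists \<tau> (act s F)" by (rule act_form(9)[OF mor_ghom[OF s] frc_ex.prems(2)])
    ultimately show ?thesis
      using der_rule[OF exR[OF u] mor_wf[OF s]] is_term_mor[OF s frc_ex.prems(2)] by (auto simp: der_def)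
  qed
  then show ?case by (intro der_of_cps[OF frc_ex.IH frc_ex.prems(1,2)]) blast
next
  case (frc_nabla a \<tau> F w)
  have t: "is_term (fst w) F (\<tau> \<rightarrow> Prop)" "\<tau> \<in> nominal" using frc_nabla.prems by (simp_all add: is_term_const_iff)
  then have a: "is_term (fst w) (Nom a) \<tau>" using frc_nabla.hyps(1) is_term_Nom by auto
  have "der w (nf (F \<cdot> Nom a))"
    using frc_nabla.IH[OF frc_nabla.prems(1) is_term_nf_App[OF t(1) a]] frc_nabla.prems(3)
      lev_mor_instance[OF frc_nabla.prems(1,2) _ t(1) mor_id[OF frc_nabla.prems(1)] a] t(1) by simp
  then show ?case
    by (intro der_rule[OF nablaR[OF frc_nabla.hyps(1,2)]]) (use frc_nabla.prems in \<open>auto simp: der_def\<close>)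
next
  case (frc_eq w t u \<tau>)
  have "der w' (act s (Eq \<tau> t u))" if s: "mor s w w'" and eq: "act s t = act s u" for w' s
  proof -
    have "act s (Eq \<tau> t u) = Eq \<tau> (act s u) (act s u)"
      using act_form(7)[OF mor_ghom[OF s] frc_eq.prems(2)] eq by simp
    then show ?thesis
      using der_rule[OF eqR mor_wf[OF s]] is_term_mor[OF s frc_eq.prems(2)] by simp
  qed
  then show ?case by (intro der_of_cps[OF frc_eq.hyps frc_eq.prems(1,2)]) blast
next
  case (frc_atom A p w)
  have lA: "lev A = lvl p"
    using frc_atom.hyps(1) head_apps_exists[of A] by (metis level_simps(1))
  have "der w' (act s A)" if s: "mor s w w'" and d: "(\<exists>X\<in>#snd w'. eqv (act s A) X) \<or>
      (\<exists>xs B ts. act s A = Atom p ts \<and> clause p = Some (xs, B) \<and> length ts = length xs \<and>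
        frc R w' (inst B xs ts) \<and> (wf_world w' \<longrightarrow> is_term (fst w') (inst B xs ts) Prop \<longrightarrow>
          lev (inst B xs ts) \<le> n \<longrightarrow> der w' (inst B xs ts)))" for w' s
    using d
  proof (elim disjE bexE exE conjE)
    fix X assume X: "X \<in># snd w'" "eqv (act s A) X"
    then show ?thesis by (rule der_id[OF _ _ mor_wf[OF s] is_term_mor[OF s frc_atom.prems(2)]])
  next
    fix xs B ts
    assume A: "act s A = Atom p ts" and c: "clause p = Some (xs, B)" "length ts = length xs"
      and IH: "wf_world w' \<longrightarrow> is_term (fst w') (inst B xs ts) Prop \<longrightarrow> lev (inst B xs ts) \<le> n \<longrightarrow> der w' (inst B xs ts)"
    have T: "is_term (fst w') (Atom p ts) Prop" using is_term_mor[OF s frc_atom.prems(2)] A by simp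
    then have "der w' (inst B xs ts)"
      using IH mor_wf[OF s] inst_is_term[OF c(1)] inst_level[OF c(1)] lA frc_atom.prems(3) by fastforce
    then show ?thesis unfolding A
      by (intro der_rule[OF defR[OF c]]) (auto simp: der_def mor_wf[OF s] T)
  qed
  then show ?case by (intro der_of_cps[OF frc_atom.IH frc_atom.prems(1,2)]) blast
next
  case (frc_nat w I)
  have t: "is_term (fst w) I Nt" using frc_nat.prems by (simp add: is_term_const_iff)
  have "der w' (act s (NatP I))" if s: "mor s w w'" and d: "(\<exists>X\<in>#snd w'. eqv (NatP (act s I)) X) \<or> act s I = Zero \<or>
      (\<exists>J. act s I = Succ J \<and> frc R w' (NatP J) \<and> (wf_world w' \<longrightarrow> is_term (fst w') (NatP J) Prop \<longrightarrow> lev (NatP J) \<le> n \<longrightarrow> der w' (NatP J)))"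
    for w' s
  proof -
    have eq: "act s (NatP I) = NatP (act s I)" by (rule act_form(11)[OF mor_ghom[OF s] frc_nat.prems(2)])
    have T: "is_term (fst w') (NatP (act s I)) Prop" using is_term_mor[OF s frc_nat.prems(2)] eq by simp
    show ?thesis unfolding eq using d
    proof (elim disjE bexE exE conjE)
      fix X assume X: "X \<in># snd w'" "eqv (NatP (act s I)) X"
      then show "der w' (NatP (act s I))" by (rule der_id[OF _ _ mor_wf[OF s] T])
    next
      assume "act s I = Zero"
      then show "der w' (NatP (act s I))"
        using T der_rule[OF natR_zero mor_wf[OF s]] by auto
    next
      fix J assume J: "act s I = Succ J" and IH: "wf_world w' \<longrightarrow> is_term (fst w') (NatP J) Prop \<longrightarrow> lev (NatP J) \<le> n \<longrightarrow> der w' (NatP J)"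
      have "is_term (fst w') (NatP J) Prop" using T J by (simp add: is_term_const_iff)
      then have "der w' (NatP J)" using IH mor_wf[OF s] frc_nat.prems(3) by simp
      then show "der w' (NatP (act s I))" unfolding J
        by (intro der_rule[OF natR_succ]) (use T J mor_wf[OF s] in \<open>auto simp: der_def\<close>)
    qed
  qed
  then show ?case by (intro der_of_cps[OF frc_nat.IH frc_nat.prems(1,2)]) blast
qed

section \<open>Unifiers, and reflection of available formulas\<close>

text \<open>From left to right, apply both abstractions to the nominal constants \<open>cs\<close>;
  from right to left, abstract along the reductions to the common normal form.\<close>

lemma nf_abs_noms_eq_iff:
  assumes "tyd t \<tau>" "tyd u \<tau>" "\<And>c. c \<in> set cs \<Longrightarrow> ntype c \<in> nominal"
  shows "nf (abs_noms cs t) = nf (abs_noms cs u) \<longleftrightarrow> nf t = nf u"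
proof
  have A: "nf (apps (nf (abs_noms cs t)) (map Nom cs)) = nf t" if t: "tyd t \<tau>" for t
  proof -
    have a: "tyd (abs_noms cs t) (raised cs \<tau>)" using t assms(3) by (rule tyd_abs_noms)
    then have b: "tyd (apps (abs_noms cs t) (map Nom cs)) \<tau>" using assms(3) by (rule tyd_apps_Nom)
    have "nf (apps (abs_noms cs t) (map Nom cs)) = nf t"
      by (rule nf_reds[OF b reds_apps_abs_noms[OF t assms(3)]])
    then show ?thesis
      using nf_reds[OF b reds_apps_fun[OF reds_nf[OF a]]] by simp
  qed
  assume "nf (abs_noms cs t) = nf (abs_noms cs u)"
  then show "nf t = nf u" using A[OF assms(1)] A[OF assms(2)] by simp
next
  have A: "nf (abs_noms cs t) = nf (abs_noms cs (nf t))" if t: "tyd t \<tau>" for t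
    by (rule nf_reds[OF tyd_abs_noms[OF t assms(3)] reds_abs_noms[OF reds_nf[OF t]]])
  assume "nf t = nf u"
  then show "nf (abs_noms cs t) = nf (abs_noms cs u)" using A[OF assms(1)] A[OF assms(2)] by simp
qed

lemma perm_inject: "is_perm \<pi> \<Longrightarrow> perm \<pi> t = perm \<pi> u \<longleftrightarrow> t = u"
  using perm_inv(1) by metis

lemma msubst_eq_psubst_subst:
  assumes "is_subst \<Sigma> \<theta>" "fv t \<subseteq> \<Sigma>"
  shows "msubst \<theta> t = psubst (msubst \<theta>) t"
  by (rule msubst_eq_psubst) (use assms in \<open>auto simp: is_subst_def is_term_def\<close>)

lemma khom_msubst: "is_subst \<Sigma> \<theta> \<Longrightarrow> khom \<Sigma> (subst_sig \<theta> \<Sigma>) (msubst \<theta>)"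
  unfolding khom_def ghom_def is_subst_def is_term_def by (auto intro: exI[of _ id])

lemma nf_msubst: "is_subst \<Sigma> \<theta> \<Longrightarrow> is_term \<Sigma> t \<tau> \<Longrightarrow> nf (msubst \<theta> t) = act (msubst \<theta>) t"
  by (simp add: act_def msubst_eq_psubst_subst[symmetric] is_term_def)

text \<open>The values of \<theta> contain no nominal constants, so the abstractions capture nothing
  and the side condition of \<open>eqL\<close> is plain unification.\<close>

lemma unify_abs_noms_iff:
  assumes "is_subst \<Sigma> \<theta>" "is_term \<Sigma> t \<tau>" "is_term \<Sigma> u \<tau>" "\<And>c. c \<in> set cs \<Longrightarrow> ntype c \<in> nominal"
  shows "nf (msubst \<theta> (abs_noms cs t)) = nf (msubst \<theta> (abs_noms cs u)) \<longleftrightarrow>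
    act (msubst \<theta>) t = act (msubst \<theta>) u"
proof -
  have A: "msubst \<theta> (abs_noms cs t) = abs_noms cs (psubst (msubst \<theta>) t)" if "is_term \<Sigma> t \<tau>" for t
  proof -
    have "msubst \<theta> (abs_noms cs t) = psubst (msubst \<theta>) (abs_noms cs t)"
      by (rule msubst_eq_psubst_subst[OF assms(1)]) (use that in \<open>auto simp: is_term_def\<close>)
    also have "\<dots> = abs_noms cs (psubst (msubst \<theta>) t)"
      by (rule psubst_abs_noms[of _ \<tau>]) (use that assms(1,4) in \<open>auto simp: is_term_def is_subst_def\<close>)
    finally show ?thesis .
  qed
  have T: "tyd (psubst (msubst \<theta>) t) \<tau>" if "is_term \<Sigma> t \<tau>" for t
    by (rule tyd_psubst[OF _ _ ghom_tsub[OF khom_ghom[OF khom_msubst[OF assms(1)]]]])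
      (use that in \<open>auto simp: is_term_def\<close>)
  show ?thesis
    unfolding A[OF assms(2)] A[OF assms(3)] act_def
    by (rule nf_abs_noms_eq_iff[OF T[OF assms(2)] T[OF assms(3)] assms(4)])
qed

lemma lists_supp_nominal:
  "lists_supp cs t \<Longrightarrow> tyd t \<tau> \<Longrightarrow> c \<in> set cs \<Longrightarrow> ntype c \<in> nominal"
  using has_type_supp by (auto simp: lists_supp_def)

text \<open>Every premise of \<open>eqL\<close> is a world reached by a morphism, and the
  continuation of \<open>cps\<close> can be called there.\<close>

lemma mor_msubst:
  assumes "is_subst (fst w) \<theta>" "wf_world w"
  shows "mor (msubst \<theta>) w (subst_sig \<theta> (fst w), image_mset (\<lambda>B. nf (msubst \<theta> B)) (snd w))"
    (is "mor _ _ ?w")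
proof -
  have eq: "nf (msubst \<theta> B) = act (msubst \<theta>) B" if "B \<in># snd w" for B
    using nf_msubst[OF assms(1)] assms(2) that by (auto simp: wf_world_def)
  have "wf_world ?w"
    using assms eq is_term_act[OF khom_ghom[OF khom_msubst[OF assms(1)]]]
    by (auto simp: wf_world_def is_subst_def)
  then show ?thesis
    unfolding mor_def using khom_msubst[OF assms(1)] eq by (fastforce intro: eqv_refl)
qed

text \<open>Reflecting an implication reifies its antecedent, and reifying one reflects its
  antecedent; the antecedent has a lower level, so \<open>reify\<close> can close the loop by
  induction on levels. Within a level the induction is on the number of connectives. Clause bodies
  never enter, since an available atom is forced as an assumption and not by unfolding.\<close>

lemma reflect:
  assumes "\<And>w B. wf_world w \<Longrightarrow> is_term (fst w) B Prop \<Longrightarrow> lev B < l \<Longrightarrow> forces w B \<Longrightarrow> der w B"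
    and "wf_world w" "is_term (fst w) B Prop" "lev B \<le> l" "available w B"
  shows "forces w B"
  using assms(2-5)
proof (induction "fsize B" arbitrary: w B rule: less_induct)
  case less
  note wf = less.prems(1) and tB = less.prems(2)
  \<comment> \<open>A left rule leaves a renamed copy of the component in its premise. There the
    component is available as an assumption, hence forced by the induction hypothesis.\<close>
  have sub: "forces (ext w' (perm \<pi> A)) A"
    if "mor s w w'" "fsize A < fsize B" "is_term (fst w') A Prop" "lev A \<le> l" "is_perm \<pi>" for w' s A \<pi>
  proof (rule less.hyps[OF that(2) _ _ that(4)])
    show wfe: "wf_world (ext w' (perm \<pi> A))"
      by (intro wf_ext mor_wf[OF that(1)] is_term_perm that)
    show "is_term (fst (ext w' (perm \<pi> A))) A Prop" using that by simp
    show "available (ext w' (perm \<pi> A)) A"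
      by (rule available_context[OF _ eqv_perm[OF that(5)] wfe]) (use that in auto)
  qed
  from wf_world_sig[OF wf] tB show ?case
  proof (cases rule: formula_cases)
    case (atom p)
    show ?thesis
      unfolding forces_atom_iff[OF wf tB atom]
      by (rule available_cps[OF less.prems(4) tB]) (auto simp: unfolds_def intro: eqv_perm)
  next
    case bot
    show ?thesis
      unfolding bot forces_bot_iff
    proof (rule available_cps_der[OF less.prems(4)])
      fix w' s E \<pi>
      assume s: "mor s w w'" and E: "is_term (fst w') E Prop" and \<pi>: "is_perm \<pi>"
      show "der (ext w' (perm \<pi> (act s B))) E"
        by (rule der_ext_rule[of "{}", OF _ mor_wf[OF s] is_term_pa[OF s \<pi> tB] E])
          (auto simp: bot act_form(1)[OF mor_ghom[OF s]] intro: botL)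
    qed
  next
    case top
    then show ?thesis by (simp add: forces_top)
  next
    case (conj B1 B2)
    note t = tB[unfolded conj]
    show ?thesis
      unfolding conj forces_conj_iff[OF wf t]
      using less.hyps[of B1] less.hyps[of B2] fsize_less(1)[OF wf_world_sig[OF wf] t] conj wf less.prems(3)
        available_conj[OF less.prems(4)[unfolded conj] t] t
      by (simp add: is_term_const_iff level_simps)
  next
    case (disj B1 B2)
    note t = tB[unfolded disj]
    have t': "is_term (fst w) B1 Prop" "is_term (fst w) B2 Prop" "lev B1 \<le> l" "lev B2 \<le> l"
      using t less.prems(3) disj by (simp_all add: is_term_const_iff level_simps)
    show ?thesis
      unfolding disj forces_disj_iff[OF wf t]
    proof (rule available_cps_der[OF less.prems(4)])
      fix w' s E \<pi>
      assume s: "mor s w w'" and E: "is_term (fst w') E Prop" and \<pi>: "is_perm \<pi>"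
        and k: "\<And>w'' r. mor r w' w'' \<Longrightarrow> forces w'' (act (cmp r s) B1) \<or> forces w'' (act (cmp r s) B2) \<Longrightarrow> der w'' (act r E)"
      have D: "der (ext w' (perm \<pi> (act s A))) E" if "A = B1 \<or> A = B2" for A
      proof -
        have A: "is_term (fst w) A Prop" "lev A \<le> l" "fsize A < fsize B"
          using that t' fsize_less(2)[OF wf_world_sig[OF wf] t] disj by auto
        have "forces (ext w' (perm \<pi> (act s A))) (act s A)"
          using A(2,3) lev_act[OF mor_ghom[OF s] wf_world_sig[OF wf] A(1)] fsize_act[OF s wf A(1)]
          by (intro sub[OF s _ is_term_mor[OF s A(1)] _ \<pi>]) auto
        then show ?thesis
          using k mor_ext[OF mor_wf[OF s] is_term_pa[OF s \<pi> A(1)]] E that by (metis act_id cmp_id)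
      qed
      have eq: "perm \<pi> (act s B) = Disj (perm \<pi> (act s B1)) (perm \<pi> (act s B2))"
        unfolding disj by (simp add: act_form(5)[OF mor_ghom[OF s] t])
      show "der (ext w' (perm \<pi> (act s B))) E"
      proof (rule der_ext_rule[OF _ mor_wf[OF s] is_term_pa[OF s \<pi> tB] E])
        show "LG_rule {fst w';; add_mset (perm \<pi> (act s B1)) (snd w') \<turnstile> E,
              fst w';; add_mset (perm \<pi> (act s B2)) (snd w') \<turnstile> E}
            (fst w';; add_mset (perm \<pi> (act s B)) (snd w') \<turnstile> E)"
          unfolding eq by (rule orL)
      qed (use D in \<open>auto simp: der_def\<close>)
    qed
  next
    case (imp B1 B2)
    note t = tB[unfolded imp]
    have t': "is_term (fst w) B1 Prop" "is_term (fst w) B2 Prop" "lev B1 < l" "lev B2 \<le> l"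
      using t less.prems(3) imp by (simp_all add: is_term_const_iff level_simps)
    show ?thesis
      unfolding imp forces_imp_iff[OF wf t]
    proof (intro allI impI)
      fix w' s
      assume s: "mor s w w'" and B1: "forces w' (act s B1)"
      note s1 = is_term_mor[OF s t'(1)] and s2 = is_term_mor[OF s t'(2)]
      show "forces w' (act s B2)"
      proof (rule less.hyps[OF _ mor_wf[OF s] s2])
        show "fsize (act s B2) < fsize B"
          using fsize_act[OF s wf t'(2)] fsize_less(3)[OF wf_world_sig[OF wf] t] imp by simp
        show "lev (act s B2) \<le> l" using lev_act[OF mor_ghom[OF s] wf_world_sig[OF wf] t'(2)] t' by simp
        have av: "available w' (Imp (act s B1) (act s B2))"
          using available_mor[OF less.prems(4) wf tB s] act_form(6)[OF mor_ghom[OF s] t] imp by simp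
        show "available w' (act s B2)"
        proof (rule available_imp[OF av])
          show "is_term (fst w') (Imp (act s B1) (act s B2)) Prop" using s1 s2 by (simp add: is_term_const_iff)
          fix w'' r \<pi>
          assume r: "mor r w' w''" and \<pi>: "is_perm \<pi>"
          note rs1 = is_term_mor[OF r s1]
          have "forces w'' (perm \<pi> (act r (act s B1)))"
            by (intro forces_perm forces_mor[OF B1 mor_wf[OF s] s1 r] mor_wf[OF r] rs1 \<pi>)
          moreover have "lev (perm \<pi> (act r (act s B1))) < l"
            using lev_act[OF mor_ghom[OF s] wf_world_sig[OF wf] t'(1)]
              lev_act[OF mor_ghom[OF r] wf_world_sig[OF mor_wf[OF s]] s1]
              lev_act[OF khom_ghom[OF khom_perm[OF \<pi>]] wf_world_sig[OF mor_wf[OF r]] rs1] act_perm[OF \<pi> rs1] t'(3) by simp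
          ultimately show "der w'' (perm \<pi> (act r (act s B1)))"
            using assms(1)[OF mor_wf[OF r] is_term_perm[OF \<pi> rs1]] by simp
        qed
      qed
    qed
  next
    case (all \<tau> F)
    note t = tB[unfolded all]
    have F: "is_term (fst w) F (\<tau> \<rightarrow> Prop)" using t by (simp add: is_term_const_iff)
    show ?thesis
      unfolding all forces_all_iff[OF wf t]
    proof (intro allI impI)
      fix w' s u
      assume s: "mor s w w'" and u: "is_term (fst w') u \<tau>"
      note sF = is_term_mor[OF s F]
      have eq: "act s B = Forall \<tau> (act s F)" using act_form(8)[OF mor_ghom[OF s] t] all by simp
      have sB: "is_term (fst w') (Forall \<tau> (act s F)) Prop" using is_term_mor[OF s tB] eq by simp
      show "forces w' (nf (act s F \<cdot> u))"
      proof (rule less.hyps[OF _ mor_wf[OF s] is_term_nf_App[OF sF u]])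
        show "fsize (nf (act s F \<cdot> u)) < fsize B"
          using fsize_instance[OF mor_wf[OF s] sB _ sF u] fsize_act[OF s wf tB] eq by simp
        show "lev (nf (act s F \<cdot> u)) \<le> l"
          using lev_mor_instance[OF wf t _ F s u] less.prems(3) all by simp
        show "available w' (nf (act s F \<cdot> u))"
          using available_all[OF _ sB u] available_mor[OF less.prems(4) wf tB s] eq by simp
      qed
    qed
  next
    case (ex \<tau> F)
    note t = tB[unfolded ex]
    have F: "is_term (fst w) F (\<tau> \<rightarrow> Prop)" "o_free \<tau>" using t by (simp_all add: is_term_const_iff)
    show ?thesis
      unfolding ex forces_ex_iff[OF wf t]
    proof (rule available_cps_der[OF less.prems(4)])
      fix w' s E \<pi>
      assume s: "mor s w w'" and E: "is_term (fst w') E Prop" and \<pi>: "is_perm \<pi>"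
        and k: "\<And>w'' r. mor r w' w'' \<Longrightarrow>
          \<exists>t. is_term (fst w'') t \<tau> \<and> forces w'' (nf (act (cmp r s) F \<cdot> t)) \<Longrightarrow> der w'' (act r E)"
      note sF = is_term_mor[OF s F(1)]
      let ?F = "perm \<pi> (act s F)"
      have eq: "perm \<pi> (act s B) = Exists \<tau> ?F"
        unfolding ex by (simp add: act_form(9)[OF mor_ghom[OF s] t])
      have sB: "is_term (fst w') (Exists \<tau> (act s F)) Prop" "act s B = Exists \<tau> (act s F)"
        using is_term_mor[OF s t] act_form(9)[OF mor_ghom[OF s] t] ex by auto
      have pF: "is_term (fst w') ?F (\<tau> \<rightarrow> Prop)" by (rule is_term_perm[OF \<pi> sF])
      obtain cs m h where h: "lists_supp cs ?F" "h = (m, raised cs \<tau>)" "h \<notin> fst w'"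
        "wf_world (insert h (fst w'), snd w')" "is_term (insert h (fst w')) (apps (Var h) (map Nom cs)) \<tau>"
        using eigenvariable[OF mor_wf[OF s] pF F(2)] .
      let ?w = "(insert h (fst w'), snd w')" and ?u = "apps (Var h) (map Nom cs)"
      \<comment> \<open>\<open>exL\<close> is applied to the formula renamed by \<pi>, and its
        eigenvariable term \<open>?u\<close> is a witness for that one. Renaming back gives the
        witness for \<open>act s F\<close>.\<close>
      let ?v = "perm (inv \<pi>) ?u"
      have m: "mor id w' ?w" by (rule mor_weaken) (use h(4) mor_wf[OF s] in auto)
      have v: "is_term (fst ?w) ?v \<tau>" using is_term_perm[OF is_perm_inv[OF \<pi>]] h(5) by simp
      have F1: "is_term (fst ?w) (act s F) (\<tau> \<rightarrow> Prop)" using is_term_mor[OF m sF] sF by simp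
      have vF: "is_term (fst ?w) (nf (act s F \<cdot> ?v)) Prop" by (rule is_term_nf_App[OF F1 v])
      have pv: "perm \<pi> (nf (act s F \<cdot> ?v)) = nf (?F \<cdot> ?u)"
        using perm_instance[OF \<pi> F1 v] unfolding perm_inv(2)[OF \<pi>] .
      have ms: "mor s w ?w" using mor_cmp[OF s m wf] by simp
      have "forces (ext ?w (perm \<pi> (nf (act s F \<cdot> ?v)))) (nf (act s F \<cdot> ?v))"
      proof (rule sub[OF ms _ vF _ \<pi>])
        have "is_term (fst ?w) (Exists \<tau> (act s F)) Prop"
          using sB(1) F1 by (simp add: is_term_const_iff)
        then show "fsize (nf (act s F \<cdot> ?v)) < fsize B"
          using fsize_instance[of ?w "CEx \<tau>", OF h(4) _ _ F1 v] fsize_act[OF s wf tB] sB(2) by simp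
        show "lev (nf (act s F \<cdot> ?v)) \<le> l"
          using lev_mor_instance[OF wf t _ F(1) ms v] less.prems(3) ex by simp
      qed
      then have *: "forces (ext ?w (nf (?F \<cdot> ?u))) (nf (act s F \<cdot> ?v))" by (simp add: pv)
      have "mor id w' (ext ?w (nf (?F \<cdot> ?u)))"
      proof (rule mor_weaken[OF mor_wf[OF s]])
        show "wf_world (ext ?w (nf (?F \<cdot> ?u)))"
          using wf_ext[OF h(4) is_term_perm[OF \<pi> vF]] by (simp add: pv)
      qed auto
      moreover have "\<exists>t. is_term (fst (ext ?w (nf (?F \<cdot> ?u)))) t \<tau> \<and>
          forces (ext ?w (nf (?F \<cdot> ?u))) (nf (act (cmp id s) F \<cdot> t))"
        using * v by auto
      ultimately have D: "der (ext ?w (nf (?F \<cdot> ?u))) E" using k E by (metis act_id)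
      show "der (ext w' (perm \<pi> (act s B))) E"
      proof (rule der_ext_rule[OF _ mor_wf[OF s] is_term_pa[OF s \<pi> tB] E])
        show "LG_rule {insert h (fst w');; add_mset (nf (?F \<cdot> ?u)) (snd w') \<turnstile> E}
            (fst w';; add_mset (perm \<pi> (act s B)) (snd w') \<turnstile> E)"
          unfolding eq by (rule exL[OF h(1,2,3)])
      qed (use D in \<open>auto simp: der_def\<close>)
    qed
  next
    case (nabla \<tau> F)
    note t = tB[unfolded nabla]
    have F: "is_term (fst w) F (\<tau> \<rightarrow> Prop)" "\<tau> \<in> nominal" using t by (simp_all add: is_term_const_iff)
    obtain a where a: "ntype a = \<tau>" "a \<notin> supp F" using fresh_nominal[OF nominal_ok F(2) finite_supp] .
    have n: "is_term (fst w) (Nom a) \<tau>" using is_term_Nom[of a] a(1) F(2) by simp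
    show ?thesis
      unfolding nabla forces_nabla_iff[OF wf t a]
    proof (rule less.hyps[OF _ wf is_term_nf_App[OF F(1) n]])
      show "fsize (nf (F \<cdot> Nom a)) < fsize B" using fsize_instance[OF wf t _ F(1) n] nabla by simp
      show "lev (nf (F \<cdot> Nom a)) \<le> l"
        using lev_mor_instance[OF wf t _ F(1) mor_id[OF wf] n] less.prems(3) nabla F(1) by simp
      show "available w (nf (F \<cdot> Nom a))" using available_nabla[OF _ t a] less.prems(4) nabla by simp
    qed
  next
    case (nat I)
    show ?thesis
      unfolding nat forces_nat_iff
    proof (rule available_cps[OF less.prems(4) tB])
      fix w' s \<pi> assume s: "mor s w w'" and \<pi>: "is_perm \<pi>"
      have "act s B = NatP (act s I)" using act_form(11)[OF mor_ghom[OF s] tB[unfolded nat]] nat by simp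
      then show "nat_unfolds (ext w' (perm \<pi> (act s B))) (act s I)"
        using eqv_perm[OF \<pi>, of "act s B"] by (simp add: nat_unfolds_def)
    qed
  next
    case (eq \<tau> u v)
    note t = tB[unfolded eq]
    have uv: "is_term (fst w) u \<tau>" "is_term (fst w) v \<tau>" using t by (simp_all add: is_term_const_iff)
    show ?thesis
      unfolding eq forces_eq_iff
    proof (rule available_cps_der[OF less.prems(4)])
      fix w' s E \<pi>
      assume s: "mor s w w'" and E: "is_term (fst w') E Prop" and \<pi>: "is_perm \<pi>"
        and k: "\<And>w'' r. mor r w' w'' \<Longrightarrow> act (cmp r s) u = act (cmp r s) v \<Longrightarrow> der w'' (act r E)"
      note suv = is_term_mor[OF s uv(1)] is_term_mor[OF s uv(2)]
      let ?u = "perm \<pi> (act s u)" and ?v = "perm \<pi> (act s v)"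
      have eq': "perm \<pi> (act s B) = Eq \<tau> ?u ?v"
        unfolding eq by (simp add: act_form(7)[OF mor_ghom[OF s] t])
      have T: "is_term (fst w') (Eq \<tau> ?u ?v) Prop" using is_term_pa[OF s \<pi> tB] eq' by simp
      then have T': "is_term (fst w') ?u \<tau>" "is_term (fst w') ?v \<tau>" by (simp_all add: is_term_const_iff)
      obtain cs where cs: "lists_supp cs (Eq \<tau> ?u ?v)" using lists_supp_exists by blast
      have csn: "\<And>c. c \<in> set cs \<Longrightarrow> ntype c \<in> nominal"
        using lists_supp_nominal[OF cs] T by (auto simp: is_term_def)
      show "der (ext w' (perm \<pi> (act s B))) E"
      proof (rule der_ext_rule[OF _ mor_wf[OF s] is_term_pa[OF s \<pi> tB] E])
        show "LG_rule {subst_sig \<theta> (fst w');; image_mset (\<lambda>B. nf (msubst \<theta> B)) (snd w') \<turnstile> nf (msubst \<theta> E) | \<theta>.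
              is_subst (fst w') \<theta> \<and> nf (msubst \<theta> (abs_noms cs ?u)) = nf (msubst \<theta> (abs_noms cs ?v))}
            (fst w';; add_mset (perm \<pi> (act s B)) (snd w') \<turnstile> E)"
          unfolding eq' by (rule eqL[OF cs])
        fix P assume "P \<in> {subst_sig \<theta> (fst w');; image_mset (\<lambda>B. nf (msubst \<theta> B)) (snd w') \<turnstile> nf (msubst \<theta> E) | \<theta>.
              is_subst (fst w') \<theta> \<and> nf (msubst \<theta> (abs_noms cs ?u)) = nf (msubst \<theta> (abs_noms cs ?v))}"
        then obtain \<theta> where \<theta>: "is_subst (fst w') \<theta>"
          "nf (msubst \<theta> (abs_noms cs ?u)) = nf (msubst \<theta> (abs_noms cs ?v))"
          "P = (subst_sig \<theta> (fst w');; image_mset (\<lambda>B. nf (msubst \<theta> B)) (snd w') \<turnstile> nf (msubst \<theta> E))"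
          by blast
        note m = mor_msubst[OF \<theta>(1) mor_wf[OF s]]
        have "act (msubst \<theta>) ?u = act (msubst \<theta>) ?v"
          using \<theta>(2) unify_abs_noms_iff[OF \<theta>(1) T' csn] by simp
        \<comment> \<open>\<open>msubst \<theta>\<close> fixes nominal constants and \<theta> brings
          none in, so \<pi> commutes with it and can afterwards be cancelled.\<close>
        then have "perm \<pi> (act (msubst \<theta>) (act s u)) = perm \<pi> (act (msubst \<theta>) (act s v))"
          using act_perm_conj[OF khom_msubst[OF \<theta>(1)] is_perm_id(1) _ \<pi>] suv by simp
        then have "act (cmp (msubst \<theta>) s) u = act (cmp (msubst \<theta>) s) v"
          using act_cmp_mor[OF s m] uv by (simp add: perm_inject[OF \<pi>])
        then show "derivable_mc_free P"
          using k m nf_msubst[OF \<theta>(1) E] \<theta>(3) by (auto simp: der_def)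
      qed
    qed
  qed
qed

lemma reify: "wf_world w \<Longrightarrow> is_term (fst w) B Prop \<Longrightarrow> forces w B \<Longrightarrow> der w B"
proof (induction "lev B" arbitrary: w B rule: less_induct)
  case less
  have "below (lev B) w' A" if "wf_world w'" "is_term (fst w') A Prop" "lev A < lev B" "available w' A" for w' A
    using reflect[of "lev B" w' A] less.hyps below_iff_forces that by auto
  then show ?case
    using reify_frc[of "below (lev B)" w B "lev B"] less.prems by (simp add: forces_def)
qed

lemma forces_context:
  assumes "wf_world w" "B \<in># snd w"
  shows "forces w B"
proof -
  have t: "is_term (fst w) B Prop" using assms by (simp add: wf_world_def)
  show ?thesis
    by (rule reflect[OF reify assms(1) t order_refl available_context[OF assms(2) eqv_refl assms(1) t]])
qed

text \<open>Every formula is an algebra for the modality, although its answers are only derivability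
  statements. Where a clause is itself given by \<open>cps\<close>, this is \<open>cps_bind\<close>;
  conjunctions, implications, universal and nabla formulas pass to smaller formulas. It justifies
  left rules whose conclusion is arbitrary.\<close>

lemma run:
  assumes "cps w P" "wf_world w" "is_term (fst w) D Prop" "\<And>w' s. mor s w w' \<Longrightarrow> P w' s \<Longrightarrow> forces w' (act s D)"
  shows "forces w D"
  using assms
proof (induction "fsize D" arbitrary: w D P rule: less_induct)
  case less
  note wf = less.prems(2) and tD = less.prems(3)
  have bind: "cps w Q" if "\<And>w' s. mor s w w' \<Longrightarrow> forces w' (act s D) \<Longrightarrow> cps w' (\<lambda>w'' r. Q w'' (cmp r s))" for Q
    by (rule cps_bind[OF less.prems(1) wf]) (use that less.prems(4) in blast)
  from wf_world_sig[OF wf] tD show ?case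
  proof (cases rule: formula_cases)
    case (atom p)
    show ?thesis
      unfolding forces_atom_iff[OF wf tD atom]
    proof (rule bind)
      fix w' s assume s: "mor s w w'" and f: "forces w' (act s D)"
      show "cps w' (\<lambda>w'' r. unfolds w'' (act (cmp r s) D))"
        using f unfolding forces_atom_iff[OF mor_wf[OF s] is_term_mor[OF s tD] head_act[OF mor_ghom[OF s] tD atom]]
        by (subst cps_cong[OF mor_wf[OF s]]) (auto simp: act_cmp_mor[OF s _ tD])
    qed
  next
    case bot
    show ?thesis unfolding bot forces_bot_iff
      by (rule bind) (simp add: bot act_form(1)[OF mor_ghom] forces_bot_iff)
  next
    case top
    then show ?thesis by (simp add: forces_top)
  next
    case (conj B C)
    note t = tD[unfolded conj]
    have t': "is_term (fst w) B Prop" "is_term (fst w) C Prop" using t by (simp_all add: is_term_const_iff)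
    have f: "forces w' (act s B) \<and> forces w' (act s C)" if s: "mor s w w'" "P w' s" for w' s
      using less.prems(4)[OF s] forces_conj_iff[OF mor_wf[OF s(1)]] is_term_mor[OF s(1) t]
      by (simp add: conj act_form(4)[OF mor_ghom[OF s(1)] t])
    show ?thesis
      unfolding conj forces_conj_iff[OF wf t]
      using less.hyps[OF _ less.prems(1) wf t'(1)] less.hyps[OF _ less.prems(1) wf t'(2)] f
        fsize_less(1)[OF wf_world_sig[OF wf] t] conj by blast
  next
    case (disj B C)
    note t = tD[unfolded disj]
    have t': "is_term (fst w) B Prop" "is_term (fst w) C Prop" using t by (simp_all add: is_term_const_iff)
    show ?thesis
      unfolding disj forces_disj_iff[OF wf t]
    proof (rule bind)
      fix w' s assume s: "mor s w w'" and f: "forces w' (act s D)"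
      have "cps w' (\<lambda>w'' r. forces w'' (act r (act s B)) \<or> forces w'' (act r (act s C)))"
        using f forces_disj_iff[OF mor_wf[OF s]] is_term_mor[OF s t] by (simp add: disj act_form(5)[OF mor_ghom[OF s] t])
      then show "cps w' (\<lambda>w'' r. forces w'' (act (cmp r s) B) \<or> forces w'' (act (cmp r s) C))"
        by (subst cps_cong[OF mor_wf[OF s]]) (auto simp: act_cmp_mor[OF s _ t'(1)] act_cmp_mor[OF s _ t'(2)])
    qed
  next
    case (imp B C)
    note t = tD[unfolded imp]
    have t': "is_term (fst w) B Prop" "is_term (fst w) C Prop" using t by (simp_all add: is_term_const_iff)
    show ?thesis
      unfolding imp forces_imp_iff[OF wf t]
    proof (intro allI impI)
      fix w' s
      assume s: "mor s w w'" and B: "forces w' (act s B)"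
      note sB = is_term_mor[OF s t'(1)] and sC = is_term_mor[OF s t'(2)]
      show "forces w' (act s C)"
      proof (rule less.hyps[OF _ cps_mor[OF less.prems(1) wf s] mor_wf[OF s] sC])
        show "fsize (act s C) < fsize D"
          using fsize_act[OF s wf t'(2)] fsize_less(3)[OF wf_world_sig[OF wf] t] imp by simp
        fix w'' r assume r: "mor r w' w''" and P: "P w'' (cmp r s)"
        note rs = mor_cmp[OF s r wf]
        have "forces w'' (Imp (act (cmp r s) B) (act (cmp r s) C))"
          using less.prems(4)[OF rs P] by (simp add: imp act_form(6)[OF mor_ghom[OF rs] t])
        moreover have "is_term (fst w'') (Imp (act (cmp r s) B) (act (cmp r s) C)) Prop"
          using is_term_mor[OF rs t] by (simp add: act_form(6)[OF mor_ghom[OF rs] t])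
        moreover have "forces w'' (act (cmp r s) B)"
          using forces_mor[OF B mor_wf[OF s] sB r] by (simp add: act_cmp_mor[OF s r t'(1)])
        ultimately have "forces w'' (act (cmp r s) C)"
          using forces_imp_iff[OF mor_wf[OF r]] mor_id[OF mor_wf[OF r]] is_term_mor[OF rs t'(1)] is_term_mor[OF rs t'(2)]
          by (metis act_id)
        then show "forces w'' (act r (act s C))" by (simp add: act_cmp_mor[OF s r t'(2)])
      qed
    qed
  next
    case (all \<tau> F)
    note t = tD[unfolded all]
    have F: "is_term (fst w) F (\<tau> \<rightarrow> Prop)" using t by (simp add: is_term_const_iff)
    show ?thesis
      unfolding all forces_all_iff[OF wf t]
    proof (intro allI impI)
      fix w' s u
      assume s: "mor s w w'" and u: "is_term (fst w') u \<tau>"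
      note sF = is_term_mor[OF s F]
      have eq: "act s D = Forall \<tau> (act s F)" using act_form(8)[OF mor_ghom[OF s] t] all by simp
      have sB: "is_term (fst w') (Forall \<tau> (act s F)) Prop" using is_term_mor[OF s tD] eq by simp
      show "forces w' (nf (act s F \<cdot> u))"
      proof (rule less.hyps[OF _ cps_mor[OF less.prems(1) wf s] mor_wf[OF s] is_term_nf_App[OF sF u]])
        show "fsize (nf (act s F \<cdot> u)) < fsize D"
          using fsize_instance[OF mor_wf[OF s] sB _ sF u] fsize_act[OF s wf tD] eq by simp
        fix w'' r assume r: "mor r w' w''" and P: "P w'' (cmp r s)"
        note rs = mor_cmp[OF s r wf]
        have rF: "is_term (fst w'') (act r (act s F)) (\<tau> \<rightarrow> Prop)" by (rule is_term_mor[OF r sF])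
        have rB: "is_term (fst w'') (Forall \<tau> (act r (act s F))) Prop"
          using is_term_mor[OF r sB] act_form(8)[OF mor_ghom[OF r] sB] by simp
        have "forces w'' (Forall \<tau> (act r (act s F)))"
          using less.prems(4)[OF rs P] by (simp add: all act_form(8)[OF mor_ghom[OF rs] t] act_cmp_mor[OF s r F])
        then have "forces w'' (nf (act id (act r (act s F)) \<cdot> act r u))"
          using forces_all_iff[OF mor_wf[OF r] rB] mor_id[OF mor_wf[OF r]] is_term_mor[OF r u] by blast
        then show "forces w'' (act r (nf (act s F \<cdot> u)))"
          using rF act_instance[OF mor_ghom[OF r] sF u] by simp
      qed
    qed
  next
    case (ex \<tau> F)
    note t = tD[unfolded ex]
    have F: "is_term (fst w) F (\<tau> \<rightarrow> Prop)" using t by (simp add: is_term_const_iff)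
    show ?thesis
      unfolding ex forces_ex_iff[OF wf t]
    proof (rule bind)
      fix w' s assume s: "mor s w w'" and f: "forces w' (act s D)"
      have "cps w' (\<lambda>w'' r. \<exists>u. is_term (fst w'') u \<tau> \<and> forces w'' (nf (act r (act s F) \<cdot> u)))"
        using f forces_ex_iff[OF mor_wf[OF s]] is_term_mor[OF s t] by (simp add: ex act_form(9)[OF mor_ghom[OF s] t])
      then show "cps w' (\<lambda>w'' r. \<exists>u. is_term (fst w'') u \<tau> \<and> forces w'' (nf (act (cmp r s) F \<cdot> u)))"
        by (subst cps_cong[OF mor_wf[OF s]]) (auto simp: act_cmp_mor[OF s _ F])
    qed
  next
    case (nabla \<tau> F)
    note t = tD[unfolded nabla]
    have F: "is_term (fst w) F (\<tau> \<rightarrow> Prop)" "\<tau> \<in> nominal" using t by (simp_all add: is_term_const_iff)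
    obtain a where a: "ntype a = \<tau>" "a \<notin> supp F" using fresh_nominal[OF nominal_ok F(2) finite_supp] .
    have n: "is_term (fst w) (Nom a) \<tau>" using is_term_Nom[of a] a(1) F(2) by simp
    show ?thesis
      unfolding nabla forces_nabla_iff[OF wf t a]
    proof (rule less.hyps[OF _ less.prems(1) wf is_term_nf_App[OF F(1) n]])
      show "fsize (nf (F \<cdot> Nom a)) < fsize D" using fsize_instance[OF wf t _ F(1) n] nabla by simp
      fix w' s assume s: "mor s w w'" and P: "P w' s"
      obtain b where b: "s (Nom a) = Nom b" "ntype b = ntype a" "b \<notin> supp (act s F)"
        using act_fresh[OF s F(1) a(2)] .
      have sa: "act s (Nom a) = Nom b" by (simp add: act_def b(1) nf_normal)
      have eq: "act s D = Nabla \<tau> (act s F)" using act_form(10)[OF mor_ghom[OF s] t] nabla by simp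
      have "forces w' (nf (act s F \<cdot> Nom b))"
        using less.prems(4)[OF s P] forces_nabla_iff[OF mor_wf[OF s], of \<tau> "act s F" b] is_term_mor[OF s tD] b a(1) eq by simp
      then show "forces w' (act s (nf (F \<cdot> Nom a)))" using act_instance[OF mor_ghom[OF s] F(1) n] sa by simp
    qed
  next
    case (nat I)
    note t = tD[unfolded nat]
    have I: "is_term (fst w) I Nt" using t by (simp add: is_term_const_iff)
    show ?thesis
      unfolding nat forces_nat_iff
    proof (rule bind)
      fix w' s assume s: "mor s w w'" and f: "forces w' (act s D)"
      have "cps w' (\<lambda>w'' r. nat_unfolds w'' (act r (act s I)))"
        using f by (simp add: nat act_form(11)[OF mor_ghom[OF s] t] forces_nat_iff)
      then show "cps w' (\<lambda>w'' r. nat_unfolds w'' (act (cmp r s) I))"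
        by (subst cps_cong[OF mor_wf[OF s]]) (auto simp: act_cmp_mor[OF s _ I])
    qed
  next
    case (eq \<tau> u v)
    note t = tD[unfolded eq]
    have uv: "is_term (fst w) u \<tau>" "is_term (fst w) v \<tau>" using t by (simp_all add: is_term_const_iff)
    show ?thesis
      unfolding eq forces_eq_iff
    proof (rule bind)
      fix w' s assume s: "mor s w w'" and f: "forces w' (act s D)"
      have "cps w' (\<lambda>w'' r. act r (act s u) = act r (act s v))"
        using f by (simp add: eq act_form(7)[OF mor_ghom[OF s] t] forces_eq_iff)
      then show "cps w' (\<lambda>w'' r. act (cmp r s) u = act (cmp r s) v)"
        by (subst cps_cong[OF mor_wf[OF s]]) (auto simp: act_cmp_mor[OF s _ uv(1)] act_cmp_mor[OF s _ uv(2)])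
    qed
  qed
qed

section \<open>Soundness of the calculus with multicut\<close>

text \<open>\<theta> is shared by all formulas of a sequent, whereas \<pi> is chosen anew for each
  of them.\<close>

definition vsub :: "('b var \<Rightarrow> ('b, 'k, 'n) tm) \<Rightarrow> ('n \<Rightarrow> 'n) \<Rightarrow> ('b, 'k, 'n) subst" where
  "vsub \<theta> \<pi> a = (case a of Var x \<Rightarrow> \<theta> x | Nom a \<Rightarrow> Nom (\<pi> a) | _ \<Rightarrow> a)"

lemma vsub_simps [simp]:
  "vsub \<theta> \<pi> (Bound i) = Bound i" "vsub \<theta> \<pi> (Var x) = \<theta> x" "vsub \<theta> \<pi> (Nom a) = Nom (\<pi> a)"
  by (simp_all add: vsub_def)

text \<open>The values are typed terms and not normal forms: \<open>act\<close> normalizes at the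
  end, so that \<open>cmp_val\<close> and the abstractions of \<open>holds_eigen_iff\<close> can be
  used as they are.\<close>

definition val :: "'b var set \<Rightarrow> ('b, 'k, 'n) world \<Rightarrow> ('b var \<Rightarrow> ('b, 'k, 'n) tm) \<Rightarrow> bool" where
  "val \<Sigma> w \<theta> \<longleftrightarrow> is_sig \<Sigma> \<and> wf_world w \<and> (\<forall>x\<in>\<Sigma>. tyd (\<theta> x) (snd x) \<and> fv (\<theta> x) \<subseteq> fst w)"

definition vsupp :: "'b var set \<Rightarrow> ('b var \<Rightarrow> ('b, 'k, 'n) tm) \<Rightarrow> 'n set" where
  "vsupp \<Sigma> \<theta> = (\<Union>x\<in>\<Sigma>. supp (\<theta> x))"

definition avoids :: "'b var set \<Rightarrow> ('b var \<Rightarrow> ('b, 'k, 'n) tm) \<Rightarrow> ('n \<Rightarrow> 'n) \<Rightarrow> 'n set \<Rightarrow> bool" where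
  "avoids \<Sigma> \<theta> \<pi> A \<longleftrightarrow> is_perm \<pi> \<and> \<pi> ` A \<inter> vsupp \<Sigma> \<theta> = {}"

text \<open>
  Every formula of a sequent has its own local scope of nominal constants, so the nominal
  constants that a valuation \<open>\<theta>\<close> brings in have to be kept apart from those of each formula
  separately.
\<close>

definition holds :: "'b var set \<Rightarrow> ('b, 'k, 'n) world \<Rightarrow> ('b var \<Rightarrow> ('b, 'k, 'n) tm) \<Rightarrow> ('b, 'k, 'n) tm \<Rightarrow> bool" where
  "holds \<Sigma> w \<theta> X \<longleftrightarrow> (\<forall>\<pi>. avoids \<Sigma> \<theta> \<pi> (supp X) \<longrightarrow> forces w (act (vsub \<theta> \<pi>) X))"

lemma val_wf: "val \<Sigma> w \<theta> \<Longrightarrow> wf_world w"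
  by (simp add: val_def)

lemma avoids_perm: "avoids \<Sigma> \<theta> \<pi> A \<Longrightarrow> is_perm \<pi>"
  by (simp add: avoids_def)

lemma avoids_mono: "avoids \<Sigma> \<theta> \<pi> A \<Longrightarrow> A' \<subseteq> A \<Longrightarrow> avoids \<Sigma> \<theta> \<pi> A'"
  by (auto simp: avoids_def)

lemma ghom_vsub: "val \<Sigma> w \<theta> \<Longrightarrow> is_perm \<pi> \<Longrightarrow> ghom \<Sigma> (fst w) (vsub \<theta> \<pi>)"
  by (auto simp: ghom_def val_def)

lemma finite_vsupp: "val \<Sigma> w \<theta> \<Longrightarrow> finite (vsupp \<Sigma> \<theta>)"
  by (auto simp: vsupp_def val_def is_sig_def)

lemma avoids_exists:
  assumes "val \<Sigma> w \<theta>" "finite A" "\<And>a. a \<in> A \<Longrightarrow> ntype a \<in> nominal"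
  obtains \<pi> where "avoids \<Sigma> \<theta> \<pi> A"
  using perm_avoid[OF nominal_ok assms(2) finite_vsupp[OF assms(1)] finite.emptyI is_perm_id(1)] assms(3)
  unfolding avoids_def by (metis Int_empty_left image_empty)

lemma avoids_term_exists:
  assumes "val \<Sigma> w \<theta>" "is_term \<Sigma> X \<tau>"
  obtains \<pi> where "avoids \<Sigma> \<theta> \<pi> (supp X)"
  by (rule avoids_exists[OF assms(1), of "supp X"]) (use assms(2) has_type_supp in \<open>auto simp: is_term_def\<close>)

text \<open>The map that fixes the nominal constants of \<theta> and sends \<open>\<pi> a\<close> to
  \<open>\<pi>' a\<close> is injective, as both renamings avoid those of \<theta>; it extends to a
  permutation. With \<open>forces_perm\<close>, \<open>holds\<close> can therefore be tested with a
  single renaming.\<close>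

lemma avoids_unique:
  assumes "val \<Sigma> w \<theta>" "is_term \<Sigma> X \<tau>" "avoids \<Sigma> \<theta> \<pi> (supp X)" "avoids \<Sigma> \<theta> \<pi>' (supp X)"
  obtains \<rho> where "is_perm \<rho>" "act (vsub \<theta> \<pi>') X = perm \<rho> (act (vsub \<theta> \<pi>) X)"
proof -
  let ?S = "vsupp \<Sigma> \<theta>"
  let ?f = "\<lambda>b. if b \<in> ?S then b else \<pi>' (inv \<pi> b)"
  have \<pi>: "is_perm \<pi>" "is_perm \<pi>'" "\<pi> ` supp X \<inter> ?S = {}" "\<pi>' ` supp X \<inter> ?S = {}"
    using assms(3,4) by (auto simp: avoids_def)
  have inv: "inv \<pi> (\<pi> a) = a" for a using \<pi>(1) by (simp add: is_perm_def bij_is_inj)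
  have inj': "inj \<pi>'" using \<pi>(2) by (simp add: is_perm_def bij_is_inj)
  have 1: "finite (?S \<union> \<pi> ` supp X)" using finite_vsupp[OF assms(1)] by simp
  have 2: "inj_on ?f (?S \<union> \<pi> ` supp X)"
  proof (rule inj_onI)
    fix a b assume ab: "a \<in> ?S \<union> \<pi> ` supp X" "b \<in> ?S \<union> \<pi> ` supp X" "?f a = ?f b"
    have N: "\<pi>' c \<notin> ?S" if "c \<in> supp X" for c using that \<pi>(4) by auto
    show "a = b"
      using ab N by (auto simp: inv split: if_splits dest: injD[OF inj'])
  qed
  have 3: "ntype (?f a) = ntype a" if "a \<in> ?S \<union> \<pi> ` supp X" for a
    using that \<pi>(1,2) inv by (auto simp: is_perm_def)
  obtain \<rho> where \<rho>: "is_perm \<rho>" "\<And>a. a \<in> ?S \<union> \<pi> ` supp X \<Longrightarrow> \<rho> a = ?f a"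
    using perm_extend[OF 1 2 3] by blast
  have g: "ghom \<Sigma> (fst w) (vsub \<theta> \<pi>)" "ghom (fst w) (fst w) (perm \<rho>)"
    using ghom_vsub[OF assms(1) \<pi>(1)] khom_ghom[OF khom_perm[OF \<rho>(1)]] by auto
  have "act (vsub \<theta> \<pi>') X = act (cmp (perm \<rho>) (vsub \<theta> \<pi>)) X"
    unfolding act_def
  proof (rule arg_cong[of _ _ nf], rule psubst_cong)
    show "vsub \<theta> \<pi>' (Var x) = cmp (perm \<rho>) (vsub \<theta> \<pi>) (Var x)" if "x \<in> fv X" for x
    proof -
      have "x \<in> \<Sigma>" using that assms(2) by (auto simp: is_term_def)
      then have "a \<in> ?S" if "a \<in> supp (\<theta> x)" for a using that by (auto simp: vsupp_def)
      then have "perm \<rho> (\<theta> x) = \<theta> x" using \<rho>(2) by (intro perm_idle) simp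
      then show ?thesis by (simp add: cmp_def flip: perm_eq_psubst)
    qed
    show "vsub \<theta> \<pi>' (Nom a) = cmp (perm \<rho>) (vsub \<theta> \<pi>) (Nom a)" if "a \<in> supp X" for a
      using that \<rho>(2) \<pi>(3) inv by (auto simp: cmp_def)
  qed (simp add: cmp_def)
  also have "\<dots> = perm \<rho> (act (vsub \<theta> \<pi>) X)"
    using act_cmp[OF g assms(2)] act_perm[OF \<rho>(1) is_term_act[OF g(1) assms(2)]] by simp
  finally show ?thesis using that \<rho>(1) by blast
qed

lemma holds_iff:
  assumes "val \<Sigma> w \<theta>" "is_term \<Sigma> X Prop" "avoids \<Sigma> \<theta> \<pi> (supp X)"
  shows "holds \<Sigma> w \<theta> X \<longleftrightarrow> forces w (act (vsub \<theta> \<pi>) X)"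
proof
  assume f: "forces w (act (vsub \<theta> \<pi>) X)"
  have t: "is_term (fst w) (act (vsub \<theta> \<pi>) X) Prop"
    by (rule is_term_act[OF ghom_vsub[OF assms(1) avoids_perm[OF assms(3)]] assms(2)])
  show "holds \<Sigma> w \<theta> X"
    unfolding holds_def
  proof (intro allI impI)
    fix \<pi>' assume \<pi>': "avoids \<Sigma> \<theta> \<pi>' (supp X)"
    obtain \<rho> where \<rho>: "is_perm \<rho>" "act (vsub \<theta> \<pi>') X = perm \<rho> (act (vsub \<theta> \<pi>) X)"
      using avoids_unique[OF assms \<pi>'] .
    then show "forces w (act (vsub \<theta> \<pi>') X)" using forces_perm[OF f val_wf[OF assms(1)] t] by simp
  qed
qed (use assms(3) in \<open>simp add: holds_def\<close>)

section \<open>Transport of valuations along morphisms\<close>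

definition cmp_val :: "('b, 'k, 'n) subst \<Rightarrow> ('b var \<Rightarrow> ('b, 'k, 'n) tm) \<Rightarrow> 'b var \<Rightarrow> ('b, 'k, 'n) tm" where
  "cmp_val s \<theta> x = psubst s (\<theta> x)"

lemma cmp_val_id [simp]: "cmp_val id \<theta> = \<theta>"
  by (simp add: cmp_val_def[abs_def] psubst_id)

lemma val_mor:
  assumes "val \<Sigma> w \<theta>" "mor s w w'"
  shows "val \<Sigma> w' (cmp_val s \<theta>)"
  unfolding val_def cmp_val_def
proof (intro conjI ballI)
  fix x assume "x \<in> \<Sigma>"
  then have x: "tyd (\<theta> x) (snd x)" "fv (\<theta> x) \<subseteq> fst w" using assms(1) by (auto simp: val_def)
  show "tyd (psubst s (\<theta> x)) (snd x)" by (rule tyd_psubst[OF x ghom_tsub[OF mor_ghom[OF assms(2)]]])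
  show "fv (psubst s (\<theta> x)) \<subseteq> fst w'" by (rule ghom_fv[OF mor_ghom[OF assms(2)] x(2)])
qed (use assms mor_wf in \<open>auto simp: val_def\<close>)

text \<open>\<pi>' is \<pi> followed by the renaming that \<open>s\<close> performs. Avoidance is
  kept because \<open>s\<close> brings in no nominal constants through its values and renames those
  of \<theta> and of the formula by the same injection.\<close>

lemma vsub_mor:
  assumes "val \<Sigma> w \<theta>" "mor s w w'" "is_perm \<pi>"
  obtains \<pi>' where "\<And>X \<tau>. is_term \<Sigma> X \<tau> \<Longrightarrow> act s (act (vsub \<theta> \<pi>) X) = act (vsub (cmp_val s \<theta>) \<pi>') X"
    "\<And>A. avoids \<Sigma> \<theta> \<pi> A \<Longrightarrow> avoids \<Sigma> (cmp_val s \<theta>) \<pi>' A"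
proof -
  obtain \<rho> where \<rho>: "is_perm \<rho>" "\<forall>a. s (Nom a) = Nom (\<rho> a)" using mor_ghom[OF assms(2)] by (auto simp: ghom_def)
  have "act s (act (vsub \<theta> \<pi>) X) = act (vsub (cmp_val s \<theta>) (\<rho> \<circ> \<pi>)) X" if X: "is_term \<Sigma> X \<tau>" for X \<tau>
  proof -
    have "act (cmp s (vsub \<theta> \<pi>)) X = act (vsub (cmp_val s \<theta>) (\<rho> \<circ> \<pi>)) X"
      unfolding act_def
      by (rule arg_cong[of _ _ nf], rule psubst_cong)
        (use \<rho>(2) mor_ghom[OF assms(2)] in \<open>auto simp: cmp_def cmp_val_def ghom_def\<close>)
    then show ?thesis using act_cmp[OF ghom_vsub[OF assms(1,3)] mor_ghom[OF assms(2)] X] by simp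
  qed
  moreover have "avoids \<Sigma> (cmp_val s \<theta>) (\<rho> \<circ> \<pi>) A" if A: "avoids \<Sigma> \<theta> \<pi> A" for A
  proof -
    have "supp (psubst s (\<theta> x)) \<subseteq> \<rho> ` supp (\<theta> x)" if "x \<in> \<Sigma>" for x
    proof -
      have "fv (\<theta> x) \<subseteq> fst w" using that assms(1) by (auto simp: val_def)
      then have "(\<Union>y\<in>fv (\<theta> x). supp (s (Var y))) = {}" using mor_khom[OF assms(2)] by (auto simp: khom_def)
      then show ?thesis using ghom_supp[OF mor_ghom[OF assms(2)] \<rho>(2), of "\<theta> x"] by simp
    qed
    then have S: "vsupp \<Sigma> (cmp_val s \<theta>) \<subseteq> \<rho> ` vsupp \<Sigma> \<theta>" unfolding vsupp_def cmp_val_def image_UN by blast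
    have "inj \<rho>" using \<rho>(1) by (simp add: is_perm_def bij_is_inj)
    then have "\<rho> ` (\<pi> ` A) \<inter> \<rho> ` vsupp \<Sigma> \<theta> = {}"
      using A by (auto simp: avoids_def dest: injD)
    moreover have "(\<rho> \<circ> \<pi>) ` A = \<rho> ` \<pi> ` A" by auto
    ultimately have "(\<rho> \<circ> \<pi>) ` A \<inter> vsupp \<Sigma> (cmp_val s \<theta>) = {}" using S by blast
    then show ?thesis
      using A \<rho>(1) is_perm_comp unfolding avoids_def by blast
  qed
  ultimately show ?thesis using that by blast
qed

lemma holds_act_iff:
  assumes "val \<Sigma> w \<theta>" "is_term \<Sigma> X Prop" "avoids \<Sigma> \<theta> \<pi> (supp X)" "mor s w w'"
  shows "holds \<Sigma> w' (cmp_val s \<theta>) X \<longleftrightarrow> forces w' (act s (act (vsub \<theta> \<pi>) X))"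
proof -
  obtain \<pi>' where "act s (act (vsub \<theta> \<pi>) X) = act (vsub (cmp_val s \<theta>) \<pi>') X" "avoids \<Sigma> (cmp_val s \<theta>) \<pi>' (supp X)"
    using vsub_mor[OF assms(1,4) avoids_perm[OF assms(3)]] assms(2,3) by metis
  then show ?thesis using holds_iff[OF val_mor[OF assms(1,4)] assms(2)] by simp
qed

lemma holds_mor:
  assumes "holds \<Sigma> w \<theta> X" "val \<Sigma> w \<theta>" "is_term \<Sigma> X Prop" "mor s w w'"
  shows "holds \<Sigma> w' (cmp_val s \<theta>) X"
proof -
  obtain \<pi> where \<pi>: "avoids \<Sigma> \<theta> \<pi> (supp X)" using avoids_term_exists[OF assms(2,3)] .
  have "forces w (act (vsub \<theta> \<pi>) X)" using assms(1) \<pi> by (simp add: holds_def)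
  then have "forces w' (act s (act (vsub \<theta> \<pi>) X))"
    by (rule forces_mor[OF _ val_wf[OF assms(2)] is_term_act[OF ghom_vsub[OF assms(2) avoids_perm[OF \<pi>]] assms(3)] assms(4)])
  then show ?thesis using holds_act_iff[OF assms(2,3) \<pi> assms(4)] by simp
qed

lemma holds_run:
  assumes "cps w P" "val \<Sigma> w \<theta>" "is_term \<Sigma> D Prop"
    "\<And>w' s. mor s w w' \<Longrightarrow> P w' s \<Longrightarrow> holds \<Sigma> w' (cmp_val s \<theta>) D"
  shows "holds \<Sigma> w \<theta> D"
proof -
  obtain \<pi> where \<pi>: "avoids \<Sigma> \<theta> \<pi> (supp D)" using avoids_term_exists[OF assms(2,3)] .
  have "forces w (act (vsub \<theta> \<pi>) D)"
    by (rule run[OF assms(1) val_wf[OF assms(2)] is_term_act[OF ghom_vsub[OF assms(2) avoids_perm[OF \<pi>]] assms(3)]])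
      (use assms(4) holds_act_iff[OF assms(2,3) \<pi>] in blast)
  then show ?thesis using holds_iff[OF assms(2,3) \<pi>] by simp
qed

section \<open>Validity of sequents, connective by connective\<close>

definition sound :: "('b, 'k, 'n) sequent \<Rightarrow> bool" where
  "sound S \<longleftrightarrow> (case S of (\<Sigma>;; \<Gamma> \<turnstile> C) \<Rightarrow>
     \<forall>w \<theta>. val \<Sigma> w \<theta> \<longrightarrow> (\<forall>X\<in>#\<Gamma>. holds \<Sigma> w \<theta> X) \<longrightarrow> holds \<Sigma> w \<theta> C)"

lemma sound_iff: "sound (\<Sigma>;; \<Gamma> \<turnstile> C) \<longleftrightarrow>
    (\<forall>w \<theta>. val \<Sigma> w \<theta> \<longrightarrow> (\<forall>X\<in>#\<Gamma>. holds \<Sigma> w \<theta> X) \<longrightarrow> holds \<Sigma> w \<theta> C)"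
  by (simp add: sound_def)

lemma soundD:
  "sound (\<Sigma>;; \<Gamma> \<turnstile> C) \<Longrightarrow> val \<Sigma> w \<theta> \<Longrightarrow> (\<And>X. X \<in># \<Gamma> \<Longrightarrow> holds \<Sigma> w \<theta> X) \<Longrightarrow> holds \<Sigma> w \<theta> C"
  unfolding sound_iff by blast

lemma holds_conj_iff:
  assumes "val \<Sigma> w \<theta>" "is_term \<Sigma> (Conj B C) Prop"
  shows "holds \<Sigma> w \<theta> (Conj B C) \<longleftrightarrow> holds \<Sigma> w \<theta> B \<and> holds \<Sigma> w \<theta> C"
proof -
  obtain \<pi> where \<pi>: "avoids \<Sigma> \<theta> \<pi> (supp (Conj B C))" using avoids_term_exists[OF assms] .
  note g = ghom_vsub[OF assms(1) avoids_perm[OF \<pi>]]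
  have t: "is_term \<Sigma> B Prop" "is_term \<Sigma> C Prop" using assms(2) by (simp_all add: is_term_const_iff)
  have a: "avoids \<Sigma> \<theta> \<pi> (supp B)" "avoids \<Sigma> \<theta> \<pi> (supp C)" by (rule avoids_mono[OF \<pi>]; simp)+
  note eq = act_form(4)[OF g assms(2)]
  show ?thesis
    unfolding holds_iff[OF assms \<pi>] holds_iff[OF assms(1) t(1) a(1)] holds_iff[OF assms(1) t(2) a(2)] eq
    by (rule forces_conj_iff[OF val_wf[OF assms(1)]]) (use is_term_act[OF g assms(2)] eq in simp)
qed

lemma holds_imp_iff:
  assumes "val \<Sigma> w \<theta>" "is_term \<Sigma> (Imp B C) Prop"
  shows "holds \<Sigma> w \<theta> (Imp B C) \<longleftrightarrow>
    (\<forall>w' s. mor s w w' \<longrightarrow> holds \<Sigma> w' (cmp_val s \<theta>) B \<longrightarrow> holds \<Sigma> w' (cmp_val s \<theta>) C)"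
proof -
  obtain \<pi> where \<pi>: "avoids \<Sigma> \<theta> \<pi> (supp (Imp B C))" using avoids_term_exists[OF assms] .
  note g = ghom_vsub[OF assms(1) avoids_perm[OF \<pi>]]
  have t: "is_term \<Sigma> B Prop" "is_term \<Sigma> C Prop" using assms(2) by (simp_all add: is_term_const_iff)
  have a: "avoids \<Sigma> \<theta> \<pi> (supp B)" "avoids \<Sigma> \<theta> \<pi> (supp C)" by (rule avoids_mono[OF \<pi>]; simp)+
  note eq = act_form(6)[OF g assms(2)]
  have "holds \<Sigma> w \<theta> (Imp B C) \<longleftrightarrow> (\<forall>w' s. mor s w w' \<longrightarrow>
      forces w' (act s (act (vsub \<theta> \<pi>) B)) \<longrightarrow> forces w' (act s (act (vsub \<theta> \<pi>) C)))"
    unfolding holds_iff[OF assms \<pi>] eq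
    by (rule forces_imp_iff[OF val_wf[OF assms(1)]]) (use is_term_act[OF g assms(2)] eq in simp)
  then show ?thesis using holds_act_iff[OF assms(1) t(1) a(1)] holds_act_iff[OF assms(1) t(2) a(2)] by blast
qed

lemma holds_disj_iff:
  assumes "val \<Sigma> w \<theta>" "is_term \<Sigma> (Disj B C) Prop"
  shows "holds \<Sigma> w \<theta> (Disj B C) \<longleftrightarrow> cps w (\<lambda>w' s. holds \<Sigma> w' (cmp_val s \<theta>) B \<or> holds \<Sigma> w' (cmp_val s \<theta>) C)"
proof -
  obtain \<pi> where \<pi>: "avoids \<Sigma> \<theta> \<pi> (supp (Disj B C))" using avoids_term_exists[OF assms] .
  note g = ghom_vsub[OF assms(1) avoids_perm[OF \<pi>]]
  have t: "is_term \<Sigma> B Prop" "is_term \<Sigma> C Prop" using assms(2) by (simp_all add: is_term_const_iff)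
  have a: "avoids \<Sigma> \<theta> \<pi> (supp B)" "avoids \<Sigma> \<theta> \<pi> (supp C)" by (rule avoids_mono[OF \<pi>]; simp)+
  note eq = act_form(5)[OF g assms(2)]
  have "holds \<Sigma> w \<theta> (Disj B C) \<longleftrightarrow>
      cps w (\<lambda>w' s. forces w' (act s (act (vsub \<theta> \<pi>) B)) \<or> forces w' (act s (act (vsub \<theta> \<pi>) C)))"
    unfolding holds_iff[OF assms \<pi>] eq
    by (rule forces_disj_iff[OF val_wf[OF assms(1)]]) (use is_term_act[OF g assms(2)] eq in simp)
  also have "\<dots> \<longleftrightarrow> cps w (\<lambda>w' s. holds \<Sigma> w' (cmp_val s \<theta>) B \<or> holds \<Sigma> w' (cmp_val s \<theta>) C)"
    by (rule cps_cong[OF val_wf[OF assms(1)]])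
      (use holds_act_iff[OF assms(1) t(1) a(1)] holds_act_iff[OF assms(1) t(2) a(2)] in blast)
  finally show ?thesis .
qed

lemma holds_disjI:
  assumes "val \<Sigma> w \<theta>" "is_term \<Sigma> (Disj B C) Prop" "holds \<Sigma> w \<theta> B \<or> holds \<Sigma> w \<theta> C"
  shows "holds \<Sigma> w \<theta> (Disj B C)"
  unfolding holds_disj_iff[OF assms(1,2)] using assms(2,3) holds_mor[OF _ assms(1)]
  by (intro cps_return) (auto simp: is_term_const_iff)

lemma holds_nabla_iff:
  assumes "val \<Sigma> w \<theta>" "is_term \<Sigma> (Nabla \<tau> F) Prop" "ntype a = \<tau>" "a \<notin> supp F"
  shows "holds \<Sigma> w \<theta> (Nabla \<tau> F) \<longleftrightarrow> holds \<Sigma> w \<theta> (nf (F \<cdot> Nom a))"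
proof -
  have F: "is_term \<Sigma> F (\<tau> \<rightarrow> Prop)" "\<tau> \<in> nominal" using assms(2) by (simp_all add: is_term_const_iff)
  have n: "is_term \<Sigma> (Nom a) \<tau>" using is_term_Nom[of a] assms(3) F(2) by simp
  have tF: "tyd (F \<cdot> Nom a) Prop" using F(1) n by (auto simp: is_term_def intro: has_type.intros(5))
  have s: "supp (nf (F \<cdot> Nom a)) \<subseteq> supp (F \<cdot> Nom a)" by (rule reds_supp[OF reds_nf[OF tF]])
  obtain \<pi> where \<pi>: "avoids \<Sigma> \<theta> \<pi> (supp (F \<cdot> Nom a))"
    using avoids_exists[OF assms(1), of "supp (F \<cdot> Nom a)"] has_type_supp[OF tF] by auto
  note g = ghom_vsub[OF assms(1) avoids_perm[OF \<pi>]]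
  have a: "avoids \<Sigma> \<theta> \<pi> (supp (Nabla \<tau> F))" "avoids \<Sigma> \<theta> \<pi> (supp (nf (F \<cdot> Nom a)))"
    using avoids_mono[OF \<pi> s] avoids_mono[OF \<pi>, of "supp F"] by auto
  \<comment> \<open>A nominal constant of the instantiated \<open>F\<close> is either one of
    \<theta>, which \<pi> avoids, or the image of one of \<open>F\<close>, which differs from
    \<open>\<pi> a\<close> by injectivity.\<close>
  have b: "\<pi> a \<notin> supp (act (vsub \<theta> \<pi>) F)"
  proof
    assume "\<pi> a \<in> supp (act (vsub \<theta> \<pi>) F)"
    moreover have "supp (act (vsub \<theta> \<pi>) F) \<subseteq> (\<Union>x\<in>fv F. supp (vsub \<theta> \<pi> (Var x))) \<union> \<pi> ` supp F"
      by (rule act_supp[OF g _ F(1)]) simp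
    moreover have "(\<Union>x\<in>fv F. supp (vsub \<theta> \<pi> (Var x))) \<subseteq> vsupp \<Sigma> \<theta>"
      using F(1) by (auto simp: vsupp_def is_term_def)
    ultimately show False
      using \<pi> assms(4) by (auto simp: avoids_def is_perm_def bij_def dest: injD)
  qed
  note eq = act_form(10)[OF g assms(2)]
  have "act (vsub \<theta> \<pi>) (nf (F \<cdot> Nom a)) = nf (act (vsub \<theta> \<pi>) F \<cdot> Nom (\<pi> a))"
    using act_instance[OF g F(1) n] by (simp add: act_def nf_normal)
  moreover have "ntype (\<pi> a) = \<tau>" using avoids_perm[OF \<pi>] assms(3) by (simp add: is_perm_def)
  ultimately show ?thesis
    unfolding holds_iff[OF assms(1,2) a(1)] holds_iff[OF assms(1) is_term_nf_App[OF F(1) n] a(2)] eq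
    using forces_nabla_iff[OF val_wf[OF assms(1)] _ _ b] is_term_act[OF g assms(2)] eq by simp
qed

lemma holds_top: "val \<Sigma> w \<theta> \<Longrightarrow> holds \<Sigma> w \<theta> Top"
  using forces_top act_form(2)[OF ghom_vsub] avoids_perm by (auto simp: holds_def)

lemma holds_bot:
  assumes "val \<Sigma> w \<theta>" "holds \<Sigma> w \<theta> Bot" "is_term \<Sigma> D Prop"
  shows "holds \<Sigma> w \<theta> D"
proof -
  have "avoids \<Sigma> \<theta> id (supp (Bot :: ('b, 'k, 'n) tm))" by (simp add: avoids_def)
  then have "forces w Bot"
    using assms(2) act_form(1)[OF ghom_vsub[OF assms(1) is_perm_id(1)]] by (auto simp: holds_def)
  then show ?thesis by (intro holds_run[where P = "\<lambda>_ _. False", OF _ assms(1,3)]) (auto simp: forces_bot_iff)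
qed

text \<open>The renaming between the two formulas is absorbed into the one that \<open>holds\<close>
  chooses. This works for a single assumption only because each formula has its own
  renaming.\<close>

lemma holds_perm_eq:
  assumes "val \<Sigma> w \<theta>" "is_term \<Sigma> B Prop" "is_term \<Sigma> B' Prop" "is_perm \<pi>" "is_perm \<pi>'"
    "perm \<pi> B = perm \<pi>' B'" "holds \<Sigma> w \<theta> B"
  shows "holds \<Sigma> w \<theta> B'"
proof -
  let ?\<rho> = "inv \<pi> \<circ> \<pi>'"
  have \<rho>: "is_perm ?\<rho>" using assms by (intro is_perm_comp is_perm_inv)
  have B: "B = perm ?\<rho> B'" using assms(6) perm_inv(1)[OF assms(4)] by (metis perm_perm)
  obtain \<pi>0 where \<pi>0: "avoids \<Sigma> \<theta> \<pi>0 (supp B)" using avoids_term_exists[OF assms(1,2)] .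
  have a: "avoids \<Sigma> \<theta> (\<pi>0 \<circ> ?\<rho>) (supp B')"
    using \<pi>0 is_perm_comp[OF avoids_perm[OF \<pi>0] \<rho>] by (auto simp: avoids_def B image_comp)
  have "act (vsub \<theta> \<pi>0) B = act (vsub \<theta> (\<pi>0 \<circ> ?\<rho>)) B'"
    unfolding act_def B perm_eq_psubst[of ?\<rho> B'] psubst_psubst
    by (rule arg_cong[of _ _ nf], rule psubst_cong) auto
  then show ?thesis
    using assms(7) holds_iff[OF assms(1,2) \<pi>0] holds_iff[OF assms(1,3) a] by simp
qed

lemma act_vsub_cong:
  "(\<And>x. x \<in> fv t \<Longrightarrow> \<theta> x = \<theta>' x) \<Longrightarrow> (\<And>a. a \<in> supp t \<Longrightarrow> \<pi> a = \<pi>' a) \<Longrightarrow> act (vsub \<theta> \<pi>) t = act (vsub \<theta>' \<pi>') t"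
  unfolding act_def by (rule arg_cong[of _ _ nf], rule psubst_cong) auto

lemma holds_weaken_iff:
  assumes "val \<Sigma>' w \<theta>'" "val \<Sigma> w \<theta>" "\<Sigma> \<subseteq> \<Sigma>'" "\<And>x. x \<in> \<Sigma> \<Longrightarrow> \<theta>' x = \<theta> x" "is_term \<Sigma> X Prop"
  shows "holds \<Sigma>' w \<theta>' X \<longleftrightarrow> holds \<Sigma> w \<theta> X"
proof -
  have X: "is_term \<Sigma>' X Prop" using assms(3,5) by (auto simp: is_term_def)
  obtain \<pi> where \<pi>: "avoids \<Sigma>' \<theta>' \<pi> (supp X)" using avoids_term_exists[OF assms(1) X] .
  have "vsupp \<Sigma> \<theta> \<subseteq> vsupp \<Sigma>' \<theta>'" using assms(3,4) by (force simp: vsupp_def)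
  then have \<pi>': "avoids \<Sigma> \<theta> \<pi> (supp X)" using \<pi> by (auto simp: avoids_def)
  have "act (vsub \<theta>' \<pi>) X = act (vsub \<theta> \<pi>) X"
    by (rule act_vsub_cong) (use assms(4,5) in \<open>auto simp: is_term_def\<close>)
  then show ?thesis using holds_iff[OF assms(1) X \<pi>] holds_iff[OF assms(2,5) \<pi>'] by simp
qed

text \<open>What raising achieves semantically. The term \<open>t\<close> may share nominal
  constants with the renamed \<open>F\<close>; abstracting these gives a value for \<open>h\<close>
  that \<pi> still avoids, and applying \<open>h\<close> to \<open>cs\<close> restores
  \<open>t\<close>.\<close>

lemma holds_eigen_iff:
  assumes v: "val \<Sigma> w \<theta>" and F: "is_term \<Sigma> F (\<tau> \<rightarrow> Prop)" and cs: "lists_supp cs F"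
    and h: "h = (n, raised cs \<tau>)" "h \<notin> \<Sigma>" "is_sig (insert h \<Sigma>)"
    and \<pi>: "avoids \<Sigma> \<theta> \<pi> (supp F)" and t: "is_term (fst w) t \<tau>"
  defines "\<theta>' \<equiv> \<theta>(h := abs_noms (map \<pi> cs) t)"
  shows val_eigen: "val (insert h \<Sigma>) w \<theta>'"
    and "holds (insert h \<Sigma>) w \<theta>' (nf (F \<cdot> apps (Var h) (map Nom cs))) \<longleftrightarrow>
      forces w (nf (act (vsub \<theta> \<pi>) F \<cdot> t))"
proof -
  note p = avoids_perm[OF \<pi>]
  have csn: "ntype c \<in> nominal" if "c \<in> set cs" for c
    using lists_supp_nominal[OF cs _ that] F by (auto simp: is_term_def)
  then have csn': "ntype c \<in> nominal" if "c \<in> set (map \<pi> cs)" for c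
    using that p by (auto simp: is_perm_def)
  have "raised (map \<pi> cs) \<tau> = raised cs \<tau>" using p by (induction cs) (auto simp: is_perm_def)
  then have "tyd (abs_noms (map \<pi> cs) t) (raised cs \<tau>)"
    using tyd_abs_noms[of t \<tau> "map \<pi> cs", OF _ csn'] t by (simp add: is_term_def)
  then show v': "val (insert h \<Sigma>) w \<theta>'"
    using v h t by (auto simp: val_def \<theta>'_def is_term_def)
  let ?u = "apps (Var h) (map Nom cs)" and ?\<Sigma> = "insert h \<Sigma>"
  have u: "is_term ?\<Sigma> ?u \<tau>"
    unfolding is_term_def
  proof (intro conjI)
    have "tyd (Var h) (raised cs \<tau>)" using has_type.intros(2)[of "[]" h] h by simp
    then show "tyd ?u \<tau>" using csn by (rule tyd_apps_Nom)
  qed (auto simp: normal_apps)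
  have F': "is_term ?\<Sigma> F (\<tau> \<rightarrow> Prop)" using F by (auto simp: is_term_def)
  have tFu: "tyd (F \<cdot> ?u) Prop" using F u by (auto simp: is_term_def intro: has_type.intros(5))
  have s: "supp (nf (F \<cdot> ?u)) \<subseteq> supp F"
    using reds_supp[OF reds_nf[OF tFu]] cs by (auto simp: lists_supp_def)
  have "\<theta>' x = \<theta> x" if "x \<in> \<Sigma>" for x using that h(2) by (auto simp: \<theta>'_def)
  then have "vsupp ?\<Sigma> \<theta>' = supp (\<theta>' h) \<union> vsupp \<Sigma> \<theta>" by (simp add: vsupp_def)
  then have "vsupp ?\<Sigma> \<theta>' \<subseteq> vsupp \<Sigma> \<theta> \<union> (supp t - \<pi> ` supp F)"
    using cs by (auto simp: \<theta>'_def lists_supp_def)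
  then have "avoids ?\<Sigma> \<theta>' \<pi> (supp F)" using \<pi> by (auto simp: avoids_def)
  then have a: "avoids ?\<Sigma> \<theta>' \<pi> (supp (nf (F \<cdot> ?u)))" using s by (rule avoids_mono)
  note g = ghom_vsub[OF v' p]
  have 1: "act (vsub \<theta>' \<pi>) F = act (vsub \<theta> \<pi>) F"
    by (rule act_vsub_cong) (use F h(2) in \<open>auto simp: is_term_def \<theta>'_def\<close>)
  have "act (vsub \<theta>' \<pi>) ?u = nf (apps (abs_noms (map \<pi> cs) t) (map Nom (map \<pi> cs)))"
    by (simp add: act_def psubst_apps \<theta>'_def o_def)
  also have "\<dots> = nf t"
  proof (rule nf_reds)
    show "tyd (apps (abs_noms (map \<pi> cs) t) (map Nom (map \<pi> cs))) \<tau>"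
      using t by (intro tyd_apps_Nom tyd_abs_noms csn') (auto simp: is_term_def)
    show "red\<^sup>*\<^sup>* (apps (abs_noms (map \<pi> cs) t) (map Nom (map \<pi> cs))) t"
      using t csn' by (intro reds_apps_abs_noms) (auto simp: is_term_def)
  qed
  also have "\<dots> = t" using t by (simp add: is_term_def nf_normal)
  finally have 2: "act (vsub \<theta>' \<pi>) ?u = t" .
  show "holds ?\<Sigma> w \<theta>' (nf (F \<cdot> ?u)) \<longleftrightarrow> forces w (nf (act (vsub \<theta> \<pi>) F \<cdot> t))"
    unfolding holds_iff[OF v' is_term_nf_App[OF F' u] a] act_instance[OF g F' u] 1 2 ..
qed

lemma sound_allR:
  assumes "is_sequent (\<Sigma>;; \<Gamma> \<turnstile> Forall \<tau> F)" "lists_supp cs F" "h = (n, raised cs \<tau>)" "h \<notin> \<Sigma>"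
    "is_sig (insert h \<Sigma>)" "sound (insert h \<Sigma>;; \<Gamma> \<turnstile> nf (F \<cdot> apps (Var h) (map Nom cs)))"
  shows "sound (\<Sigma>;; \<Gamma> \<turnstile> Forall \<tau> F)"
  unfolding sound_iff
proof (intro allI impI)
  fix w \<theta> assume v: "val \<Sigma> w \<theta>" and \<Gamma>: "\<forall>X\<in>#\<Gamma>. holds \<Sigma> w \<theta> X"
  have t: "is_term \<Sigma> (Forall \<tau> F) Prop" using assms(1) by simp
  then have F: "is_term \<Sigma> F (\<tau> \<rightarrow> Prop)" by (simp add: is_term_const_iff)
  obtain \<pi> where \<pi>: "avoids \<Sigma> \<theta> \<pi> (supp (Forall \<tau> F))" using avoids_term_exists[OF v t] .
  note g = ghom_vsub[OF v avoids_perm[OF \<pi>]]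
  note eq = act_form(8)[OF g t]
  have T: "is_term (fst w) (Forall \<tau> (act (vsub \<theta> \<pi>) F)) Prop" using is_term_act[OF g t] eq by simp
  show "holds \<Sigma> w \<theta> (Forall \<tau> F)"
    unfolding holds_iff[OF v t \<pi>] eq forces_all_iff[OF val_wf[OF v] T]
  proof (intro allI impI)
    fix w' s u assume s: "mor s w w'" and u: "is_term (fst w') u \<tau>"
    obtain \<pi>' where \<pi>': "act s (act (vsub \<theta> \<pi>) F) = act (vsub (cmp_val s \<theta>) \<pi>') F" "avoids \<Sigma> (cmp_val s \<theta>) \<pi>' (supp F)"
      using vsub_mor[OF v s avoids_perm[OF \<pi>]] F avoids_mono[OF \<pi>] by (metis sup_bot_left tm.set(4,5) order_refl)
    note v1 = val_mor[OF v s]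
    note e = holds_eigen_iff[OF v1 F assms(2,3,4,5) \<pi>'(2) u]
    note v2 = val_eigen[OF v1 F assms(2,3,4,5) \<pi>'(2) u]
    let ?\<theta> = "(cmp_val s \<theta>)(h := abs_noms (map \<pi>' cs) u)"
    have eq\<theta>: "?\<theta> x = cmp_val s \<theta> x" if "x \<in> \<Sigma>" for x using that assms(4) by auto
    have "\<forall>X\<in>#\<Gamma>. holds (insert h \<Sigma>) w' ?\<theta> X"
    proof
      fix X assume X: "X \<in># \<Gamma>"
      then have tX: "is_term \<Sigma> X Prop" using assms(1) by simp
      have "holds \<Sigma> w' (cmp_val s \<theta>) X" using holds_mor[OF _ v tX s] \<Gamma> X by blast
      then show "holds (insert h \<Sigma>) w' ?\<theta> X"
        using holds_weaken_iff[of "insert h \<Sigma>" w' ?\<theta> \<Sigma>, OF v2 v1 subset_insertI eq\<theta> tX] by blast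
    qed
    then have "holds (insert h \<Sigma>) w' ?\<theta> (nf (F \<cdot> apps (Var h) (map Nom cs)))"
      by (intro soundD[OF assms(6) v2]) blast
    then show "forces w' (nf (act s (act (vsub \<theta> \<pi>) F) \<cdot> u))" unfolding \<pi>'(1) e .
  qed
qed

lemma sound_exL:
  assumes "is_sequent (\<Sigma>;; add_mset (Exists \<tau> F) \<Gamma> \<turnstile> C)" "lists_supp cs F" "h = (n, raised cs \<tau>)" "h \<notin> \<Sigma>"
    "is_sig (insert h \<Sigma>)" "sound (insert h \<Sigma>;; add_mset (nf (F \<cdot> apps (Var h) (map Nom cs))) \<Gamma> \<turnstile> C)"
  shows "sound (\<Sigma>;; add_mset (Exists \<tau> F) \<Gamma> \<turnstile> C)"
  unfolding sound_iff
proof (intro allI impI)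
  fix w \<theta> assume v: "val \<Sigma> w \<theta>" and \<Gamma>: "\<forall>X\<in>#add_mset (Exists \<tau> F) \<Gamma>. holds \<Sigma> w \<theta> X"
  have t: "is_term \<Sigma> (Exists \<tau> F) Prop" and C: "is_term \<Sigma> C Prop" using assms(1) by auto
  then have F: "is_term \<Sigma> F (\<tau> \<rightarrow> Prop)" by (simp add: is_term_const_iff)
  obtain \<pi> where \<pi>: "avoids \<Sigma> \<theta> \<pi> (supp (Exists \<tau> F))" using avoids_term_exists[OF v t] .
  note g = ghom_vsub[OF v avoids_perm[OF \<pi>]]
  note eq = act_form(9)[OF g t]
  have T: "is_term (fst w) (Exists \<tau> (act (vsub \<theta> \<pi>) F)) Prop" using is_term_act[OF g t] eq by simp
  have "holds \<Sigma> w \<theta> (Exists \<tau> F)" using \<Gamma> by simp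
  from this[unfolded holds_iff[OF v t \<pi>] eq forces_ex_iff[OF val_wf[OF v] T]] v C
  show "holds \<Sigma> w \<theta> C"
  proof (rule holds_run, elim exE conjE)
    fix w' s u assume s: "mor s w w'" and u: "is_term (fst w') u \<tau>"
      and f: "forces w' (nf (act s (act (vsub \<theta> \<pi>) F) \<cdot> u))"
    obtain \<pi>' where \<pi>': "act s (act (vsub \<theta> \<pi>) F) = act (vsub (cmp_val s \<theta>) \<pi>') F" "avoids \<Sigma> (cmp_val s \<theta>) \<pi>' (supp F)"
      using vsub_mor[OF v s avoids_perm[OF \<pi>]] F avoids_mono[OF \<pi>] by (metis sup_bot_left tm.set(4,5) order_refl)
    note v1 = val_mor[OF v s]
    note e = holds_eigen_iff[OF v1 F assms(2,3,4,5) \<pi>'(2) u]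
    note v2 = val_eigen[OF v1 F assms(2,3,4,5) \<pi>'(2) u]
    let ?\<theta> = "(cmp_val s \<theta>)(h := abs_noms (map \<pi>' cs) u)"
    have eq\<theta>: "?\<theta> x = cmp_val s \<theta> x" if "x \<in> \<Sigma>" for x using that assms(4) by auto
    have "holds (insert h \<Sigma>) w' ?\<theta> (nf (F \<cdot> apps (Var h) (map Nom cs)))"
      using f unfolding \<pi>'(1) e .
    moreover have "holds (insert h \<Sigma>) w' ?\<theta> X" if X: "X \<in># \<Gamma>" for X
    proof -
      have tX: "is_term \<Sigma> X Prop" using assms(1) X by simp
      have "holds \<Sigma> w' (cmp_val s \<theta>) X" using holds_mor[OF _ v tX s] \<Gamma> X by simp
      then show "holds (insert h \<Sigma>) w' ?\<theta> X"
        using holds_weaken_iff[of "insert h \<Sigma>" w' ?\<theta> \<Sigma>, OF v2 v1 subset_insertI eq\<theta> tX] by blast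
    qed
    ultimately have "holds (insert h \<Sigma>) w' ?\<theta> C"
      by (intro soundD[OF assms(6) v2]) (unfold set_mset_add_mset_insert insert_iff, blast)
    then show "holds \<Sigma> w' (cmp_val s \<theta>) C"
      using holds_weaken_iff[of "insert h \<Sigma>" w' ?\<theta> \<Sigma>, OF v2 v1 subset_insertI eq\<theta> C] by blast
  qed
qed

text \<open>One renaming has to serve the quantified formula and its instance, so it is chosen for
  the nominal constants of \<open>F\<close> and of the witness together.\<close>

lemma quant_avoids:
  assumes "val \<Sigma> w \<theta>" "is_term \<Sigma> F (\<tau> \<rightarrow> Prop)" "is_term \<Sigma> t \<tau>"
  obtains \<pi> where "avoids \<Sigma> \<theta> \<pi> (supp F)" "avoids \<Sigma> \<theta> \<pi> (supp (nf (F \<cdot> t)))"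
proof -
  have tF: "tyd (F \<cdot> t) Prop" using assms by (auto simp: is_term_def intro: has_type.intros(5))
  have s: "supp (nf (F \<cdot> t)) \<subseteq> supp (F \<cdot> t)" by (rule reds_supp[OF reds_nf[OF tF]])
  obtain \<pi> where \<pi>: "avoids \<Sigma> \<theta> \<pi> (supp (F \<cdot> t))"
    using avoids_exists[OF assms(1), of "supp (F \<cdot> t)"] has_type_supp[OF tF] by auto
  show ?thesis using that[OF avoids_mono[OF \<pi>] avoids_mono[OF \<pi> s]] by simp
qed

lemma holds_allD:
  assumes "val \<Sigma> w \<theta>" "is_term \<Sigma> (Forall \<tau> F) Prop" "is_term \<Sigma> t \<tau>" "holds \<Sigma> w \<theta> (Forall \<tau> F)"
  shows "holds \<Sigma> w \<theta> (nf (F \<cdot> t))"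
proof -
  have F: "is_term \<Sigma> F (\<tau> \<rightarrow> Prop)" using assms(2) by (simp add: is_term_const_iff)
  obtain \<pi> where \<pi>: "avoids \<Sigma> \<theta> \<pi> (supp F)" "avoids \<Sigma> \<theta> \<pi> (supp (nf (F \<cdot> t)))"
    using quant_avoids[OF assms(1) F assms(3)] .
  note g = ghom_vsub[OF assms(1) avoids_perm[OF \<pi>(1)]] and wf = val_wf[OF assms(1)]
  note eq = act_form(8)[OF g assms(2)]
  have T: "is_term (fst w) (Forall \<tau> (act (vsub \<theta> \<pi>) F)) Prop" using is_term_act[OF g assms(2)] eq by simp
  have "forces w (Forall \<tau> (act (vsub \<theta> \<pi>) F))"
    using assms(4) \<pi>(1) holds_iff[OF assms(1,2)] eq by simp
  then have "forces w (nf (act id (act (vsub \<theta> \<pi>) F) \<cdot> act (vsub \<theta> \<pi>) t))"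
    using forces_all_iff[OF wf T] mor_id[OF wf] is_term_act[OF g assms(3)] by blast
  then show ?thesis
    using holds_iff[OF assms(1) is_term_nf_App[OF F assms(3)] \<pi>(2)] act_instance[OF g F assms(3)]
      is_term_act[OF g F] by simp
qed

lemma holds_exI:
  assumes "val \<Sigma> w \<theta>" "is_term \<Sigma> (Exists \<tau> F) Prop" "is_term \<Sigma> t \<tau>" "holds \<Sigma> w \<theta> (nf (F \<cdot> t))"
  shows "holds \<Sigma> w \<theta> (Exists \<tau> F)"
proof -
  have F: "is_term \<Sigma> F (\<tau> \<rightarrow> Prop)" using assms(2) by (simp add: is_term_const_iff)
  obtain \<pi> where \<pi>: "avoids \<Sigma> \<theta> \<pi> (supp F)" "avoids \<Sigma> \<theta> \<pi> (supp (nf (F \<cdot> t)))"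
    using quant_avoids[OF assms(1) F assms(3)] .
  note g = ghom_vsub[OF assms(1) avoids_perm[OF \<pi>(1)]] and wf = val_wf[OF assms(1)]
  note eq = act_form(9)[OF g assms(2)]
  note F' = is_term_act[OF g F] and t' = is_term_act[OF g assms(3)]
  have T: "is_term (fst w) (Exists \<tau> (act (vsub \<theta> \<pi>) F)) Prop" using is_term_act[OF g assms(2)] eq by simp
  have f: "forces w (nf (act (vsub \<theta> \<pi>) F \<cdot> act (vsub \<theta> \<pi>) t))"
    using assms(4) holds_iff[OF assms(1) is_term_nf_App[OF F assms(3)] \<pi>(2)] act_instance[OF g F assms(3)] by simp
  have "forces w (Exists \<tau> (act (vsub \<theta> \<pi>) F))"
    unfolding forces_ex_iff[OF wf T]
  proof (rule cps_return)
    fix w' s assume s: "mor s w w'"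
    have "forces w' (nf (act s (act (vsub \<theta> \<pi>) F) \<cdot> act s (act (vsub \<theta> \<pi>) t)))"
      using forces_mor[OF f wf is_term_nf_App[OF F' t'] s] act_instance[OF mor_ghom[OF s] F' t'] by simp
    then show "\<exists>t. is_term (fst w') t \<tau> \<and> forces w' (nf (act s (act (vsub \<theta> \<pi>) F) \<cdot> t))"
      using is_term_mor[OF s t'] by blast
  qed
  then show ?thesis using holds_iff[OF assms(1,2)] \<pi>(1) eq by simp
qed

lemma holds_eq_refl:
  assumes "val \<Sigma> w \<theta>" "is_term \<Sigma> (Eq \<tau> t t) Prop"
  shows "holds \<Sigma> w \<theta> (Eq \<tau> t t)"
proof -
  obtain \<pi> where \<pi>: "avoids \<Sigma> \<theta> \<pi> (supp (Eq \<tau> t t))" using avoids_term_exists[OF assms] .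
  note g = ghom_vsub[OF assms(1) avoids_perm[OF \<pi>]]
  show ?thesis
    unfolding holds_iff[OF assms \<pi>] act_form(7)[OF g assms(2)] forces_eq_iff by (rule cps_return) simp
qed

lemma available_clause:
  assumes "available w (Atom p ts)" "is_term (fst w) (Atom p ts) Prop" "clause p = Some (xs, B)" "length ts = length xs"
  shows "available w (inst B xs ts)"
proof (rule available_rule[OF assms(1,2)])
  fix w' s \<pi> E
  assume s: "mor s w w'" and \<pi>: "is_perm \<pi>"
  note g = mor_ghom[OF s] and h = khom_ghom[OF khom_perm[OF \<pi>]]
  have T: "is_term (fst w') (Atom p (map (act s) ts)) Prop"
    using is_term_mor[OF s assms(2)] by (simp add: act_form(13)[OF g assms(2)])
  let ?us = "map (act (perm \<pi>)) (map (act s) ts)"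
  have "perm \<pi> (act s (Atom p ts)) = Atom p ?us"
    unfolding act_form(13)[OF g assms(2)] using act_form(13)[OF h T] act_perm[OF \<pi> T] by simp
  moreover have "perm \<pi> (act s (inst B xs ts)) = inst B xs ?us"
    unfolding act_inst[OF g assms(3,2)]
    using act_inst[OF h assms(3) T] act_perm[OF \<pi> inst_is_term[OF assms(3) T]] by simp
  ultimately show "\<exists>Ps. LG_rule (insert (fst w';; add_mset (perm \<pi> (act s (inst B xs ts))) (snd w') \<turnstile> E) Ps)
      (fst w';; add_mset (perm \<pi> (act s (Atom p ts))) (snd w') \<turnstile> E) \<and> (\<forall>P\<in>Ps. derivable_mc_free P)"
    using defL[OF assms(3), of ?us] assms(4) by (intro exI[of _ "{}"]) simp
qed

lemma reflect_context:
  assumes "wf_world w" "is_term (fst w) B Prop" "available w B"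
  shows "forces w B"
  by (rule reflect[OF reify assms(1,2) order_refl assms(3)])

text \<open>If the atom is only assumed, its unfolding is available by \<open>defL\<close> and
  forced by reflection. Otherwise an unfolding is forced already, and it is this one because a
  predicate has at most one clause.\<close>

lemma unfolds_inst:
  assumes "unfolds w (Atom p ts)" "wf_world w" "is_term (fst w) (Atom p ts) Prop" "clause p = Some (xs, B)"
    "length ts = length xs"
  shows "forces w (inst B xs ts)"
  using assms(1) unfolding unfolds_def
proof (elim disjE bexE exE conjE)
  fix X assume "X \<in># snd w" "eqv (Atom p ts) X"
  then show ?thesis
    using assms by (intro reflect_context inst_is_term[OF assms(4,3)] available_clause available_context)
next
  fix q ys B' us
  assume "Atom p ts = Atom q us" "clause q = Some (ys, B')" "forces w (inst B' ys us)"
  then show ?thesis using Atom_inject[of p ts q us] assms(4) by auto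
qed

lemma clause_avoids:
  assumes "val \<Sigma> w \<theta>" "is_term \<Sigma> (Atom p ts) Prop" "clause p = Some (xs, B)"
  obtains \<pi> where "avoids \<Sigma> \<theta> \<pi> (supp (Atom p ts))" "avoids \<Sigma> \<theta> \<pi> (supp (inst B xs ts))"
proof -
  have *: "ntype a \<in> nominal" if "a \<in> supp (Atom p ts) \<union> supp (inst B xs ts)" for a
    using that assms(2) inst_is_term[OF assms(3,2)] has_type_supp unfolding is_term_def by blast
  obtain \<pi> where \<pi>: "avoids \<Sigma> \<theta> \<pi> (supp (Atom p ts) \<union> supp (inst B xs ts))"
    by (rule avoids_exists[OF assms(1) finite_UnI[OF finite_supp finite_supp] *])
  show ?thesis by (rule that; rule avoids_mono[OF \<pi>]; blast)
qed

lemma holds_clause_iff: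
  assumes v: "val \<Sigma> w \<theta>" and t: "is_term \<Sigma> (Atom p ts) Prop" and c: "clause p = Some (xs, B)" "length ts = length xs"
  shows "holds \<Sigma> w \<theta> (Atom p ts) \<longleftrightarrow> holds \<Sigma> w \<theta> (inst B xs ts)"
proof -
  obtain \<pi> where \<pi>: "avoids \<Sigma> \<theta> \<pi> (supp (Atom p ts))" "avoids \<Sigma> \<theta> \<pi> (supp (inst B xs ts))"
    using clause_avoids[OF v t c(1)] .
  let ?us = "map (act (vsub \<theta> \<pi>)) ts"
  note g = ghom_vsub[OF v avoids_perm[OF \<pi>(1)]]
  note eq = act_form(13)[OF g t]
  have T: "is_term (fst w) (Atom p ?us) Prop" using is_term_act[OF g t] eq by simp
  note I = inst_is_term[OF c(1) t] and I' = inst_is_term[OF c(1) T]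
  have h: "holds \<Sigma> w \<theta> (Atom p ts) \<longleftrightarrow> cps w (\<lambda>w' s. unfolds w' (act s (Atom p ?us)))"
    unfolding holds_iff[OF v t \<pi>(1)] eq by (rule forces_atom_iff[OF val_wf[OF v] T]) simp
  have S: "act s (Atom p ?us) = Atom p (map (act s) ?us)" "is_term (fst w') (Atom p (map (act s) ?us)) Prop"
    "act s (inst B xs ?us) = inst B xs (map (act s) ?us)" if "mor s w w'" for s w'
    using act_form(13)[OF mor_ghom[OF that] T] is_term_mor[OF that T] act_inst[OF mor_ghom[OF that] c(1) T] by simp_all
  show ?thesis
  proof
    assume "holds \<Sigma> w \<theta> (Atom p ts)"
    from this[unfolded h] v I show "holds \<Sigma> w \<theta> (inst B xs ts)"
    proof (rule holds_run)
      fix w' s assume s: "mor s w w'" and u: "unfolds w' (act s (Atom p ?us))"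
      have "forces w' (inst B xs (map (act s) ?us))"
        by (rule unfolds_inst[of w' p]) (use u S[OF s] mor_wf[OF s] c in auto)
      then show "holds \<Sigma> w' (cmp_val s \<theta>) (inst B xs ts)"
        unfolding holds_act_iff[OF v I \<pi>(2) s] act_inst[OF g c(1) t] S(3)[OF s] .
    qed
  next
    assume "holds \<Sigma> w \<theta> (inst B xs ts)"
    then have f: "forces w (inst B xs ?us)"
      unfolding holds_iff[OF v I \<pi>(2)] act_inst[OF g c(1) t] .
    show "holds \<Sigma> w \<theta> (Atom p ts)"
      unfolding h
    proof (rule cps_return)
      fix w' s assume s: "mor s w w'"
      have "forces w' (inst B xs (map (act s) ?us))" using forces_mor[OF f val_wf[OF v] I' s] S[OF s] by simp
      then show "unfolds w' (act s (Atom p ?us))"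
        unfolding unfolds_def S(1)[OF s] using c by (metis length_map)
    qed
  qed
qed

subsection \<open>Natural number induction\<close>

definition Succs :: "nat \<Rightarrow> ('b, 'k, 'n) tm \<Rightarrow> ('b, 'k, 'n) tm" where
  "Succs k t = ((\<lambda>u. Succ u) ^^ k) t"

lemma Succs_simps [simp]: "Succs 0 t = t" "Succs (Suc k) t = Succ (Succs k t)"
  by (simp_all add: Succs_def)

lemma Succs_Succ: "Succs k (Succ t) = Succ (Succs k t)"
  by (induction k) auto

lemma has_type_Succs: "has_type \<Delta> t Nt \<Longrightarrow> has_type \<Delta> (Succs k t) Nt"
  using has_type.intros(4)[of CSucc \<Delta>] by (induction k) (auto intro: has_type.intros(5))

lemma is_term_Succs: "is_term \<Sigma> t Nt \<Longrightarrow> is_term \<Sigma> (Succs k t) Nt"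
  by (induction k) (auto simp: is_term_const_iff)

lemma act_Succs: "ghom \<Sigma> \<Sigma>' s \<Longrightarrow> is_term \<Sigma> t Nt \<Longrightarrow> act s (Succs k t) = Succs k (act s t)"
  using is_term_Succs by (induction k) (auto simp: act_form(12) is_term_const_iff)

lemma subst_bound_Succs: "subst_bound i u (Succs k t) = Succs k (subst_bound i u t)"
  by (induction k) auto

lemma supp_Succs [simp]: "supp (Succs k t) = supp t"
  by (induction k) auto

lemma fv_Succs [simp]: "fv (Succs k t) = fv t"
  by (induction k) auto

text \<open>The invariant \<open>D\<close> precomposed with \<open>k\<close> successors, normalized
  because \<open>natL\<close> demands a normal term.\<close>

definition shift_inv :: "nat \<Rightarrow> ('b, 'k, 'n) tm \<Rightarrow> ('b, 'k, 'n) tm" where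
  "shift_inv k D = nf (Lam Nt (D \<cdot> Succs k (Bound 0)))"

lemma shift_inv:
  assumes "is_term {} D (Nt \<rightarrow> Prop)"
  shows is_term_shift_inv: "is_term {} (shift_inv k D) (Nt \<rightarrow> Prop)"
    and shift_inv_App: "is_term \<Sigma> t Nt \<Longrightarrow> nf (shift_inv k D \<cdot> t) = nf (D \<cdot> Succs k t)"
proof -
  have D: "tyd D (Nt \<rightarrow> Prop)" "fv D = {}" using assms by (auto simp: is_term_def)
  have "has_type [Nt] (Succs k (Bound 0)) Nt"
    using has_type.intros(1)[of 0 "[Nt]"] by (intro has_type_Succs) simp
  then have L: "tyd (Lam Nt (D \<cdot> Succs k (Bound 0))) (Nt \<rightarrow> Prop)"
    using tyd_weaken[OF D(1)] by (auto intro: has_type.intros(5,6))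
  then show "is_term {} (shift_inv k D) (Nt \<rightarrow> Prop)"
    using reds_fv[OF reds_nf[OF L]] D(2)
    by (simp add: is_term_def shift_inv_def has_type_nf normal_nf)
  assume t: "is_term \<Sigma> t Nt"
  have Lt: "tyd (Lam Nt (D \<cdot> Succs k (Bound 0)) \<cdot> t) Prop"
    using L t by (auto simp: is_term_def intro: has_type.intros(5))
  have "subst_bound 0 t D = D" using subst_bound_lift[of 0 t D] lift_tyd[OF D(1)] by simp
  then have "red (Lam Nt (D \<cdot> Succs k (Bound 0)) \<cdot> t) (D \<cdot> Succs k t)"
    using red.beta[of Nt "D \<cdot> Succs k (Bound 0)" t] by (simp add: subst_bound_Succs)
  then have "nf (Lam Nt (D \<cdot> Succs k (Bound 0)) \<cdot> t) = nf (D \<cdot> Succs k t)"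
    by (intro nf_reds[OF Lt]) auto
  moreover have "nf (shift_inv k D \<cdot> t) = nf (Lam Nt (D \<cdot> Succs k (Bound 0)) \<cdot> t)"
    unfolding shift_inv_def
    by (rule nf_reds[OF Lt, symmetric]) (intro reds_appL reds_nf[OF L])
  ultimately show "nf (shift_inv k D \<cdot> t) = nf (D \<cdot> Succs k t)" by simp
qed

lemma act_closed:
  assumes "ghom \<Sigma> \<Sigma>' s" "\<forall>a. s (Nom a) = Nom (\<rho> a)" "is_perm \<rho>" "is_term {} X \<tau>"
  shows "act s X = perm \<rho> X"
proof -
  have "act s X = act (perm \<rho>) X"
    unfolding act_def
    by (rule arg_cong[of _ _ nf], rule psubst_cong) (use assms in \<open>auto simp: ghom_def is_term_def\<close>)
  then show ?thesis using act_perm[OF assms(3,4)] by simp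
qed

lemma is_term_mono: "is_term \<Sigma> t \<tau> \<Longrightarrow> \<Sigma> \<subseteq> \<Sigma>' \<Longrightarrow> is_term \<Sigma>' t \<tau>"
  by (auto simp: is_term_def)

text \<open>
  The induction step cannot be instantiated with a term that shares nominal constants with \<open>D\<close>.
  Instead, the numbers of the form \<open>s (\<dots> (s I))\<close> are covered by the shifted invariants
  \<open>\<lambda>x. D (s (\<dots> (s x)))\<close>.
\<close>

context
  fixes D and j :: "'b var" and n
  assumes D: "is_term {} D (Nt \<rightarrow> Prop)" and j: "j = (n, Nt)"
    and base: "sound ({};; {#} \<turnstile> nf (D \<cdot> Zero))"
    and step: "sound ({j};; {#nf (D \<cdot> Var j)#} \<turnstile> nf (D \<cdot> Succ (Var j)))"
begin

lemma is_sig_j: "is_sig {j}"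
  using j by (simp add: is_sig_def)

lemma is_term_j: "is_term {j} (Var j) Nt"
  using j has_type.intros(2)[of "[]" j] by (simp add: is_term_def)

lemma Dj: "is_term {j} D (Nt \<rightarrow> Prop)"
  using D by (rule is_term_mono) simp

lemma act_D: "ghom \<Sigma> \<Sigma>' (vsub \<theta> \<pi>) \<Longrightarrow> is_perm \<pi> \<Longrightarrow> act (vsub \<theta> \<pi>) D = perm \<pi> D"
  by (rule act_closed[OF _ _ _ D]) auto

lemma forces_base:
  assumes "wf_world w" "is_perm \<pi>"
  shows "forces w (nf (perm \<pi> D \<cdot> Zero))"
proof -
  have v: "val {} w Var" using assms by (simp add: val_def is_sig_def)
  have "holds {} w Var (nf (D \<cdot> Zero))" by (rule soundD[OF base v]) simp
  then have "forces w (act (vsub Var \<pi>) (nf (D \<cdot> Zero)))"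
    using assms(2) by (simp add: holds_def avoids_def vsupp_def)
  then show ?thesis
    using act_instance[OF ghom_vsub[OF v assms(2)] D, of Zero] act_D[OF ghom_vsub[OF v assms(2)] assms(2)]
    by (simp add: is_term_const_iff act_form(3)[OF ghom_vsub[OF v assms(2)]])
qed

text \<open>The step premise is valid for renamings of \<open>D\<close> that avoid the nominal
  constants of the value of \<open>j\<close>. As \<open>t\<close> has none, \<pi> can be
  arbitrary.\<close>

lemma forces_step:
  assumes "wf_world w" "is_perm \<pi>" "is_term (fst w) t Nt" "supp t = {}" "forces w (nf (perm \<pi> D \<cdot> t))"
  shows "forces w (nf (perm \<pi> D \<cdot> Succ t))"
proof -
  let ?\<theta> = "\<lambda>_. t"
  have v: "val {j} w ?\<theta>" using assms j is_sig_j by (simp add: val_def is_term_def)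
  have a: "avoids {j} ?\<theta> \<pi> A" for A using assms(2,4) by (simp add: avoids_def vsupp_def)
  note g = ghom_vsub[OF v assms(2)]
  have tS: "is_term {j} (Succ (Var j)) Nt" using is_term_j by (simp add: is_term_const_iff)
  have V: "act (vsub ?\<theta> \<pi>) (Var j) = t" using assms(3) by (simp add: act_def is_term_def nf_normal)
  have "holds {j} w ?\<theta> (nf (D \<cdot> Var j))"
    using assms(5) unfolding holds_iff[OF v is_term_nf_App[OF Dj is_term_j] a]
      act_instance[OF g Dj is_term_j] act_D[OF g assms(2)] V .
  then have "holds {j} w ?\<theta> (nf (D \<cdot> Succ (Var j)))" by (intro soundD[OF step v]) simp
  then show ?thesis
    unfolding holds_iff[OF v is_term_nf_App[OF Dj tS] a]
      act_instance[OF g Dj tS] act_D[OF g assms(2)] act_form(12)[OF g tS] V .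
qed

lemma forces_numeral:
  assumes "wf_world w" "is_perm \<pi>"
  shows "forces w (nf (perm \<pi> D \<cdot> Succs k Zero))"
proof (induction k)
  case 0
  show ?case using forces_base[OF assms] by simp
next
  case (Suc k)
  have "is_term (fst w) (Succs k Zero) Nt" by (rule is_term_Succs) (simp add: is_term_const_iff)
  then show ?case using forces_step[OF assms _ _ Suc] by simp
qed

text \<open>Here an instance of \<open>natL\<close> with a shifted invariant is put into the
  derivation being built. Its first two premises concern only \<open>Succs k Zero\<close> and
  \<open>Succs k (Var j)\<close>, which have no nominal constants; so they are forced, and
  reification gives their cut-free derivations.\<close>

lemma available_nat:
  assumes "available w (NatP I)" "is_term (fst w) I Nt" "is_perm \<rho>"
  shows "available w (nf (perm \<rho> D \<cdot> Succs k I))"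
proof (rule available_rule[OF assms(1)])
  fix w' s \<pi> E
  assume s: "mor s w w'" and \<pi>: "is_perm \<pi>"
  note g = mor_ghom[OF s]
  obtain \<rho>' where \<rho>': "is_perm \<rho>'" "\<forall>a. s (Nom a) = Nom (\<rho>' a)" using g by (auto simp: ghom_def)
  \<comment> \<open>\<open>D\<close> has no variables, so the morphism \<open>s\<close> only renames
    it, by \<rho>'. The three renamings are collected into one.\<close>
  let ?\<pi> = "\<pi> \<circ> \<rho>' \<circ> \<rho>"
  have p: "is_perm ?\<pi>" using \<pi> \<rho>' assms(3) by (simp add: is_perm_comp)
  have tN: "is_term (fst w) (NatP I) Prop" using assms(2) by (simp add: is_term_const_iff)
  have \<rho>D: "is_term {} (perm \<rho> D) (Nt \<rightarrow> Prop)" by (rule is_term_perm[OF assms(3) D])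
  have \<rho>Dw: "is_term (fst w) (perm \<rho> D) (Nt \<rightarrow> Prop)" by (rule is_term_mono[OF \<rho>D]) simp
  let ?I = "perm \<pi> (act s I)" and ?D = "shift_inv k (perm ?\<pi> D)"
  have I: "is_term (fst w') ?I Nt" by (rule is_term_pa[OF s \<pi> assms(2)])
  have pD: "is_term {} (perm ?\<pi> D) (Nt \<rightarrow> Prop)" by (rule is_term_perm[OF p D])
  have D': "is_term {} ?D (Nt \<rightarrow> Prop)" by (rule is_term_shift_inv[OF pD])
  have eq: "perm \<pi> (act s (NatP I)) = NatP ?I" by (simp add: act_form(11)[OF g tN])
  have pI: "perm \<pi> (Succs k (act s I)) = Succs k ?I" by (induction k) auto
  have "perm \<pi> (act s (nf (perm \<rho> D \<cdot> Succs k I))) = perm \<pi> (nf (perm (\<rho>' \<circ> \<rho>) D \<cdot> Succs k (act s I)))"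
    unfolding act_instance[OF g \<rho>Dw is_term_Succs[OF assms(2)]] act_Succs[OF g assms(2)]
      act_closed[OF g \<rho>'(2,1) \<rho>D] perm_perm ..
  also have "\<dots> = nf (perm \<pi> (perm (\<rho>' \<circ> \<rho>) D) \<cdot> perm \<pi> (Succs k (act s I)))"
  proof (rule perm_instance[OF \<pi>])
    show "is_term (fst w') (perm (\<rho>' \<circ> \<rho>) D) (Nt \<rightarrow> Prop)"
      by (rule is_term_mono[OF is_term_perm[OF is_perm_comp[OF \<rho>'(1) assms(3)] D]]) simp
    show "is_term (fst w') (Succs k (act s I)) Nt" by (rule is_term_Succs[OF is_term_mor[OF s assms(2)]])
  qed
  also have "\<dots> = nf (?D \<cdot> ?I)"
    unfolding perm_perm pI shift_inv_App[OF pD I] by (simp add: o_assoc)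
  finally have eq': "perm \<pi> (act s (nf (perm \<rho> D \<cdot> Succs k I))) = nf (?D \<cdot> ?I)" .
  have M0: "der ({}, {#}) (nf (?D \<cdot> Zero))"
  proof -
    have w: "wf_world ({}, {#})" by (simp add: wf_world_def is_sig_def)
    have z: "is_term {} Zero Nt" by (simp add: is_term_const_iff)
    have "forces ({}, {#}) (nf (?D \<cdot> Zero))" unfolding shift_inv_App[OF pD z] by (rule forces_numeral[OF w p])
    then show ?thesis using reify[OF w] is_term_nf_App[OF D' z] by simp
  qed
  have M1: "der ({j}, {#nf (?D \<cdot> Var j)#}) (nf (?D \<cdot> Succ (Var j)))"
  proof -
    let ?w = "({j}, {#nf (?D \<cdot> Var j)#})"
    have D'j: "is_term {j} ?D (Nt \<rightarrow> Prop)" by (rule is_term_mono[OF D']) simp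
    have w: "wf_world ?w"
      using is_term_nf_App[OF D'j is_term_j] is_sig_j by (simp add: wf_world_def)
    have tS: "is_term {j} (Succ (Var j)) Nt" using is_term_j by (simp add: is_term_const_iff)
    have "forces ?w (nf (?D \<cdot> Var j))" by (rule forces_context[OF w]) simp
    then have "forces ?w (nf (perm ?\<pi> D \<cdot> Succs k (Var j)))" unfolding shift_inv_App[OF pD is_term_j] .
    then have "forces ?w (nf (perm ?\<pi> D \<cdot> Succ (Succs k (Var j))))"
      using is_term_Succs[OF is_term_j] by (intro forces_step[OF w p]) auto
    then have "forces ?w (nf (?D \<cdot> Succ (Var j)))" unfolding shift_inv_App[OF pD tS] Succs_Succ .
    then show ?thesis using reify[OF w] is_term_nf_App[OF D'j tS] by simp
  qed
  show "\<exists>Ps. LG_rule (insert (fst w';; add_mset (perm \<pi> (act s (nf (perm \<rho> D \<cdot> Succs k I)))) (snd w') \<turnstile> E) Ps)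
      (fst w';; add_mset (perm \<pi> (act s (NatP I))) (snd w') \<turnstile> E) \<and> (\<forall>P\<in>Ps. derivable_mc_free P)"
    using natL[OF D' j, of "fst w'" ?I "snd w'" E] M0 M1 unfolding eq eq'
    by (intro exI[of _ "{{};; {#} \<turnstile> nf (?D \<cdot> Zero), {j};; {#nf (?D \<cdot> Var j)#} \<turnstile> nf (?D \<cdot> Succ (Var j))}"])
      (simp add: insert_commute der_def)
qed (use assms(2) in \<open>simp add: is_term_const_iff\<close>)

lemma forces_nat_elim:
  assumes "forces w (NatP I)" "wf_world w" "is_term (fst w) I Nt" "is_perm \<pi>"
  shows "forces w (nf (perm \<pi> D \<cdot> Succs k I))"
proof -
  \<comment> \<open>\<open>k\<close> is quantified because removing a successor from
    \<open>I\<close> adds one to \<open>k\<close>. The induction thus ends at a numeral or at an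
    assumption \<open>nat I\<close>, and \<open>forces_step\<close> is never applied to
    \<open>I\<close> itself.\<close>
  have "wf_world w \<longrightarrow> is_term (fst w) I Nt \<longrightarrow> (\<forall>\<pi> k. is_perm \<pi> \<longrightarrow> forces w (nf (perm \<pi> D \<cdot> Succs k I)))"
    using assms(1)
  proof (induction rule: forces_nat_induct)
    case (step w I)
    show ?case
    proof (intro impI allI)
      fix \<pi> k assume w: "wf_world w" and I: "is_term (fst w) I Nt" and \<pi>: "is_perm \<pi>"
      have pD: "is_term {} (perm \<pi> D) (Nt \<rightarrow> Prop)" by (rule is_term_perm[OF \<pi> D])
      have pDw: "is_term (fst w) (perm \<pi> D) (Nt \<rightarrow> Prop)" by (rule is_term_mono[OF pD]) simp
      note Ik = is_term_Succs[OF I]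
      show "forces w (nf (perm \<pi> D \<cdot> Succs k I))"
      proof (rule run[OF step w is_term_nf_App[OF pDw Ik]])
        fix w' s
        assume s: "mor s w w'" and d: "(\<exists>X\<in>#snd w'. eqv (NatP (act s I)) X) \<or> act s I = Zero \<or>
          (\<exists>J. act s I = Succ J \<and> (wf_world w' \<longrightarrow> is_term (fst w') J Nt \<longrightarrow>
            (\<forall>\<pi> k. is_perm \<pi> \<longrightarrow> forces w' (nf (perm \<pi> D \<cdot> Succs k J)))))"
        note g = mor_ghom[OF s] and w' = mor_wf[OF s]
        obtain \<rho> where \<rho>: "is_perm \<rho>" "\<forall>a. s (Nom a) = Nom (\<rho> a)" using g by (auto simp: ghom_def)
        have p: "is_perm (\<rho> \<circ> \<pi>)" by (rule is_perm_comp[OF \<rho>(1) \<pi>])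
        have I': "is_term (fst w') (act s I) Nt" by (rule is_term_mor[OF s I])
        have eq: "act s (nf (perm \<pi> D \<cdot> Succs k I)) = nf (perm (\<rho> \<circ> \<pi>) D \<cdot> Succs k (act s I))"
          unfolding act_instance[OF g pDw Ik] act_Succs[OF g I] act_closed[OF g \<rho>(2,1) pD] perm_perm ..
        show "forces w' (act s (nf (perm \<pi> D \<cdot> Succs k I)))"
          unfolding eq using d
        proof (elim disjE bexE exE conjE)
          fix X assume X: "X \<in># snd w'" "eqv (NatP (act s I)) X"
          have N: "is_term (fst w') (NatP (act s I)) Prop" using I' by (simp add: is_term_const_iff)
          have "is_term (fst w') (perm (\<rho> \<circ> \<pi>) D) (Nt \<rightarrow> Prop)" by (rule is_term_mono[OF is_term_perm[OF p D]]) simp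
          from is_term_nf_App[OF this is_term_Succs[OF I']]
          show "forces w' (nf (perm (\<rho> \<circ> \<pi>) D \<cdot> Succs k (act s I)))"
            by (rule reflect_context[OF w' _ available_nat[OF available_context[OF X w' N] I' p]])
        next
          assume "act s I = Zero"
          then show "forces w' (nf (perm (\<rho> \<circ> \<pi>) D \<cdot> Succs k (act s I)))" using forces_numeral[OF w' p] by simp
        next
          fix J assume J: "act s I = Succ J" and IH: "wf_world w' \<longrightarrow> is_term (fst w') J Nt \<longrightarrow>
            (\<forall>\<pi> k. is_perm \<pi> \<longrightarrow> forces w' (nf (perm \<pi> D \<cdot> Succs k J)))"
          have "is_term (fst w') J Nt" using I' J by (simp add: is_term_const_iff)
          then have "forces w' (nf (perm (\<rho> \<circ> \<pi>) D \<cdot> Succs (Suc k) J))" using IH w' p by blast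
          then show "forces w' (nf (perm (\<rho> \<circ> \<pi>) D \<cdot> Succs k (act s I)))" unfolding J Succs_Succ by simp
        qed
      qed
    qed
  qed
  then show ?thesis using assms by blast
qed

lemma holds_nat_elim:
  assumes v: "val \<Sigma> w \<theta>" and t: "is_term \<Sigma> I Nt" and h: "holds \<Sigma> w \<theta> (NatP I)"
  shows "holds \<Sigma> w \<theta> (nf (D \<cdot> I))"
proof -
  have DS: "is_term \<Sigma> D (Nt \<rightarrow> Prop)" by (rule is_term_mono[OF D]) simp
  obtain \<pi> where \<pi>: "avoids \<Sigma> \<theta> \<pi> (supp (nf (D \<cdot> I)))" "avoids \<Sigma> \<theta> \<pi> (supp I)"
  proof -
    have tN: "tyd (D \<cdot> I) Prop" using DS t by (auto simp: is_term_def intro: has_type.intros(5))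
    have s: "supp (nf (D \<cdot> I)) \<subseteq> supp (D \<cdot> I)" by (rule reds_supp[OF reds_nf[OF tN]])
    obtain \<pi> where \<pi>: "avoids \<Sigma> \<theta> \<pi> (supp (D \<cdot> I))"
      using avoids_exists[OF v, of "supp (D \<cdot> I)"] has_type_supp[OF tN] by auto
    show ?thesis using that[OF avoids_mono[OF \<pi> s] avoids_mono[OF \<pi>]] by simp
  qed
  note p = avoids_perm[OF \<pi>(1)]
  note g = ghom_vsub[OF v p]
  have tN: "is_term \<Sigma> (NatP I) Prop" using t by (simp add: is_term_const_iff)
  have "forces w (NatP (act (vsub \<theta> \<pi>) I))"
    using h \<pi>(2) holds_iff[OF v tN] act_form(11)[OF g tN] by simp
  then have "forces w (nf (perm \<pi> D \<cdot> Succs 0 (act (vsub \<theta> \<pi>) I)))"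
    by (rule forces_nat_elim[OF _ val_wf[OF v] is_term_act[OF g t] p])
  then show ?thesis
    unfolding holds_iff[OF v is_term_nf_App[OF DS t] \<pi>(1)] act_instance[OF g DS t] act_D[OF g p] by simp
qed

end

lemma holds_nat_zero:
  assumes "val \<Sigma> w \<theta>"
  shows "holds \<Sigma> w \<theta> (NatP Zero)"
proof -
  have t: "is_term \<Sigma> (NatP Zero) Prop" by (simp add: is_term_const_iff)
  obtain \<pi> where \<pi>: "avoids \<Sigma> \<theta> \<pi> (supp (NatP Zero :: ('b, 'k, 'n) tm))" using avoids_term_exists[OF assms t] .
  note g = ghom_vsub[OF assms avoids_perm[OF \<pi>]]
  show ?thesis
    unfolding holds_iff[OF assms t \<pi>] act_form(11)[OF g t] act_form(3)[OF g] forces_nat_iff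
    by (rule cps_return) (simp add: act_form(3)[OF mor_ghom] nat_unfolds_def)
qed

lemma holds_nat_succ:
  assumes "val \<Sigma> w \<theta>" "is_term \<Sigma> I Nt" "holds \<Sigma> w \<theta> (NatP I)"
  shows "holds \<Sigma> w \<theta> (NatP (Succ I))"
proof -
  have t: "is_term \<Sigma> (NatP I) Prop" "is_term \<Sigma> (NatP (Succ I)) Prop" "is_term \<Sigma> (Succ I) Nt"
    using assms by (simp_all add: is_term_const_iff)
  obtain \<pi> where \<pi>: "avoids \<Sigma> \<theta> \<pi> (supp (NatP I))" using avoids_term_exists[OF assms(1) t(1)] .
  then have \<pi>': "avoids \<Sigma> \<theta> \<pi> (supp (NatP (Succ I)))" by simp
  note g = ghom_vsub[OF assms(1) avoids_perm[OF \<pi>]]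
  let ?I = "act (vsub \<theta> \<pi>) I"
  have I: "is_term (fst w) (NatP ?I) Prop" "is_term (fst w) (Succ ?I) Nt"
    using is_term_act[OF g assms(2)] by (simp_all add: is_term_const_iff)
  have f: "forces w (NatP ?I)" using assms(3) holds_iff[OF assms(1) t(1) \<pi>] act_form(11)[OF g t(1)] by simp
  show ?thesis
    unfolding holds_iff[OF assms(1) t(2) \<pi>'] act_form(11)[OF g t(2)] act_form(12)[OF g t(3)] forces_nat_iff
  proof (rule cps_return)
    fix w' s assume s: "mor s w w'"
    have "forces w' (NatP (act s ?I))"
      using forces_mor[OF f val_wf[OF assms(1)] I(1) s] act_form(11)[OF mor_ghom[OF s] I(1)] by simp
    then show "nat_unfolds w' (act s (Succ ?I))"
      unfolding act_form(12)[OF mor_ghom[OF s] I(2)] nat_unfolds_def by blast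
  qed
qed

text \<open>
  The rule \<open>eqL\<close> only considers unifiers without nominal constants, so those of \<open>\<theta>\<close> are replaced
  by fresh variables, which \<open>\<theta>'\<close> maps back to them.
\<close>

lemma unifier_without_nominals:
  assumes v: "val \<Sigma> w \<theta>" and s: "is_term \<Sigma> s \<tau>" and t: "is_term \<Sigma> t \<tau>"
    and \<pi>: "avoids \<Sigma> \<theta> \<pi> (supp s \<union> supp t)" and eq: "act (vsub \<theta> \<pi>) s = act (vsub \<theta> \<pi>) t"
  obtains \<rho> \<theta>' where "is_subst \<Sigma> \<rho>" "act (msubst \<rho>) s = act (msubst \<rho>) t" "val (subst_sig \<rho> \<Sigma>) w \<theta>'"
    "\<And>X. is_term \<Sigma> X Prop \<Longrightarrow> holds (subst_sig \<rho> \<Sigma>) w \<theta>' (nf (msubst \<rho> X)) \<longleftrightarrow> holds \<Sigma> w \<theta> X"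
proof -
  let ?S = "vsupp \<Sigma> \<theta>"
  have \<theta>: "tyd (\<theta> x) (snd x)" "fv (\<theta> x) \<subseteq> fst w" "supp (\<theta> x) \<subseteq> ?S" if "x \<in> \<Sigma>" for x
    using that v by (auto simp: val_def vsupp_def)
  have Sn: "ntype d \<in> nominal" if "d \<in> ?S" for d
    using that by (auto simp: vsupp_def intro: has_type_supp[OF \<theta>(1)])
  have sigw: "is_sig (fst w)" using val_wf[OF v] by (rule wf_world_sig)
  have sig\<Sigma>: "is_sig \<Sigma>" using v by (simp add: val_def)
  obtain idx :: "'n \<Rightarrow> nat" where idx: "inj_on idx ?S"
    using finite_imp_inj_to_nat_seg[OF finite_vsupp[OF v]] by blast
  have "finite (fst ` fst w)" using sigw by (simp add: is_sig_def)
  then obtain n0 where n0: "\<forall>k\<in>fst ` fst w. k < n0" using finite_nat_set_iff_bounded by blast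
  \<comment> \<open>\<open>n0\<close> exceeds the numbers of all variables of the world, so adding
    an injective index gives distinct fresh variables.\<close>
  define y where "y d = (n0 + idx d, ntype d)" for d
  have y_fresh: "y d \<notin> fst w" for d using n0 by (force simp: y_def)
  have y_inj: "inj_on y ?S" using idx by (auto simp: y_def inj_on_def)
  have ty: "tyd (Var (y d)) (ntype d)" for d using has_type.intros(2)[of "[]" "y d"] by (simp add: y_def)
  define \<sigma> where "\<sigma> \<pi> a = (case a of Nom d \<Rightarrow> if d \<in> ?S then Var (y d) else Nom (\<pi> d) | _ \<Rightarrow> a)"
    for \<pi> :: "'n \<Rightarrow> 'n" and a :: "('b, 'k, 'n) tm"
  have \<sigma>_simps [simp]: "\<sigma> \<pi> (Bound i) = Bound i" "\<sigma> \<pi> (Var x) = Var x"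
    "\<sigma> \<pi> (Nom d) = (if d \<in> ?S then Var (y d) else Nom (\<pi> d))" for \<pi> i x d by (simp_all add: \<sigma>_def)
  have \<sigma>_tsub: "tsub A (\<sigma> \<pi>)" if "is_perm \<pi>" for A \<pi>
    using that has_type.intros(3)[of _ "[]"] unfolding tsub_def is_perm_def
    by (metis \<sigma>_simps(2,3) has_type.intros(2) ty)
  define \<rho> where "\<rho> x = nf (psubst (\<sigma> id) (\<theta> x))" for x
  have h\<theta>: "tyd (psubst (\<sigma> id) (\<theta> x)) (snd x)" if "x \<in> \<Sigma>" for x
    by (rule tyd_psubst[OF \<theta>(1)[OF that] subset_UNIV \<sigma>_tsub]) simp
  have r\<rho>: "red\<^sup>*\<^sup>* (psubst (\<sigma> id) (\<theta> x)) (\<rho> x)" if "x \<in> \<Sigma>" for x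
    unfolding \<rho>_def by (rule reds_nf[OF h\<theta>[OF that]])
  have fv\<rho>: "fv (\<rho> x) \<subseteq> fst w \<union> y ` ?S" if "x \<in> \<Sigma>" for x
  proof -
    have "fv (\<rho> x) \<subseteq> fv (psubst (\<sigma> id) (\<theta> x))" by (rule reds_fv[OF r\<rho>[OF that]])
    also have "\<dots> \<subseteq> fst w \<union> y ` ?S"
      using fv_psubst[of "\<sigma> id" "\<theta> x"] \<theta>[OF that] by (auto split: if_splits)
    finally show ?thesis .
  qed
  have supp\<rho>: "supp (\<rho> x) = {}" if "x \<in> \<Sigma>" for x
  proof -
    have "supp (\<rho> x) \<subseteq> supp (psubst (\<sigma> id) (\<theta> x))" by (rule reds_supp[OF r\<rho>[OF that]])
    also have "\<dots> \<subseteq> (\<Union>d\<in>supp (\<theta> x). supp (\<sigma> id (Nom d)))"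
      using supp_psubst[of "\<sigma> id" "\<theta> x"] by simp
    also have "\<dots> = {}" using \<theta>(3)[OF that] by auto
    finally show ?thesis by simp
  qed
  have sub: "is_subst \<Sigma> \<rho>"
    unfolding is_subst_def
  proof (intro conjI ballI)
    have "o_free (snd z)" if "z \<in> fst w \<union> y ` ?S" for z
      using that sigw Sn nominal_ok by (auto simp: is_sig_def y_def nominal_types_ok_def)
    moreover have "subst_sig \<rho> \<Sigma> \<subseteq> fst w \<union> y ` ?S"
      unfolding subst_sig_def using fv\<rho> by blast
    moreover have "finite (subst_sig \<rho> \<Sigma>)"
      using sig\<Sigma> by (simp add: subst_sig_def is_sig_def)
    ultimately show "is_sig (subst_sig \<rho> \<Sigma>)" unfolding is_sig_def by blast
    fix x assume x: "x \<in> \<Sigma>"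
    show "is_term (subst_sig \<rho> \<Sigma>) (\<rho> x) (snd x)"
      using has_type_nf[OF h\<theta>[OF x]] normal_nf[OF h\<theta>[OF x]] x
      by (auto simp: is_term_def \<rho>_def subst_sig_def)
  qed (rule supp\<rho>)
  note p = avoids_perm[OF \<pi>]
  \<comment> \<open>\<sigma> turns the nominal constants of \<theta> into variables, while
    \<open>inv \<pi>\<close> restores those of \<open>s\<close> and \<open>t\<close>, which \<pi>
    keeps apart from them. So the equation between the instances under \<theta> becomes a
    unification by \<rho>.\<close>
  have unif: "act (\<sigma> (inv \<pi>)) (act (vsub \<theta> \<pi>) u) = act (msubst \<rho>) u"
    if u: "is_term \<Sigma> u \<tau>" "supp u \<subseteq> supp s \<union> supp t" for u
  proof -
    let ?f = "\<lambda>a. psubst (\<sigma> (inv \<pi>)) (vsub \<theta> \<pi> a)"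
    note ip = is_perm_inv[OF p]
    note ts = \<sigma>_tsub[OF ip, of UNIV]
    have tv: "tsub \<Sigma> (vsub \<theta> \<pi>)" by (rule ghom_tsub[OF ghom_vsub[OF v p]])
    have u': "tyd u \<tau>" "fv u \<subseteq> \<Sigma>" using u by (auto simp: is_term_def)
    have "act (\<sigma> (inv \<pi>)) (act (vsub \<theta> \<pi>) u) = act ?f u"
      by (rule act_act[OF u' tv subset_UNIV ts])
    also have "\<dots> = act (msubst \<rho>) u"
    proof (rule act_cong_reds[OF u'])
      show "tsub \<Sigma> ?f"
        using tv tyd_psubst[OF _ subset_UNIV ts] unfolding tsub_def by blast
      fix x assume "x \<in> fv u"
      then have x: "x \<in> \<Sigma>" using u' by auto
      have "psubst (\<sigma> (inv \<pi>)) (\<theta> x) = psubst (\<sigma> id) (\<theta> x)"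
        by (rule psubst_cong) (use \<theta>(3)[OF x] in auto)
      then show "red\<^sup>*\<^sup>* (?f (Var x)) (msubst \<rho> (Var x))" using r\<rho>[OF x] by simp
    next
      fix a assume "a \<in> supp u"
      then have "\<pi> a \<notin> ?S" using u(2) \<pi> by (auto simp: avoids_def)
      then show "?f (Nom a) = msubst \<rho> (Nom a)" using p by (simp add: is_perm_def bij_is_inj)
    qed simp_all
    finally show ?thesis .
  qed
  define \<theta>' :: "'b var \<Rightarrow> ('b, 'k, 'n) tm" where "\<theta>' z = (if z \<in> y ` ?S then Nom (inv_into ?S y z) else Var z)" for z
  have \<theta>'y: "\<theta>' (y d) = Nom d" if "d \<in> ?S" for d
    using that y_inj by (simp add: \<theta>'_def)
  have \<theta>'w: "\<theta>' z = Var z" if "z \<in> fst w" for z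
    using that y_fresh by (auto simp: \<theta>'_def)
  have "tyd (\<theta>' z) (snd z) \<and> fv (\<theta>' z) \<subseteq> fst w" if z: "z \<in> subst_sig \<rho> \<Sigma>" for z
  proof -
    from z fv\<rho> have "z \<in> fst w \<or> z \<in> y ` ?S" by (auto simp: subst_sig_def)
    then show ?thesis
    proof
      assume "z \<in> fst w"
      then show ?thesis using \<theta>'w has_type.intros(2)[of "[]" z] by simp
    next
      assume "z \<in> y ` ?S"
      then obtain d where d: "d \<in> ?S" "z = y d" by blast
      moreover have "snd (y d) = ntype d" by (simp add: y_def)
      ultimately show ?thesis using \<theta>'y[OF d(1)] has_type.intros(3)[OF Sn[OF d(1)], of "[]"] by simp
    qed
  qed
  then have v': "val (subst_sig \<rho> \<Sigma>) w \<theta>'" using sub val_wf[OF v] by (simp add: val_def is_subst_def)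
  have S': "vsupp (subst_sig \<rho> \<Sigma>) \<theta>' \<subseteq> ?S"
    using inv_into_into[of _ y ?S] by (force simp: vsupp_def[of "subst_sig \<rho> \<Sigma>"] \<theta>'_def split: if_splits)
  have iff: "holds (subst_sig \<rho> \<Sigma>) w \<theta>' (nf (msubst \<rho> X)) \<longleftrightarrow> holds \<Sigma> w \<theta> X" if X: "is_term \<Sigma> X Prop" for X
  proof -
    obtain \<pi>' where \<pi>': "avoids \<Sigma> \<theta> \<pi>' (supp X)" using avoids_term_exists[OF v X] .
    note p' = avoids_perm[OF \<pi>']
    have X': "tyd X Prop" "fv X \<subseteq> \<Sigma>" using X by (auto simp: is_term_def)
    note g = khom_ghom[OF khom_msubst[OF sub]]
    note \<rho>X = nf_msubst[OF sub X]
    have T: "is_term (subst_sig \<rho> \<Sigma>) (act (msubst \<rho>) X) Prop" by (rule is_term_act[OF g X])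
    have "supp (act (msubst \<rho>) X) \<subseteq> (\<Union>x\<in>fv X. supp (msubst \<rho> (Var x))) \<union> id ` supp X"
      by (rule act_supp[OF g _ X]) simp
    also have "\<dots> = supp X" using supp\<rho> X'(2) by auto
    finally have a: "avoids (subst_sig \<rho> \<Sigma>) \<theta>' \<pi>' (supp (act (msubst \<rho>) X))"
      using \<pi>' S' by (auto simp: avoids_def)
    let ?f = "\<lambda>a. psubst (vsub \<theta>' \<pi>') (msubst \<rho> a)"
    have tv: "tsub \<Sigma> (vsub \<theta> \<pi>')" by (rule ghom_tsub[OF ghom_vsub[OF v p']])
    have "act (vsub \<theta>' \<pi>') (act (msubst \<rho>) X) = act ?f X"
      by (rule act_act[OF X' ghom_tsub[OF g] ghom_fv[OF g X'(2)] ghom_tsub[OF ghom_vsub[OF v' p']]])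
    also have "\<dots> = act (vsub \<theta> \<pi>') X"
    proof (rule act_cong_reds[OF X' tv, symmetric])
      fix x assume "x \<in> fv X"
      then have x: "x \<in> \<Sigma>" using X' by auto
      \<comment> \<open>All nominal constants of \<open>\<theta> x\<close> have become variables
        under \<sigma>, so \<pi>' does not touch them and \<theta>' maps them back.\<close>
      have "psubst (vsub \<theta>' \<pi>') (psubst (\<sigma> id) (\<theta> x)) = \<theta> x"
        unfolding psubst_psubst
        by (rule psubst_idle[OF \<theta>(1)[OF x]]) (use \<theta>(2,3)[OF x] \<theta>'w \<theta>'y in auto)
      then show "red\<^sup>*\<^sup>* (vsub \<theta> \<pi>' (Var x)) (?f (Var x))"
        using reds_psubst[OF r\<rho>[OF x], of "vsub \<theta>' \<pi>'"] by simp
    qed simp_all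
    finally show ?thesis
      unfolding \<rho>X holds_iff[OF v' T a] holds_iff[OF v X \<pi>'] by simp
  qed
  show ?thesis
  proof (rule that[OF sub _ v' iff])
    show "act (msubst \<rho>) s = act (msubst \<rho>) t" using unif[OF s] unif[OF t] eq by simp
  qed
qed

lemma sound_eqL:
  assumes seq: "is_sequent (\<Sigma>;; add_mset (Eq \<tau> s t) \<Gamma> \<turnstile> C)" and cs: "lists_supp cs (Eq \<tau> s t)"
    and prem: "\<And>\<theta>. is_subst \<Sigma> \<theta> \<Longrightarrow> nf (msubst \<theta> (abs_noms cs s)) = nf (msubst \<theta> (abs_noms cs t)) \<Longrightarrow>
      sound (subst_sig \<theta> \<Sigma>;; image_mset (\<lambda>B. nf (msubst \<theta> B)) \<Gamma> \<turnstile> nf (msubst \<theta> C))"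
  shows "sound (\<Sigma>;; add_mset (Eq \<tau> s t) \<Gamma> \<turnstile> C)"
  unfolding sound_iff
proof (intro allI impI)
  fix w \<theta> assume v: "val \<Sigma> w \<theta>" and \<Gamma>: "\<forall>X\<in>#add_mset (Eq \<tau> s t) \<Gamma>. holds \<Sigma> w \<theta> X"
  have E: "is_term \<Sigma> (Eq \<tau> s t) Prop" and C: "is_term \<Sigma> C Prop" using seq by auto
  have st: "is_term \<Sigma> s \<tau>" "is_term \<Sigma> t \<tau>" using E by (simp_all add: is_term_const_iff)
  obtain \<pi> where \<pi>: "avoids \<Sigma> \<theta> \<pi> (supp (Eq \<tau> s t))" using avoids_term_exists[OF v E] .
  note g = ghom_vsub[OF v avoids_perm[OF \<pi>]]
  have "holds \<Sigma> w \<theta> (Eq \<tau> s t)" using \<Gamma> by simp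
  from this[unfolded holds_iff[OF v E \<pi>] act_form(7)[OF g E] forces_eq_iff] v C
  show "holds \<Sigma> w \<theta> C"
  proof (rule holds_run)
    fix w' r assume r: "mor r w w'" and eq: "act r (act (vsub \<theta> \<pi>) s) = act r (act (vsub \<theta> \<pi>) t)"
    obtain \<pi>' where \<pi>': "\<And>X \<tau>. is_term \<Sigma> X \<tau> \<Longrightarrow> act r (act (vsub \<theta> \<pi>) X) = act (vsub (cmp_val r \<theta>) \<pi>') X"
      "\<And>A. avoids \<Sigma> \<theta> \<pi> A \<Longrightarrow> avoids \<Sigma> (cmp_val r \<theta>) \<pi>' A"
      using vsub_mor[OF v r avoids_perm[OF \<pi>]] by blast
    have a: "avoids \<Sigma> (cmp_val r \<theta>) \<pi>' (supp s \<union> supp t)" using \<pi>'(2)[OF \<pi>] by simp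
    have eq': "act (vsub (cmp_val r \<theta>) \<pi>') s = act (vsub (cmp_val r \<theta>) \<pi>') t"
      using eq \<pi>'(1)[OF st(1)] \<pi>'(1)[OF st(2)] by simp
    obtain \<rho> \<theta>' where \<rho>: "is_subst \<Sigma> \<rho>" "act (msubst \<rho>) s = act (msubst \<rho>) t" "val (subst_sig \<rho> \<Sigma>) w' \<theta>'"
      "\<And>X. is_term \<Sigma> X Prop \<Longrightarrow> holds (subst_sig \<rho> \<Sigma>) w' \<theta>' (nf (msubst \<rho> X)) \<longleftrightarrow> holds \<Sigma> w' (cmp_val r \<theta>) X"
      using unifier_without_nominals[OF val_mor[OF v r] st a eq'] by blast
    have csn: "\<And>c. c \<in> set cs \<Longrightarrow> ntype c \<in> nominal"
      using lists_supp_nominal[OF cs] E by (auto simp: is_term_def)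
    have "sound (subst_sig \<rho> \<Sigma>;; image_mset (\<lambda>B. nf (msubst \<rho> B)) \<Gamma> \<turnstile> nf (msubst \<rho> C))"
      by (rule prem[OF \<rho>(1)]) (use unify_abs_noms_iff[OF \<rho>(1) st csn] \<rho>(2) in blast)
    then have "holds (subst_sig \<rho> \<Sigma>) w' \<theta>' (nf (msubst \<rho> C))"
    proof (rule soundD[OF _ \<rho>(3)])
      fix Y assume "Y \<in># image_mset (\<lambda>B. nf (msubst \<rho> B)) \<Gamma>"
      then obtain X where X: "X \<in># \<Gamma>" "Y = nf (msubst \<rho> X)" by auto
      have tX: "is_term \<Sigma> X Prop" using seq X(1) by simp
      have "holds \<Sigma> w \<theta> X" using \<Gamma> X(1) by simp
      then show "holds (subst_sig \<rho> \<Sigma>) w' \<theta>' Y"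
        unfolding X(2) \<rho>(4)[OF tX] by (rule holds_mor[OF _ v tX r])
    qed
    then show "holds \<Sigma> w' (cmp_val r \<theta>) C" using \<rho>(4)[OF C] by blast
  qed
qed

section \<open>Soundness of all rules and the conclusion\<close>

lemma sound_rule:
  assumes "LG_rule Ps S" "is_sequent S" "\<And>P. P \<in> Ps \<Longrightarrow> is_sequent P" "\<And>P. P \<in> Ps \<Longrightarrow> sound P"
  shows "sound S"
  using assms
proof cases
  case (id_perm \<pi> \<pi>' B B' \<Sigma> \<Gamma>)
  show ?thesis
    unfolding id_perm sound_iff
    using assms(2) holds_perm_eq[OF _ _ _ id_perm(3-5)] by (simp add: id_perm)
next
  case (cL \<Sigma> B \<Gamma> C)
  have "sound (\<Sigma>;; add_mset B (add_mset B \<Gamma>) \<turnstile> C)" using assms(4) cL by simp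
  then show ?thesis unfolding cL sound_iff by simp
next
  case (botL \<Sigma> \<Gamma> C)
  show ?thesis unfolding botL sound_iff using assms(2) holds_bot by (simp add: botL)
next
  case (topR \<Sigma> \<Gamma>)
  show ?thesis unfolding topR sound_iff using holds_top by blast
next
  case (andL1 \<Sigma> B \<Gamma> D C)
  have "sound (\<Sigma>;; add_mset B \<Gamma> \<turnstile> D)" using assms(4) andL1 by simp
  then show ?thesis unfolding andL1 sound_iff using assms(2) holds_conj_iff by (simp add: andL1)
next
  case (andL2 \<Sigma> C \<Gamma> D B)
  have "sound (\<Sigma>;; add_mset C \<Gamma> \<turnstile> D)" using assms(4) andL2 by simp
  then show ?thesis unfolding andL2 sound_iff using assms(2) holds_conj_iff by (simp add: andL2)
next
  case (andR \<Sigma> \<Gamma> B C)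
  have "sound (\<Sigma>;; \<Gamma> \<turnstile> B)" "sound (\<Sigma>;; \<Gamma> \<turnstile> C)" using assms(4) andR by simp_all
  then show ?thesis unfolding andR sound_iff using assms(2) holds_conj_iff by (simp add: andR)
next
  case (orL \<Sigma> B \<Gamma> D C)
  have p: "sound (\<Sigma>;; add_mset B \<Gamma> \<turnstile> D)" "sound (\<Sigma>;; add_mset C \<Gamma> \<turnstile> D)" using assms(4) orL by simp_all
  have t: "is_term \<Sigma> (Disj B C) Prop" "is_term \<Sigma> D Prop" "\<And>X. X \<in># \<Gamma> \<Longrightarrow> is_term \<Sigma> X Prop"
    using assms(2) by (simp_all add: orL)
  show ?thesis
    unfolding orL sound_iff
  proof (intro allI impI)
    fix w \<theta> assume v: "val \<Sigma> w \<theta>" and \<Gamma>: "\<forall>X\<in>#add_mset (Disj B C) \<Gamma>. holds \<Sigma> w \<theta> X"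
    then have "holds \<Sigma> w \<theta> (Disj B C)" by simp
    from this[unfolded holds_disj_iff[OF v t(1)]] v t(2)
    show "holds \<Sigma> w \<theta> D"
    proof (rule holds_run)
      fix w' s assume s: "mor s w w'" and d: "holds \<Sigma> w' (cmp_val s \<theta>) B \<or> holds \<Sigma> w' (cmp_val s \<theta>) C"
      have "holds \<Sigma> w' (cmp_val s \<theta>) X" if "X \<in># \<Gamma>" for X
        using holds_mor[OF _ v t(3)[OF that] s] \<Gamma> that by simp
      then show "holds \<Sigma> w' (cmp_val s \<theta>) D"
        using d soundD[OF p(1) val_mor[OF v s]] soundD[OF p(2) val_mor[OF v s]] by auto
    qed
  qed
next
  case (orR1 \<Sigma> \<Gamma> B C)
  have "sound (\<Sigma>;; \<Gamma> \<turnstile> B)" using assms(4) orR1 by simp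
  then show ?thesis unfolding orR1 sound_iff using assms(2) holds_disjI by (simp add: orR1)
next
  case (orR2 \<Sigma> \<Gamma> C B)
  have "sound (\<Sigma>;; \<Gamma> \<turnstile> C)" using assms(4) orR2 by simp
  then show ?thesis unfolding orR2 sound_iff using assms(2) holds_disjI by (simp add: orR2)
next
  case (impL \<Sigma> \<Gamma> B C D)
  have p: "sound (\<Sigma>;; \<Gamma> \<turnstile> B)" "sound (\<Sigma>;; add_mset C \<Gamma> \<turnstile> D)" using assms(4) impL by simp_all
  have t: "is_term \<Sigma> (Imp B C) Prop" using assms(2) by (simp add: impL)
  show ?thesis
    unfolding impL sound_iff
  proof (intro allI impI)
    fix w \<theta> assume v: "val \<Sigma> w \<theta>" and \<Gamma>: "\<forall>X\<in>#add_mset (Imp B C) \<Gamma>. holds \<Sigma> w \<theta> X"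
    have "holds \<Sigma> w \<theta> B" using soundD[OF p(1) v] \<Gamma> by simp
    moreover have "holds \<Sigma> w \<theta> (Imp B C)" using \<Gamma> by simp
    ultimately have "holds \<Sigma> w \<theta> C"
      unfolding holds_imp_iff[OF v t] using mor_id[OF val_wf[OF v]] by (metis cmp_val_id)
    then show "holds \<Sigma> w \<theta> D" using soundD[OF p(2) v] \<Gamma> by auto
  qed
next
  case (impR \<Sigma> B \<Gamma> C)
  have p: "sound (\<Sigma>;; add_mset B \<Gamma> \<turnstile> C)" using assms(4) impR by simp
  have t: "is_term \<Sigma> (Imp B C) Prop" "\<And>X. X \<in># \<Gamma> \<Longrightarrow> is_term \<Sigma> X Prop" using assms(2) by (simp_all add: impR)
  show ?thesis
    unfolding impR sound_iff
  proof (intro allI impI)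
    fix w \<theta> assume v: "val \<Sigma> w \<theta>" and \<Gamma>: "\<forall>X\<in>#\<Gamma>. holds \<Sigma> w \<theta> X"
    show "holds \<Sigma> w \<theta> (Imp B C)"
      unfolding holds_imp_iff[OF v t(1)]
    proof (intro allI impI)
      fix w' s assume s: "mor s w w'" and B: "holds \<Sigma> w' (cmp_val s \<theta>) B"
      have "holds \<Sigma> w' (cmp_val s \<theta>) X" if "X \<in># \<Gamma>" for X
        using holds_mor[OF _ v t(2)[OF that] s] \<Gamma> that by simp
      then show "holds \<Sigma> w' (cmp_val s \<theta>) C" using soundD[OF p val_mor[OF v s]] B by auto
    qed
  qed
next
  case (allL \<Sigma> t \<tau> F \<Gamma> C)
  have p: "sound (\<Sigma>;; add_mset (nf (F \<cdot> t)) \<Gamma> \<turnstile> C)" using assms(4) allL by simp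
  show ?thesis
    unfolding allL sound_iff
  proof (intro allI impI)
    fix w \<theta> assume v: "val \<Sigma> w \<theta>" and \<Gamma>: "\<forall>X\<in>#add_mset (Forall \<tau> F) \<Gamma>. holds \<Sigma> w \<theta> X"
    have "holds \<Sigma> w \<theta> (nf (F \<cdot> t))"
      using holds_allD[OF v _ allL(3), of F] \<Gamma> assms(2) by (simp add: allL)
    then show "holds \<Sigma> w \<theta> C" using soundD[OF p v] \<Gamma> by auto
  qed
next
  case (allR cs F h n \<tau> \<Sigma> \<Gamma>)
  show ?thesis
    unfolding allR
    by (rule sound_allR[OF _ allR(3,4,5)]) (use assms(2-4) allR in auto)
next
  case (exL cs F h n \<tau> \<Sigma> \<Gamma> C)
  show ?thesis
    unfolding exL
    by (rule sound_exL[OF _ exL(3,4,5)]) (use assms(2-4) exL in auto)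
next
  case (exR \<Sigma> t \<tau> \<Gamma> F)
  have p: "sound (\<Sigma>;; \<Gamma> \<turnstile> nf (F \<cdot> t))" using assms(4) exR by simp
  show ?thesis
    unfolding exR sound_iff
  proof (intro allI impI)
    fix w \<theta> assume v: "val \<Sigma> w \<theta>" and \<Gamma>: "\<forall>X\<in>#\<Gamma>. holds \<Sigma> w \<theta> X"
    have "holds \<Sigma> w \<theta> (nf (F \<cdot> t))" using soundD[OF p v] \<Gamma> by blast
    then show "holds \<Sigma> w \<theta> (Exists \<tau> F)"
      using holds_exI[OF v _ exR(3)] assms(2) by (simp add: exR)
  qed
next
  case (nablaL a \<tau> F \<Sigma> \<Gamma> C)
  have "sound (\<Sigma>;; add_mset (nf (F \<cdot> Nom a)) \<Gamma> \<turnstile> C)" using assms(4) nablaL by simp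
  then show ?thesis
    unfolding nablaL sound_iff using assms(2) holds_nabla_iff[OF _ _ nablaL(3,4)] by (simp add: nablaL)
next
  case (nablaR a \<tau> F \<Sigma> \<Gamma>)
  have "sound (\<Sigma>;; \<Gamma> \<turnstile> nf (F \<cdot> Nom a))" using assms(4) nablaR by simp
  then show ?thesis
    unfolding nablaR sound_iff using assms(2) holds_nabla_iff[OF _ _ nablaR(3,4)] by (simp add: nablaR)
next
  case (eqL cs \<tau> s t \<Sigma> \<Gamma> C)
  show ?thesis
    unfolding eqL by (rule sound_eqL[OF _ eqL(3)]) (use assms(2,4) eqL in auto)
next
  case (eqR \<Sigma> \<Gamma> \<tau> t)
  show ?thesis unfolding eqR sound_iff using assms(2) holds_eq_refl by (simp add: eqR)
next
  case (defL p xs B ts \<Sigma> \<Gamma> C)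
  have "sound (\<Sigma>;; add_mset (inst B xs ts) \<Gamma> \<turnstile> C)" using assms(4) defL by simp
  then show ?thesis
    unfolding defL sound_iff using assms(2) holds_clause_iff[OF _ _ defL(3,4)] by (simp add: defL)
next
  case (defR p xs B ts \<Sigma> \<Gamma>)
  have "sound (\<Sigma>;; \<Gamma> \<turnstile> inst B xs ts)" using assms(4) defR by simp
  then show ?thesis
    unfolding defR sound_iff using assms(2) holds_clause_iff[OF _ _ defR(3,4)] by (simp add: defR)
next
  case (natL D j n \<Sigma> I \<Gamma> C)
  have p: "sound ({};; {#} \<turnstile> nf (D \<cdot> Zero))" "sound ({j};; {#nf (D \<cdot> Var j)#} \<turnstile> nf (D \<cdot> Succ (Var j)))"
    "sound (\<Sigma>;; add_mset (nf (D \<cdot> I)) \<Gamma> \<turnstile> C)"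
    using assms(4) natL by simp_all
  show ?thesis
    unfolding natL sound_iff
  proof (intro allI impI)
    fix w \<theta> assume v: "val \<Sigma> w \<theta>" and \<Gamma>: "\<forall>X\<in>#add_mset (NatP I) \<Gamma>. holds \<Sigma> w \<theta> X"
    have "holds \<Sigma> w \<theta> (nf (D \<cdot> I))"
      using holds_nat_elim[OF natL(3,4) p(1,2) v, of I] \<Gamma> assms(2) by (simp add: natL is_term_const_iff)
    then show "holds \<Sigma> w \<theta> C" using soundD[OF p(3) v] \<Gamma> by auto
  qed
next
  case (natR_zero \<Sigma> \<Gamma>)
  show ?thesis unfolding natR_zero sound_iff using holds_nat_zero by blast
next
  case (natR_succ \<Sigma> \<Gamma> I)
  have "sound (\<Sigma>;; \<Gamma> \<turnstile> NatP I)" using assms(4) natR_succ by simp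
  then show ?thesis
    unfolding natR_succ sound_iff using assms(2) holds_nat_succ by (simp add: natR_succ is_term_const_iff)
qed

text \<open>At a fixed world and valuation a cut is mere transitivity: the side premises make the
  cut formulas hold, and the main premise uses them.\<close>

lemma sound_multicut:
  assumes "multicut Ps S" "\<And>P. P \<in> Ps \<Longrightarrow> sound P"
  shows "sound S"
  using assms(1)
proof cases
  case (mc \<Sigma> \<Delta>Bs \<Gamma> C)
  have main: "sound (\<Sigma>;; mset (map snd \<Delta>Bs) + \<Gamma> \<turnstile> C)" using assms(2) mc(1) by blast
  have side: "sound (\<Sigma>;; \<Delta> \<turnstile> B)" if "(\<Delta>, B) \<in> set \<Delta>Bs" for \<Delta> B using assms(2) mc(1) that by blast
  have sub: "set_mset \<Delta> \<subseteq> set_mset (sum_list (map fst \<Delta>Bs))" if "(\<Delta>, B) \<in> set \<Delta>Bs" for \<Delta> B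
    using that by (induction \<Delta>Bs) auto
  show ?thesis
    unfolding mc(2) sound_iff
  proof (intro allI impI)
    fix w \<theta> assume v: "val \<Sigma> w \<theta>" and \<Gamma>: "\<forall>X\<in>#sum_list (map fst \<Delta>Bs) + \<Gamma>. holds \<Sigma> w \<theta> X"
    have "holds \<Sigma> w \<theta> B" if "(\<Delta>, B) \<in> set \<Delta>Bs" for \<Delta> B
      using soundD[OF side[OF that] v] sub[OF that] \<Gamma> by auto
    then show "holds \<Sigma> w \<theta> C"
      using \<Gamma> by (intro soundD[OF main v]) auto
  qed
qed

lemma derivable_mc_sound:
  assumes "derivable_mc S"
  shows "is_sequent S \<and> sound S"
  using assms unfolding derivable_mc_def
proof (induction rule: derivable.induct)
  case (1 Ps S)
  then show ?case using sound_rule[of Ps S] sound_multicut[of Ps S] by blast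
qed

theorem cut_admissible:
  assumes "derivable_mc (\<Sigma>;; \<Gamma> \<turnstile> C)"
  shows "derivable_mc_free (\<Sigma>;; \<Gamma> \<turnstile> C)"
proof -
  let ?w = "(\<Sigma>, \<Gamma>)"
  have seq: "is_sequent (\<Sigma>;; \<Gamma> \<turnstile> C)" and snd: "sound (\<Sigma>;; \<Gamma> \<turnstile> C)"
    using derivable_mc_sound[OF assms] by auto
  then have w: "wf_world ?w" and C: "is_term \<Sigma> C Prop" by (auto simp: wf_world_def)
  \<comment> \<open>The sequent is evaluated in its own world under the identity valuation. Its
    values have no nominal constants, so the identity renaming avoids them and every formula denotes
    itself.\<close>
  have v: "val \<Sigma> ?w Var" using w has_type.intros(2)[of "[]"] by (simp add: val_def wf_world_def)
  have a: "avoids \<Sigma> Var id A" for A by (simp add: avoids_def vsupp_def)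
  have id: "act (vsub Var id) X = X" if "is_term \<Sigma> X Prop" for X
    using that by (simp add: act_def psubst_id is_term_def nf_normal)
  have "holds \<Sigma> ?w Var X" if "X \<in># \<Gamma>" for X
  proof -
    have X: "is_term \<Sigma> X Prop" using seq that by simp
    show ?thesis unfolding holds_iff[OF v X a] id[OF X] by (rule forces_context[OF w]) (simp add: that)
  qed
  then have "holds \<Sigma> ?w Var C" by (rule soundD[OF snd v])
  then have "forces ?w C" unfolding holds_iff[OF v C a] id[OF C] .
  then show ?thesis using reify[OF w] C by (simp add: der_def)
qed

end

theorem theorem1:
  fixes ktype :: "'k \<Rightarrow> 'b ty"
    and ntype :: "'n \<Rightarrow> 'b ty"
    and nominal :: "'b ty set"
    and clause :: "'k \<Rightarrow> ('b var list \<times> ('b, 'k, 'n) tm) option"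
    and lvl :: "'k \<Rightarrow> nat" and lvl_nat :: nat
    and \<Sigma> :: "'b var set"
    and \<Gamma> :: "('b, 'k, 'n) tm multiset"
    and C :: "('b, 'k, 'n) tm"
  assumes "LG.nominal_types_ok ntype nominal"
    and "LG.stratified ktype ntype nominal clause lvl lvl_nat"
    and "LG.derivable_mc ktype ntype nominal clause (\<Sigma>;; \<Gamma> \<turnstile> C)"
  shows "LG.derivable_mc_free ktype ntype nominal clause (\<Sigma>;; \<Gamma> \<turnstile> C)"
proof -
  interpret stratified_LG ktype ntype nominal clause lvl lvl_nat
    by unfold_locales (use assms(1,2) in auto)
  show ?thesis using assms(3) by (rule cut_admissible)
qed

end
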